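(* Let $G$ be a group acting geometrically on a finite-dimensional proper geodesic metric space $(X,d)$ which possesses a consistent, conical, $G$-equivariant geodesic bicombing $\sigma$. Then $G$ admits an EZ-structure.
   Context: Dimension is covering dimension. A metric space is proper if closed balls are compact. An action of $G$ on a metric space $X$ via isometries is geometric if it is proper, i.e. $\{g\in G: gK\cap K\neq\emptyset\}$ is finite for every compact $K\subseteq X$, and cocompact, i.e. $G\backslash X$ is compact. A (geodesic) bicombing on a geodesic metric space $(X,d)$ is a continuous map $\sigma\colon X\times X\times[0,1]\to X$ such that each $\sigma_{xy}:=\sigma(x,y,\cdot)$ is a constant speed geodesic from $x$ to $y$. It is consistent if $\operatorname{im}\sigma_{\sigma_{xy}(s),\sigma_{xy}(t)}=\operatorname{im}\sigma_{xy}|_{[s,t]}$ for all $x,y\in X$, $0\le s<t\le 1$; conical if $d(\sigma_{xy}(t),\sigma_{x'y'}(t))\le(1-t)d(x,x')+t\,d(y,y')$ for all $x,y,x',y'\in X$, $t\in[0,1]$; $G$-equivariant if $g\sigma_{xy}=\sigma_{gx,gy}$ for all $g\in G$, $x,y\in X$. A space is a Euclidean retract (ER) if it can be embedded in some Euclidean space as a retract of it. A compact subset $Z$ of a compact space $\mathfrak X$ is a Z-set in $\mathfrak X$ if there is a homotopy $\{H_t\colon\mathfrak X\to\mathfrak X: t\in[0,1]\}$ with $H_0=\mathrm{id}_{\mathfrak X}$ and $H_t(\mathfrak X)\cap Z=\emptyset$ for all $t>0$. EZ-structure: let $\mathfrak X$ be a compact space, $Z\subseteq\mathfrak X$ a compact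 subset, and let $G$ act geometrically on $\mathfrak X\setminus Z$ (equipped with a metric inducing its topology). The pair $(\mathfrak X,Z)$ is an EZ-structure for $G$ if: $\mathfrak X$ is an ER; $Z$ is a Z-set in $\mathfrak X$; for every compact $K\subseteq\mathfrak X\setminus Z$ and every open cover $\mathcal U$ of $\mathfrak X$, for all but finitely many $g\in G$ the translate $gK$ is contained in some element of $\mathcal U$; and the action of $G$ on $\mathfrak X\setminus Z$ extends to an action by homeomorphisms on $\mathfrak X$. $G$ admits an EZ-structure if such a pair exists. *)

theory Defs
  imports "HOL-Analysis.Analysis" "HOL-Algebra.Group_Action"
begin

definition open_cover_of :: "'a topology \<Rightarrow> 'a set set \<Rightarrow> bool" where
  "open_cover_of X \<U> \<longleftrightarrow> (\<forall>U\<in>\<U>. openin X U) \<and> \<Union>\<U> = topspace X"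

text \<open>Covers are arbitrary, not only finite; on metrizable spaces both versions of the covering
  dimension agree.\<close>

definition covering_dim_le :: "'a topology \<Rightarrow> nat \<Rightarrow> bool" where
  "covering_dim_le X n \<longleftrightarrow>
     (\<forall>\<U>. open_cover_of X \<U> \<longrightarrow>
        (\<exists>\<V>. open_cover_of X \<V> \<and> (\<forall>V\<in>\<V>. \<exists>U\<in>\<U>. V \<subseteq> U) \<and>
           (\<forall>x\<in>topspace X. finite {V\<in>\<V>. x \<in> V} \<and> card {V\<in>\<V>. x \<in> V} \<le> n + 1)))"

definition finite_dimensional :: "'a topology \<Rightarrow> bool" where
  "finite_dimensional X \<longleftrightarrow> (\<exists>n. covering_dim_le X n)"

definition proper_metric_space :: "'a metric \<Rightarrow> bool" where
  "proper_metric_space m \<longleftrightarrow>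
     (\<forall>x\<in>mspace m. \<forall>r. compactin (mtopology_of m) (mcball_of m x r))"

definition constant_speed_geodesic :: "'a metric \<Rightarrow> (real \<Rightarrow> 'a) \<Rightarrow> 'a \<Rightarrow> 'a \<Rightarrow> bool" where
  "constant_speed_geodesic m c x y \<longleftrightarrow>
     c \<in> {0..1} \<rightarrow> mspace m \<and> c 0 = x \<and> c 1 = y \<and>
     (\<forall>s\<in>{0..1}. \<forall>t\<in>{0..1}. mdist m (c s) (c t) = \<bar>s - t\<bar> * mdist m x y)"

definition geodesic_metric_space :: "'a metric \<Rightarrow> bool" where
  "geodesic_metric_space m \<longleftrightarrow>
     (\<forall>x\<in>mspace m. \<forall>y\<in>mspace m. \<exists>c. constant_speed_geodesic m c x y)"

definition quotient_topology :: "'a topology \<Rightarrow> ('a \<Rightarrow> 'b) \<Rightarrow> 'b topology" where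
  "quotient_topology X q =
     topology (\<lambda>U. U \<subseteq> q ` topspace X \<and> openin X {x \<in> topspace X. q x \<in> U})"

lemma openin_quotient_topology:
  "openin (quotient_topology X q) U \<longleftrightarrow>
     U \<subseteq> q ` topspace X \<and> openin X {x \<in> topspace X. q x \<in> U}"
proof -
  have "istopology (\<lambda>U. U \<subseteq> q ` topspace X \<and> openin X {x \<in> topspace X. q x \<in> U})"
  proof -
    have *: "{x \<in> topspace X. q x \<in> S \<inter> T} =
        {x \<in> topspace X. q x \<in> S} \<inter> {x \<in> topspace X. q x \<in> T}" for S T
      by auto
    have **: "{x \<in> topspace X. q x \<in> \<Union>\<K>} = (\<Union>K\<in>\<K>. {x \<in> topspace X. q x \<in> K})" for \<K>
      by auto
    show ?thesis
      unfolding istopology_def * ** by blast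
  qed
  then show ?thesis
    by (simp add: quotient_topology_def topology_inverse')
qed

lemma topspace_quotient_topology [simp]:
  "topspace (quotient_topology X q) = q ` topspace X"
proof -
  have "openin (quotient_topology X q) (q ` topspace X)"
  proof -
    have "{x \<in> topspace X. q x \<in> q ` topspace X} = topspace X" by auto
    then show ?thesis by (simp add: openin_quotient_topology)
  qed
  then show ?thesis
    by (metis openin_quotient_topology openin_subset openin_topspace subset_antisym)
qed

lemma quotient_map_quotient_topology: "quotient_map X (quotient_topology X q) q"
  by (simp add: quotient_map_def openin_quotient_topology)

definition isometric_action ::
  "('g, 'k) monoid_scheme \<Rightarrow> 'a metric \<Rightarrow> ('g \<Rightarrow> 'a \<Rightarrow> 'a) \<Rightarrow> bool" where
  "isometric_action G m \<phi> \<longleftrightarrow>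
     group_action G (mspace m) \<phi> \<and>
     (\<forall>g\<in>carrier G. \<forall>x\<in>mspace m. \<forall>y\<in>mspace m. mdist m (\<phi> g x) (\<phi> g y) = mdist m x y)"

definition proper_action ::
  "('g, 'k) monoid_scheme \<Rightarrow> 'a topology \<Rightarrow> ('g \<Rightarrow> 'a \<Rightarrow> 'a) \<Rightarrow> bool" where
  "proper_action G X \<phi> \<longleftrightarrow>
     (\<forall>K. compactin X K \<longrightarrow> finite {g \<in> carrier G. \<phi> g ` K \<inter> K \<noteq> {}})"

definition cocompact_action ::
  "('g, 'k) monoid_scheme \<Rightarrow> 'a topology \<Rightarrow> ('g \<Rightarrow> 'a \<Rightarrow> 'a) \<Rightarrow> bool" where
  "cocompact_action G X \<phi> \<longleftrightarrow> compact_space (quotient_topology X (orbit G \<phi>))"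

definition geometric_action ::
  "('g, 'k) monoid_scheme \<Rightarrow> 'a metric \<Rightarrow> ('g \<Rightarrow> 'a \<Rightarrow> 'a) \<Rightarrow> bool" where
  "geometric_action G m \<phi> \<longleftrightarrow>
     isometric_action G m \<phi> \<and>
     proper_action G (mtopology_of m) \<phi> \<and>
     cocompact_action G (mtopology_of m) \<phi>"

definition geodesic_bicombing :: "'a metric \<Rightarrow> ('a \<Rightarrow> 'a \<Rightarrow> real \<Rightarrow> 'a) \<Rightarrow> bool" where
  "geodesic_bicombing m \<sigma> \<longleftrightarrow>
     continuous_map
       (prod_topology (mtopology_of m)
          (prod_topology (mtopology_of m) (top_of_set {0..1})))
       (mtopology_of m) (\<lambda>(x, y, t). \<sigma> x y t) \<and>
     (\<forall>x\<in>mspace m. \<forall>y\<in>mspace m. constant_speed_geodesic m (\<sigma> x y) x y)"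

definition consistent_bicombing :: "'a metric \<Rightarrow> ('a \<Rightarrow> 'a \<Rightarrow> real \<Rightarrow> 'a) \<Rightarrow> bool" where
  "consistent_bicombing m \<sigma> \<longleftrightarrow>
     (\<forall>x\<in>mspace m. \<forall>y\<in>mspace m. \<forall>s t. 0 \<le> s \<and> s < t \<and> t \<le> 1 \<longrightarrow>
        \<sigma> (\<sigma> x y s) (\<sigma> x y t) ` {0..1} = \<sigma> x y ` {s..t})"

definition conical_bicombing :: "'a metric \<Rightarrow> ('a \<Rightarrow> 'a \<Rightarrow> real \<Rightarrow> 'a) \<Rightarrow> bool" where
  "conical_bicombing m \<sigma> \<longleftrightarrow>
     (\<forall>x\<in>mspace m. \<forall>y\<in>mspace m. \<forall>x'\<in>mspace m. \<forall>y'\<in>mspace m. \<forall>t\<in>{0..1}.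
        mdist m (\<sigma> x y t) (\<sigma> x' y' t) \<le> (1 - t) * mdist m x x' + t * mdist m y y')"

definition equivariant_bicombing ::
  "('g, 'k) monoid_scheme \<Rightarrow> 'a metric \<Rightarrow> ('g \<Rightarrow> 'a \<Rightarrow> 'a) \<Rightarrow> ('a \<Rightarrow> 'a \<Rightarrow> real \<Rightarrow> 'a) \<Rightarrow> bool"
  where
  "equivariant_bicombing G m \<phi> \<sigma> \<longleftrightarrow>
     (\<forall>g\<in>carrier G. \<forall>x\<in>mspace m. \<forall>y\<in>mspace m. \<forall>t\<in>{0..1}.
        \<phi> g (\<sigma> x y t) = \<sigma> (\<phi> g x) (\<phi> g y) t)"

definition euclidean_retract :: "'a topology \<Rightarrow> bool" where
  "euclidean_retract X \<longleftrightarrow>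
     (\<exists>n S. S retract_of_space Euclidean_space n \<and>
            X homeomorphic_space subtopology (Euclidean_space n) S)"

definition Z_set :: "'a topology \<Rightarrow> 'a set \<Rightarrow> bool" where
  "Z_set X Z \<longleftrightarrow>
     (\<exists>H :: real \<times> 'a \<Rightarrow> 'a.
        continuous_map (prod_topology (top_of_set {0..1}) X) X H \<and>
        (\<forall>x\<in>topspace X. H (0, x) = x) \<and>
        (\<forall>t\<in>{0<..1}. (\<lambda>x. H (t, x)) ` topspace X \<inter> Z = {}))"

definition EZ_structure ::
  "('g, 'k) monoid_scheme \<Rightarrow> 'a topology \<Rightarrow> 'a set \<Rightarrow> ('g \<Rightarrow> 'a \<Rightarrow> 'a) \<Rightarrow> bool" where
  "EZ_structure G X Z \<phi> \<longleftrightarrow>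
     compact_space X \<and> compactin X Z \<and>
     (\<exists>m. mspace m = topspace X - Z \<and>
          mtopology_of m = subtopology X (topspace X - Z) \<and>
          geometric_action G m \<phi>) \<and>
     euclidean_retract X \<and>
     Z_set X Z \<and>
     (\<forall>K \<U>. compactin (subtopology X (topspace X - Z)) K \<and> open_cover_of X \<U> \<longrightarrow>
        finite {g \<in> carrier G. \<not> (\<exists>U\<in>\<U>. \<phi> g ` K \<subseteq> U)}) \<and>
     (\<exists>\<psi>. group_action G (topspace X) \<psi> \<and>
          (\<forall>g\<in>carrier G. homeomorphic_map X X (\<psi> g)) \<and>
          (\<forall>g\<in>carrier G. \<forall>x\<in>topspace X - Z. \<psi> g x = \<phi> g x))"

text \<open>HOL cannot quantify existentially over types, so a type has to be chosen for the points of
  the compactification.  Since a Euclidean retract is homeomorphic to a subspace of some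
  \<open>Euclidean_space n\<close>, whose points have type \<open>nat \<Rightarrow> real\<close>, this choice is no restriction:
  see \<open>EZ_structure_imp_admits\<close> below.\<close>

definition admits_EZ_structure :: "('g, 'k) monoid_scheme \<Rightarrow> bool" where
  "admits_EZ_structure G \<longleftrightarrow>
     (\<exists>(X :: (nat \<Rightarrow> real) topology) Z \<phi>. EZ_structure G X Z \<phi>)"

lemma group_action_transfer:
  assumes act: "group_action G E \<phi>"
    and f: "f \<in> E \<rightarrow> E'" and h: "h \<in> E' \<rightarrow> E"
    and hf: "\<And>x. x \<in> E \<Longrightarrow> h (f x) = x" and fh: "\<And>y. y \<in> E' \<Longrightarrow> f (h y) = y"
  shows "group_action G E' (\<lambda>g. \<lambda>y\<in>E'. f (\<phi> g (h y)))"
proof -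
  interpret group_action G E \<phi> by (rule act)
  have gG: "group G" using group_hom group_hom.axioms(1) by blast
  have bij: "bij_betw (\<phi> g) E E" if "g \<in> carrier G" for g
    using bij_prop0 that Bij_def by fastforce
  have bij': "(\<lambda>y\<in>E'. f (\<phi> g (h y))) \<in> Bij E'" if g: "g \<in> carrier G" for g
  proof -
    have "bij_betw f E E'" "bij_betw h E' E"
      using f h hf fh by (auto intro!: bij_betw_byWitness[where f'=h] bij_betw_byWitness[where f'=f])
    then have "bij_betw (f \<circ> (\<phi> g \<circ> h)) E' E'"
      using bij[OF g] by (meson bij_betw_trans)
    then have "bij_betw (\<lambda>y\<in>E'. f (\<phi> g (h y))) E' E'"
      by (subst bij_betw_cong[where g = "f \<circ> (\<phi> g \<circ> h)"]) auto
    then show ?thesis by (simp add: Bij_def)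
  qed
  have hom: "(\<lambda>y\<in>E'. f (\<phi> (g \<otimes>\<^bsub>G\<^esub> g') (h y))) =
      compose E' (\<lambda>y\<in>E'. f (\<phi> g (h y))) (\<lambda>y\<in>E'. f (\<phi> g' (h y)))"
    if g: "g \<in> carrier G" "g' \<in> carrier G" for g g'
  proof
    fix y
    show "(\<lambda>y\<in>E'. f (\<phi> (g \<otimes>\<^bsub>G\<^esub> g') (h y))) y =
      compose E' (\<lambda>y\<in>E'. f (\<phi> g (h y))) (\<lambda>y\<in>E'. f (\<phi> g' (h y))) y"
    proof (cases "y \<in> E'")
      case True
      then have hy: "h y \<in> E" using h by auto
      have "\<phi> g' (h y) \<in> E" using bij[OF g(2)] hy by (auto simp: bij_betw_def)
      moreover have "\<phi> (g \<otimes>\<^bsub>G\<^esub> g') (h y) = \<phi> g (\<phi> g' (h y))"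
        using composition_rule[OF hy g] by simp
      ultimately show ?thesis
        using True f hf by (auto simp: compose_def)
    qed (simp add: compose_def)
  qed
  show ?thesis
    unfolding group_action_def group_hom_def group_hom_axioms_def
    using gG group_BijGroup[of E'] bij' hom
    by (auto simp: hom_def BijGroup_def)
qed

lemma EZ_structure_imp_admits:
  fixes X :: "'a topology"
  assumes EZ: "EZ_structure G X Z \<phi>"
  shows "admits_EZ_structure G"
proof -
  obtain n S where ret: "S retract_of_space Euclidean_space n"
    and hs: "X homeomorphic_space subtopology (Euclidean_space n) S"
    using EZ unfolding EZ_structure_def euclidean_retract_def by blast
  define Y where "Y = subtopology (Euclidean_space n) S"
  obtain f h where fh_maps: "homeomorphic_maps X Y f h"
    using hs unfolding homeomorphic_space_def Y_def by blast
  have cf: "continuous_map X Y f" and ch: "continuous_map Y X h"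
    and hf: "\<And>x. x \<in> topspace X \<Longrightarrow> h (f x) = x"
    and fh: "\<And>y. y \<in> topspace Y \<Longrightarrow> f (h y) = y"
    using fh_maps unfolding homeomorphic_maps_def by auto
  have fX: "\<And>x. x \<in> topspace X \<Longrightarrow> f x \<in> topspace Y"
    and hY: "\<And>y. y \<in> topspace Y \<Longrightarrow> h y \<in> topspace X"
    using cf ch by (auto simp: continuous_map_def)
  have ZX: "Z \<subseteq> topspace X"
    using EZ compactin_subset_topspace by (auto simp: EZ_structure_def)
  define E where "E = topspace X - Z"
  define W where "W = f ` Z"
  define E' where "E' = topspace Y - W"
  have EX: "E \<subseteq> topspace X" and E'Y: "E' \<subseteq> topspace Y" by (auto simp: E_def E'_def)
  have fE: "f x \<in> E'" if "x \<in> E" for x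
    using that fX hf ZX unfolding E_def E'_def W_def by (auto, metis in_mono)
  have hE: "h y \<in> E" if "y \<in> E'" for y
  proof -
    have "h y \<notin> Z"
      using that fh unfolding E'_def W_def by (metis DiffE image_eqI)
    then show ?thesis using that hY by (auto simp: E_def E'_def)
  qed
  have E'f: "E' = f ` E"
    using fE hE fh E'Y by (auto simp: image_iff) (metis subsetD)
  define \<phi>' where "\<phi>' = (\<lambda>g. \<lambda>y\<in>E'. f (\<phi> g (h y)))"
  obtain m where mE: "mspace m = E" and mtop: "mtopology_of m = subtopology X E"
    and geo: "geometric_action G m \<phi>"
    using EZ unfolding EZ_structure_def E_def by blast
  have act: "group_action G E \<phi>"
    using geo mE by (simp add: geometric_action_def isometric_action_def)
  have \<phi>E: "\<phi> g x \<in> E" if "g \<in> carrier G" "x \<in> E" for g x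
    using group_action.element_image[OF act that refl] .
  have act': "group_action G E' \<phi>'"
    unfolding \<phi>'_def
    by (rule group_action_transfer[OF act]) (use fE hE hf fh EX E'Y in auto)
  have \<phi>'f: "\<phi>' g (f x) = f (\<phi> g x)" if "x \<in> E" for g x
    using that fE hf EX by (auto simp: \<phi>'_def)
  define d' where "d' = (\<lambda>x y. mdist m (h x) (h y))"
  interpret M: Metric_space E "mdist m"
    using Metric_space_mspace_mdist[of m] mE by simp
  have MS': "Metric_space E' d'"
  proof
    show "(d' x y = 0) = (x = y)" if "x \<in> E'" "y \<in> E'" for x y
      using that hE fh E'Y M.zero unfolding d'_def by (metis in_mono)
  qed (auto simp: d'_def M.commute intro!: M.triangle hE)
  interpret M': Metric_space E' d' by (rule MS')
  define m' where "m' = metric (E', d')"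
  have m'E: "mspace m' = E'" and m'd: "mdist m' = d'"
    by (auto simp: m'_def)
  have top': "mtopology_of m' = M'.mtopology" by (simp add: m'_def)
  have top: "mtopology_of m = M.mtopology" by (simp add: mtopology_of_def mE)
  have df: "d' (f x) (f y) = mdist m x y" if "x \<in> E" "y \<in> E" for x y
    using that hf EX by (auto simp: d'_def subset_iff)
  have hm1: "homeomorphic_maps M.mtopology M'.mtopology f h"
  proof -
    have "continuous_map M.mtopology M'.mtopology f"
    proof -
      have "\<exists>\<delta>>0. \<forall>x. x \<in> E \<and> mdist m a x < \<delta> \<longrightarrow> d' (f a) (f x) < \<epsilon>"
        if "a \<in> E" "0 < \<epsilon>" for a \<epsilon>
        using that df by (intro exI[of _ \<epsilon>]) auto
      then show ?thesis
        using fE by (auto simp: M.metric_continuous_map[OF MS'])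
    qed
    moreover have "continuous_map M'.mtopology M.mtopology h"
    proof -
      have "\<exists>\<delta>>0. \<forall>x. x \<in> E' \<and> d' a x < \<delta> \<longrightarrow> mdist m (h a) (h x) < \<epsilon>"
        if "a \<in> E'" "0 < \<epsilon>" for a \<epsilon>
        using that by (intro exI[of _ \<epsilon>]) (auto simp: d'_def)
      then show ?thesis
        using hE by (auto simp: M'.metric_continuous_map[OF M.Metric_space_axioms])
    qed
    ultimately show ?thesis
      using hf fh EX E'Y by (auto simp: homeomorphic_maps_def)
  qed
  have hm2: "homeomorphic_maps (subtopology X E) (subtopology Y E') f h"
    by (rule homeomorphic_maps_subtopologies[OF fh_maps])
       (use E'f EX E'Y in \<open>auto simp: Int_absorb1\<close>)
  have mtop': "mtopology_of m' = subtopology Y E'"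
  proof -
    have "homeomorphic_maps M.mtopology (subtopology Y E') f h"
      using hm2 mtop top by simp
    then have q1: "quotient_map M.mtopology (subtopology Y E') f"
      and q2: "quotient_map M.mtopology M'.mtopology f"
      using hm1 homeomorphic_map_def homeomorphic_map_maps by blast+
    have "openin (subtopology Y E') U \<longleftrightarrow> openin M'.mtopology U" for U
    proof (cases "U \<subseteq> E'")
      case True
      then show ?thesis
        using q1 q2 E'Y unfolding quotient_map_def
        by (simp add: Int_absorb1)
    next
      case False
      then show ?thesis
        by (metis M'.topspace_mtopology openin_subset openin_imp_subset)
    qed
    then show ?thesis by (simp add: topology_eq top')
  qed
  have geo': "geometric_action G m' \<phi>'"
    unfolding geometric_action_def
  proof (intro conjI)
    show "isometric_action G m' \<phi>'"
    proof -
      have "d' (\<phi>' g x) (\<phi>' g y) = d' x y" if "g \<in> carrier G" "x \<in> E'" "y \<in> E'" for g x y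
      proof -
        have "d' (\<phi>' g x) (\<phi>' g y) = mdist m (\<phi> g (h x)) (\<phi> g (h y))"
          using that df[OF \<phi>E \<phi>E] hE by (simp add: \<phi>'_def)
        then show ?thesis
          using geo that hE by (simp add: geometric_action_def isometric_action_def mE d'_def)
      qed
      then show ?thesis
        using act' by (simp add: isometric_action_def m'E m'd)
    qed
    show "proper_action G (mtopology_of m') \<phi>'"
      unfolding proper_action_def
    proof (intro allI impI)
      fix K assume K: "compactin (mtopology_of m') K"
      then have KE: "K \<subseteq> E'" using compactin_subset_topspace m'E by fastforce
      have "compactin M.mtopology (h ` K)"
        using K hm1 image_compactin unfolding top' homeomorphic_maps_def by blast
      then have "finite {g \<in> carrier G. \<phi> g ` (h ` K) \<inter> h ` K \<noteq> {}}"
        using geo by (simp add: geometric_action_def proper_action_def top)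
      moreover have "{g \<in> carrier G. \<phi>' g ` K \<inter> K \<noteq> {}} \<subseteq>
          {g \<in> carrier G. \<phi> g ` (h ` K) \<inter> h ` K \<noteq> {}}"
      proof -
        have "\<phi> g ` (h ` K) \<inter> h ` K \<noteq> {}"
          if g: "g \<in> carrier G" and x: "x \<in> K" "\<phi>' g x \<in> K" for g x
        proof -
          have "h (\<phi>' g x) = \<phi> g (h x)"
            using x KE \<phi>E[OF g] hE EX hf by (auto simp: \<phi>'_def subset_iff)
          then have "\<phi> g (h x) \<in> \<phi> g ` h ` K \<inter> h ` K" using x by (metis IntI imageI)
          then show ?thesis by blast
        qed
        then show ?thesis by blast
      qed
      ultimately show "finite {g \<in> carrier G. \<phi>' g ` K \<inter> K \<noteq> {}}"
        by (rule rev_finite_subset)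
    qed
    show "cocompact_action G (mtopology_of m') \<phi>'"
    proof -
      let ?Q = "quotient_topology M.mtopology (orbit G \<phi>)"
      let ?Q' = "quotient_topology M'.mtopology (orbit G \<phi>')"
      have orb: "f ` orbit G \<phi> x = orbit G \<phi>' (f x)" if "x \<in> E" for x
        using \<phi>'f[OF that] by (auto simp: orbit_def image_iff)
      have "continuous_map M.mtopology ?Q' (orbit G \<phi>' \<circ> f)"
        using hm1 quotient_map_quotient_topology[of M'.mtopology "orbit G \<phi>'"]
        by (meson continuous_map_compose homeomorphic_maps_def quotient_imp_continuous_map)
      then have "continuous_map M.mtopology ?Q' ((`) f \<circ> orbit G \<phi>)"
        by (rule continuous_map_eq) (simp add: orb)
      then have "continuous_map ?Q ?Q' ((`) f)"
        using continuous_compose_quotient_map[OF quotient_map_quotient_topology] by blast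
      moreover have "(`) f ` topspace ?Q = topspace ?Q'"
      proof -
        have "(`) f ` topspace ?Q = orbit G \<phi>' ` (f ` E)"
          by (simp add: image_image orb)
        then show ?thesis unfolding E'f[symmetric] by simp
      qed
      moreover have "compact_space ?Q"
        using geo by (simp add: geometric_action_def cocompact_action_def top)
      ultimately have "compact_space ?Q'"
        unfolding compact_space_def using image_compactin by metis
      then show ?thesis by (simp add: cocompact_action_def top')
    qed
  qed
  have comp: "compact_space Y"
    using EZ homeomorphic_compact_space[OF hs] by (simp add: Y_def EZ_structure_def)
  have compW: "compactin Y W"
    using EZ cf image_compactin unfolding W_def EZ_structure_def by blast
  have ER: "euclidean_retract Y"
    using ret unfolding euclidean_retract_def Y_def using homeomorphic_space_refl by blast
  have ZS: "Z_set Y W"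
  proof -
    obtain H where H: "continuous_map (prod_topology (top_of_set {0..1}) X) X H"
      and H0: "\<forall>x\<in>topspace X. H (0, x) = x"
      and H1: "\<forall>t\<in>{0<..1::real}. (\<lambda>x. H (t, x)) ` topspace X \<inter> Z = {}"
      using EZ unfolding EZ_structure_def Z_set_def by blast
    define H' where "H' = (\<lambda>p. f (H (fst p, h (snd p))))"
    have c: "continuous_map (prod_topology (top_of_set {0..1}) Y) (prod_topology (top_of_set {0..1}) X)
        (\<lambda>p. (fst p, h (snd p)))"
      using ch continuous_map_compose[OF continuous_map_snd ch]
      by (auto simp: continuous_map_pairwise o_def continuous_map_fst)
    have c': "continuous_map (prod_topology (top_of_set {0..1}) Y) Y H'"
      using continuous_map_compose[OF continuous_map_compose[OF c H] cf]
      by (simp add: H'_def o_def)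
    have "H' (t, y) \<notin> W" if t: "t \<in> {0<..1}" and y: "y \<in> topspace Y" for t y
    proof
      assume "H' (t, y) \<in> W"
      then obtain z where z: "z \<in> Z" "f (H (t, h y)) = f z"
        by (auto simp: H'_def W_def)
      have "H (t, h y) \<in> topspace X"
        using H t hY[OF y] by (auto simp: continuous_map_def Pi_iff)
      then have "H (t, h y) = z" using z ZX hf by (metis in_mono)
      then show False using H1 t hY[OF y] z by blast
    qed
    moreover have "\<forall>y\<in>topspace Y. H' (0, y) = y"
      using H0 hY fh by (simp add: H'_def)
    ultimately show ?thesis
      using c' unfolding Z_set_def by (intro exI[of _ H']) auto
  qed
  have null: "finite {g \<in> carrier G. \<not> (\<exists>V\<in>\<V>. \<phi>' g ` K \<subseteq> V)}"
    if K: "compactin (subtopology Y E') K" and V: "open_cover_of Y \<V>" for K \<V>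
  proof -
    have KE: "K \<subseteq> E'" using K by (simp add: compactin_subtopology)
    define \<U> where "\<U> = (\<lambda>V. {x \<in> topspace X. f x \<in> V}) ` \<V>"
    have "open_cover_of X \<U>"
      using V cf fX unfolding open_cover_of_def \<U>_def
      by (auto simp: continuous_map_def)
    moreover have "compactin (subtopology X E) (h ` K)"
      using K hm2 image_compactin unfolding homeomorphic_maps_def by blast
    ultimately have "finite {g \<in> carrier G. \<not> (\<exists>U\<in>\<U>. \<phi> g ` (h ` K) \<subseteq> U)}"
      using EZ unfolding EZ_structure_def E_def by blast
    moreover have "{g \<in> carrier G. \<not> (\<exists>V\<in>\<V>. \<phi>' g ` K \<subseteq> V)} \<subseteq>
        {g \<in> carrier G. \<not> (\<exists>U\<in>\<U>. \<phi> g ` (h ` K) \<subseteq> U)}"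
    proof -
      have "\<exists>V\<in>\<V>. \<phi>' g ` K \<subseteq> V" if U: "U \<in> \<U>" "\<phi> g ` (h ` K) \<subseteq> U" for g U
      proof -
        obtain V where "V \<in> \<V>" "U = {x \<in> topspace X. f x \<in> V}"
          using U by (auto simp: \<U>_def)
        then show ?thesis
          using U(2) KE by (intro bexI[of _ V]) (auto simp: \<phi>'_def image_subset_iff)
      qed
      then show ?thesis by blast
    qed
    ultimately show ?thesis by (rule rev_finite_subset)
  qed
  obtain \<psi> where \<psi>: "group_action G (topspace X) \<psi>"
    "\<forall>g\<in>carrier G. homeomorphic_map X X (\<psi> g)"
    "\<forall>g\<in>carrier G. \<forall>x\<in>topspace X - Z. \<psi> g x = \<phi> g x"
    using EZ unfolding EZ_structure_def by blast
  define \<psi>' where "\<psi>' = (\<lambda>g. \<lambda>y\<in>topspace Y. f (\<psi> g (h y)))"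
  have \<psi>1: "group_action G (topspace Y) \<psi>'"
    unfolding \<psi>'_def
    by (rule group_action_transfer[OF \<psi>(1)]) (use fX hY hf fh in auto)
  have \<psi>2: "homeomorphic_map Y Y (\<psi>' g)" if "g \<in> carrier G" for g
  proof -
    have "homeomorphic_map X Y f" "homeomorphic_map Y X h"
      using fh_maps homeomorphic_map_maps homeomorphic_maps_sym by blast+
    then have "homeomorphic_map Y Y (f \<circ> (\<psi> g \<circ> h))"
      by (metis \<psi>(2) that homeomorphic_map_compose)
    then show ?thesis
      by (rule homeomorphic_map_eq) (simp add: \<psi>'_def)
  qed
  have \<psi>3: "\<psi>' g y = \<phi>' g y" if "g \<in> carrier G" "y \<in> E'" for g y
    using that \<psi>(3) hE[OF that(2)] E'Y by (auto simp: \<psi>'_def \<phi>'_def E_def)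
  have "EZ_structure G Y W \<phi>'"
    unfolding EZ_structure_def E'_def[symmetric]
  proof (intro conjI)
    show "\<exists>m. mspace m = E' \<and> mtopology_of m = subtopology Y E' \<and> geometric_action G m \<phi>'"
      using m'E mtop' geo' by blast
    show "\<forall>K \<U>. compactin (subtopology Y E') K \<and> open_cover_of Y \<U> \<longrightarrow>
        finite {g \<in> carrier G. \<not> (\<exists>U\<in>\<U>. \<phi>' g ` K \<subseteq> U)}"
      by (intro allI impI null) auto
    show "\<exists>\<psi>. group_action G (topspace Y) \<psi> \<and>
        (\<forall>g\<in>carrier G. homeomorphic_map Y Y (\<psi> g)) \<and>
        (\<forall>g\<in>carrier G. \<forall>x\<in>E'. \<psi> g x = \<phi>' g x)"
      by (intro exI[of _ \<psi>'] conjI ballI \<psi>1 \<psi>2 \<psi>3)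
  qed (rule comp compW ER ZS)+
  then show ?thesis
    unfolding admits_EZ_structure_def by blast
qed

end

theory Submission
  imports Defs "HOL-Probability.Discrete_Topology"
begin

text \<open>
  Fix a base point \<open>b\<close> and let \<open>proj R\<close> move every point of \<open>X\<close> along its \<open>\<sigma>\<close>-geodesic from \<open>b\<close> into the
  \<open>R\<close>-ball.  Conicality makes these projections 2-Lipschitz, and contracting by \<open>t / R\<close> on points
  outside the \<open>R\<close>-ball; consistency makes them compatible.  The compactification \<open>Xbar\<close> is the
  completion of \<open>X\<close> for the metric \<open>sup\<^sub>n d (proj n x) (proj n y) / (n+1)\<^sup>2\<close>: it is totally bounded because
  balls are compact, \<open>X\<close> is open in it, and every \<open>proj R\<close> extends to a map \<open>retr R\<close> from \<open>Xbar\<close> into the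
  \<open>R\<close>-ball of \<open>X\<close> that tends uniformly to the identity.  Hence the boundary is a Z-set, and pulling back
  covers of \<open>X\<close> along \<open>retr R\<close> shows that \<open>Xbar\<close> has at most the dimension of \<open>X\<close>, so it embeds in a
  Euclidean space.

  \<open>Xbar\<close> is an absolute extensor: near the image of \<open>Xbar\<close> in Euclidean space, move nearby image points
  into \<open>X\<close> by \<open>retr R\<close> and average them there with \<open>\<sigma>\<close>, in the manner of Dugundji, where \<open>R\<close> grows so
  slowly that the averaged points become arbitrarily close in \<open>X\<close>.  No convexity at infinity is needed.

  The action extends since it is uniformly continuous for the new metric: geodesics to one point
  issuing from \<open>b\<close> and from \<open>g b\<close> stay at distance at most \<open>d b (g b)\<close>.  Translates of compact sets
  become small because radial projection shrinks bounded sets far away from \<open>b\<close>.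
\<close>

section \<open>Embedding compact spaces of finite covering dimension\<close>

text \<open>The price is the Lipschitz constant \<open>2 * (R + 2)\<^sup>2\<close> of
  \<open>retr R\<close>: undoing the weight \<open>1 / (n+1)\<^sup>2\<close> of the metric costs a
  quadratic factor. Points of \<open>Xbar\<close> at distance \<eta> have projections at distance of
  order \<open>R\<^sup>2 * \<eta>\<close>, so taking \<open>R\<close> to be about the fourth root of
  \<open>1 / \<eta>\<close> makes both this and the displacement \<open>1 / (R + 1)\<close> tend to
  0. The weight itself has to beat the diameter \<open>2 * n\<close> of the ball of radius
  \<open>n\<close>: with the square in the denominator, radii beyond \<open>N\<close> contribute at
  most \<open>2 / (N + 1)\<close>, and every estimate reduces to finitely many radii and a small
  tail. Finite dimension enters through the embedding into a Euclidean space; the retraction onto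
  the image comes from the extension of maps.\<close>

lemma finite_perturb_inj:
  fixes v :: "'i \<Rightarrow> real"
  assumes "finite I" "0 < \<eta>"
  obtains c where "inj_on c I" "\<And>i. i \<in> I \<Longrightarrow> \<bar>c i - v i\<bar> < \<eta>"
proof -
  have "\<exists>c. inj_on c I \<and> (\<forall>i\<in>I. \<bar>c i - v i\<bar> < \<eta>)"
    using assms(1)
  proof (induction I rule: finite_induct)
    case (insert i I)
    then obtain c where c: "inj_on c I" "\<forall>i\<in>I. \<bar>c i - v i\<bar> < \<eta>" by blast
    have "infinite {v i - \<eta><..<v i + \<eta>}" using assms(2) by (simp add: infinite_Ioo)
    then obtain z where z: "z \<in> {v i - \<eta><..<v i + \<eta>}" "z \<notin> c ` I"
      by (metis finite_imageI finite_subset insert.hyps(1) subsetI)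
    have "inj_on (c(i := z)) (insert i I)"
      using c(1) z(2) insert.hyps(2) by (auto simp: inj_on_def)
    moreover have "\<forall>k\<in>insert i I. \<bar>(c(i := z)) k - v k\<bar> < \<eta>"
      using c(2) z(1) by (auto simp: abs_less_iff)
    ultimately show ?case by blast
  qed auto
  then show ?thesis using that by blast
qed

lemma finite_inj_separated:
  fixes c :: "'i \<Rightarrow> real"
  assumes "finite I" "inj_on c I"
  obtains \<gamma> where "0 < \<gamma>" "\<And>i j. \<lbrakk>i \<in> I; j \<in> I; i \<noteq> j\<rbrakk> \<Longrightarrow> \<gamma> \<le> \<bar>c i - c j\<bar>"
proof -
  define D where "D = insert 1 ((\<lambda>(i, j). \<bar>c i - c j\<bar>) ` {p \<in> I \<times> I. fst p \<noteq> snd p})"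
  have fin: "finite D" unfolding D_def using assms(1) by auto
  have pos: "d > 0" if "d \<in> D" for d
    using that assms(2) by (auto simp: D_def inj_on_def)
  show ?thesis
  proof
    show "0 < Min D" using fin pos by (subst Min_gr_iff) (auto simp: D_def)
    show "Min D \<le> \<bar>c i - c j\<bar>" if "i \<in> I" "j \<in> I" "i \<noteq> j" for i j
      using that by (intro Min_le fin) (auto simp: D_def)
  qed
qed

definition clamp01 :: "real \<Rightarrow> real" where "clamp01 x = max 0 (min 1 x)"

lemma clamp01_simps: "0 \<le> clamp01 x" "clamp01 x \<le> 1" "1 \<le> x \<Longrightarrow> clamp01 x = 1" "x \<le> 0 \<Longrightarrow> clamp01 x = 0"
  by (auto simp: clamp01_def)

lemma continuous_on_clamp01 [continuous_intros]:
  "continuous_on S f \<Longrightarrow> continuous_on S (\<lambda>x. clamp01 (f x))"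
  unfolding clamp01_def by (intro continuous_intros)

text \<open>For compact metric spaces this is covering dimension at most \<open>k - 1\<close>,
  phrased by small mesh: \<open>k\<close> bounds the number of members through a point and is thus
  the dimension plus one.\<close>

definition fine_covers_of_order :: "'b::metric_space set \<Rightarrow> nat \<Rightarrow> bool" where
  "fine_covers_of_order Y k \<longleftrightarrow>
     (\<forall>\<epsilon>>0. \<exists>\<W>. finite \<W> \<and> (\<forall>W\<in>\<W>. openin (top_of_set Y) W) \<and> Y \<subseteq> \<Union>\<W> \<and>
        (\<forall>y\<in>Y. card {W\<in>\<W>. y \<in> W} \<le> k) \<and> (\<forall>W\<in>\<W>. \<forall>x\<in>W. \<forall>y\<in>W. dist x y < \<epsilon>))"

text \<open>Distance to the complement is positive only inside a member, and a Lebesgue number of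
  the cover bounds it below, at each point, for at least one member.\<close>

lemma cover_gauge_functions:
  fixes Y :: "'b::metric_space set"
  assumes Y: "compact Y"
    and op: "\<And>W. W \<in> \<W> \<Longrightarrow> openin (top_of_set Y) W" and cov: "Y \<subseteq> \<Union>\<W>"
  shows "\<exists>(a :: 'b set \<Rightarrow> 'b \<Rightarrow> real) \<mu>. (\<forall>W. continuous_on Y (a W)) \<and>
    (\<forall>W\<in>\<W>. \<forall>y\<in>Y. 0 < a W y \<longrightarrow> y \<in> W) \<and> 0 < \<mu> \<and> (\<forall>y\<in>Y. \<exists>W\<in>\<W>. \<mu> \<le> a W y)"
proof -
  \<comment> \<open>\<open>infdist\<close> to the empty set is 0, so a member containing all of
    \<open>Y\<close> gets the constant gauge 1 instead.\<close>
  define a where "a = (\<lambda>W y. if Y \<subseteq> W then 1 else infdist y (Y - W))"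
  obtain T where T: "\<And>W. W \<in> \<W> \<Longrightarrow> open (T W) \<and> W = Y \<inter> T W"
    using op unfolding openin_open by metis
  have "\<exists>e>0. \<forall>x\<in>Y. \<exists>G \<in> T ` \<W>. ball x e \<subseteq> G"
  proof (rule Heine_Borel_lemma[OF Y, of "T ` \<W>"])
    show "Y \<subseteq> \<Union>(T ` \<W>)"
    proof
      fix y assume "y \<in> Y"
      then obtain W where "W \<in> \<W>" "y \<in> W" using cov by blast
      then show "y \<in> \<Union>(T ` \<W>)" using T[of W] by blast
    qed
    show "open G" if "G \<in> T ` \<W>" for G using that T by blast
  qed blast
  then obtain e where e: "0 < e" "\<And>x. x \<in> Y \<Longrightarrow> \<exists>G \<in> T ` \<W>. ball x e \<subseteq> G" by blast
  show ?thesis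
  proof (intro exI[of _ a] exI[of _ "min 1 e"] conjI allI ballI impI)
    show "continuous_on Y (a W)" for W
      unfolding a_def by (cases "Y \<subseteq> W") (auto intro!: continuous_intros)
    show "y \<in> W" if "W \<in> \<W>" "y \<in> Y" "0 < a W y" for W y
      using that by (auto simp: a_def split: if_splits)
    show "0 < min 1 e" using e by simp
    show "\<exists>W\<in>\<W>. min 1 e \<le> a W y" if y: "y \<in> Y" for y
    proof -
      obtain W where W: "W \<in> \<W>" "ball y e \<subseteq> T W" using e(2)[OF y] by blast
      have "e \<le> infdist y (Y - W)" if "\<not> Y \<subseteq> W"
      proof -
        have "Y - W \<noteq> {}" using that by blast
        moreover have "e \<le> dist y z" if "z \<in> Y - W" for z
          using that W T[OF W(1)] by (auto simp: subset_iff not_less[symmetric])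
        ultimately show ?thesis by (auto simp: infdist_notempty intro!: cINF_greatest)
      qed
      then have "min 1 e \<le> a W y" unfolding a_def by (cases "Y \<subseteq> W") auto
      then show ?thesis using W(1) by blast
    qed
  qed
qed

text \<open>With a gauge \<open>a W\<close> for every member of a fine cover, the level \<open>\<theta> j\<close> cuts \<open>Y\<close> into cells according to the
  set \<open>S j y\<close> of those \<open>W\<close> with \<open>a W y > \<theta> j\<close>, and \<open>G j\<close> takes distinct values on the cores of distinct cells.  A
  point fails to lie in a core only for the at most \<open>k\<close> levels close to one of its nonzero gauge
  values, so with more than \<open>2 * k\<close> levels any two points lie in cores for a common level.\<close>

lemma perturb_to_separate:
  fixes Y :: "'b::metric_space set" and F :: "nat \<Rightarrow> 'b \<Rightarrow> real"
  assumes Y: "compact Y" and dimY: "fine_covers_of_order Y k" and M: "2 * k < M"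
    and F: "\<And>j. j < M \<Longrightarrow> continuous_on Y (F j)" and \<eta>: "0 < \<eta>" and \<epsilon>: "0 < \<epsilon>"
  obtains G \<gamma> where "\<And>j. j < M \<Longrightarrow> continuous_on Y (G j)"
    "\<And>j y. \<lbrakk>j < M; y \<in> Y\<rbrakk> \<Longrightarrow> \<bar>G j y - F j y\<bar> \<le> \<eta>" "0 < \<gamma>"
    "\<And>x y. \<lbrakk>x \<in> Y; y \<in> Y; \<epsilon> \<le> dist x y\<rbrakk> \<Longrightarrow> \<exists>j<M. \<gamma> \<le> \<bar>G j x - G j y\<bar>"
proof -
  have "\<exists>e>0. \<forall>j<M. \<forall>x\<in>Y. \<forall>y\<in>Y. dist x y < e \<longrightarrow> \<bar>F j x - F j y\<bar> < \<eta> / 2"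
  proof -
    have "\<exists>e>0. \<forall>x\<in>Y. \<forall>y\<in>Y. dist x y < e \<longrightarrow> \<bar>F j x - F j y\<bar> < \<eta> / 2" if "j < M" for j
    proof -
      obtain d where "d > 0" "\<forall>x\<in>Y. \<forall>y\<in>Y. dist y x < d \<longrightarrow> dist (F j y) (F j x) < \<eta> / 2"
        using compact_uniformly_continuous[OF F[OF \<open>j < M\<close>] Y, unfolded uniformly_continuous_on_def, rule_format, of "\<eta> / 2"] \<eta> by auto
      then show ?thesis by (intro exI[of _ d]) (auto simp: dist_real_def)
    qed
    then obtain e where e: "\<And>j. j < M \<Longrightarrow> 0 < e j \<and> (\<forall>x\<in>Y. \<forall>y\<in>Y. dist x y < e j \<longrightarrow> \<bar>F j x - F j y\<bar> < \<eta> / 2)"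
      by metis
    have "Min (e ` {..<M}) > 0" using M e by (subst Min_gr_iff) auto
    then show ?thesis
    proof (intro exI[of _ "Min (e ` {..<M})"] conjI allI impI ballI)
      fix j x y assume *: "j < M" "x \<in> Y" "y \<in> Y" and "dist x y < Min (e ` {..<M})"
      moreover have "Min (e ` {..<M}) \<le> e j" using *(1) by (intro Min_le) auto
      ultimately have "dist x y < e j" by linarith
      then show "\<bar>F j x - F j y\<bar> < \<eta> / 2" using e[OF *(1)] *(2,3) by blast
    qed
  qed
  then obtain e where e: "0 < e" "\<And>j x y. \<lbrakk>j < M; x \<in> Y; y \<in> Y; dist x y < e\<rbrakk> \<Longrightarrow> \<bar>F j x - F j y\<bar> < \<eta> / 2"
    by blast
  obtain \<W> where finW: "finite \<W>" and opW: "\<And>W. W \<in> \<W> \<Longrightarrow> openin (top_of_set Y) W"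
    and covW: "Y \<subseteq> \<Union>\<W>" and ordW: "\<And>y. y \<in> Y \<Longrightarrow> card {W\<in>\<W>. y \<in> W} \<le> k"
    and diamW: "\<And>W x y. \<lbrakk>W \<in> \<W>; x \<in> W; y \<in> W\<rbrakk> \<Longrightarrow> dist x y < min e \<epsilon>"
  proof -
    have "0 < min e \<epsilon>" using e(1) \<epsilon> by simp
    from dimY[unfolded fine_covers_of_order_def, rule_format, OF this]
    obtain \<W> where "finite \<W>" "\<forall>W\<in>\<W>. openin (top_of_set Y) W" "Y \<subseteq> \<Union>\<W>"
      "\<forall>y\<in>Y. card {W\<in>\<W>. y \<in> W} \<le> k" "\<forall>W\<in>\<W>. \<forall>x\<in>W. \<forall>y\<in>W. dist x y < min e \<epsilon>" by blast
    then show ?thesis using that by presburger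
  qed
  have "\<exists>(a :: 'b set \<Rightarrow> 'b \<Rightarrow> real) \<mu>. (\<forall>W. continuous_on Y (a W)) \<and>
      (\<forall>W\<in>\<W>. \<forall>y\<in>Y. 0 < a W y \<longrightarrow> y \<in> W) \<and> 0 < \<mu> \<and> (\<forall>y\<in>Y. \<exists>W\<in>\<W>. \<mu> \<le> a W y)"
    by (rule cover_gauge_functions[OF Y _ covW]) (rule opW)
  then obtain a :: "'b set \<Rightarrow> 'b \<Rightarrow> real" and \<mu> where A: "\<forall>W. continuous_on Y (a W)"
    "\<forall>W\<in>\<W>. \<forall>y\<in>Y. 0 < a W y \<longrightarrow> y \<in> W" and \<mu>: "0 < \<mu>"
    and a\<mu>: "\<forall>y\<in>Y. \<exists>W\<in>\<W>. \<mu> \<le> a W y" by blast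
  have ca: "\<And>W. continuous_on Y (a W)" and aW: "\<And>W y. \<lbrakk>W \<in> \<W>; y \<in> Y; 0 < a W y\<rbrakk> \<Longrightarrow> y \<in> W"
    using A by blast+
  \<comment> \<open>The levels \<open>\<theta> j\<close> are the multiples
    \<open>2 * m * (j + 1)\<close>. They are \<open>2 * m\<close> apart, so a gauge value is closer
    than \<open>m\<close> to at most one of them. They stay below \<open>\<mu>\<close>, so no cell
    \<open>S j y\<close> is empty, and are at least \<open>2 * m\<close>, so a value close to a
    level is positive and its member contains the point.\<close>
  define m where "m = \<mu> / (2 * (real M + 1))"
  have m: "0 < m" using \<mu> by (simp add: m_def)
  define \<theta> where "\<theta> = (\<lambda>j::nat. 2 * m * (real j + 1))"
  have \<theta>m: "2 * m \<le> \<theta> j" for j using m by (simp add: \<theta>_def)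
  have \<theta>\<mu>: "\<theta> j < \<mu>" if "j < M" for j
  proof -
    have "\<mu> = 2 * m * (real M + 1)" by (simp add: m_def field_simps)
    then show ?thesis using that m by (simp add: \<theta>_def)
  qed
  have \<theta>sep: "2 * m \<le> \<bar>\<theta> i - \<theta> j\<bar>" if "i \<noteq> j" for i j
  proof -
    have "1 \<le> \<bar>real i - real j\<bar>" using that by linarith
    moreover have "\<bar>\<theta> i - \<theta> j\<bar> = 2 * m * \<bar>real i - real j\<bar>"
      using m by (simp add: \<theta>_def abs_mult flip: right_diff_distrib)
    ultimately show ?thesis using m by simp
  qed
  define S where "S = (\<lambda>j y. {W \<in> \<W>. \<theta> j < a W y})"
  have Sne: "\<exists>W\<in>\<W>. W \<in> S j y" if "j < M" "y \<in> Y" for j y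
    using a\<mu>[rule_format, OF that(2)] \<theta>\<mu>[OF that(1)] by (force simp: S_def)
  have SW: "y \<in> W" if "W \<in> S j y" "y \<in> Y" for W j y
    using that aW \<theta>m[of j] m by (force simp: S_def)
  \<comment> \<open>A sample value of \<open>F j\<close> at a common point of the members of
    \<open>T\<close>. Each member has diameter below \<open>e\<close>, so on the cell of
    \<open>T\<close> the sample differs from \<open>F j\<close> by less than
    \<open>\<eta> / 2\<close>; for families without a common point the value is arbitrary.\<close>
  define v where "v = (\<lambda>j T. F j (SOME y. y \<in> Y \<and> (\<forall>W\<in>T. y \<in> W)))"
  have vF: "\<bar>v j (S j y) - F j y\<bar> < \<eta> / 2" if j: "j < M" and y: "y \<in> Y" for j y
  proof -
    define z where "z = (SOME z. z \<in> Y \<and> (\<forall>W\<in>S j y. z \<in> W))"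
    have "z \<in> Y \<and> (\<forall>W\<in>S j y. z \<in> W)"
      unfolding z_def by (rule someI[of _ y]) (use y SW in blast)
    moreover obtain W where "W \<in> \<W>" "W \<in> S j y" using Sne[OF j y] by blast
    ultimately have "dist z y < e" "z \<in> Y" using diamW[of W z y] SW[OF _ y] by auto
    then show ?thesis using e(2)[OF j _ y] by (simp add: v_def z_def)
  qed
  have "\<exists>c. inj_on c (Pow \<W>) \<and> (\<forall>T\<in>Pow \<W>. \<bar>c T - v j T\<bar> < \<eta> / 2)" for j
    using finite_perturb_inj[of "Pow \<W>" "\<eta> / 2" "v j"] finW \<eta> by (metis finite_Pow_iff half_gt_zero)
  then obtain c where cinj: "\<And>j. inj_on (c j) (Pow \<W>)"
    and cv: "\<And>j T. T \<subseteq> \<W> \<Longrightarrow> \<bar>c j T - v j T\<bar> < \<eta> / 2" by (metis Pow_iff)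
  \<comment> \<open>A continuous bump that vanishes outside the cell of \<open>T\<close> and equals
    1 on its core, where every gauge is at least \<open>m\<close> away from the level.
    \<open>G\<close> uses it to slide from \<open>F j\<close> to the constant
    \<open>c j T\<close>.\<close>
  define \<beta> where "\<beta> = (\<lambda>j T y. (\<Prod>W\<in>T. clamp01 ((a W y - \<theta> j) / m)) * (\<Prod>W\<in>\<W> - T. clamp01 ((\<theta> j - a W y) / m)))"
  have \<beta>01: "0 \<le> \<beta> j T y" "\<beta> j T y \<le> 1" for j T y
    unfolding \<beta>_def by (auto intro!: mult_nonneg_nonneg prod_nonneg mult_le_one prod_le_1 simp: clamp01_simps)
  have \<beta>0: "\<beta> j T y = 0" if T: "T \<subseteq> \<W>" "T \<noteq> S j y" for j T y
  proof -
    have finT: "finite T" using T finW finite_subset by blast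
    consider W where "W \<in> T" "a W y \<le> \<theta> j" | W where "W \<in> \<W> - T" "\<theta> j < a W y"
      using T by (fastforce simp: S_def)
    then show ?thesis
    proof cases
      case 1
      then have "clamp01 ((a W y - \<theta> j) / m) = 0"
        using m by (intro clamp01_simps) (simp add: divide_nonpos_pos)
      then have "(\<Prod>W\<in>T. clamp01 ((a W y - \<theta> j) / m)) = 0" using 1 finT by (intro prod_zero) auto
      then show ?thesis by (simp add: \<beta>_def)
    next
      case 2
      then have "clamp01 ((\<theta> j - a W y) / m) = 0"
        using m by (intro clamp01_simps) (simp add: divide_nonpos_pos)
      then have "(\<Prod>W\<in>\<W> - T. clamp01 ((\<theta> j - a W y) / m)) = 0" using 2 finW by (intro prod_zero) auto
      then show ?thesis by (simp add: \<beta>_def)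
    qed
  qed
  define G where "G = (\<lambda>j y. F j y + (\<Sum>T\<in>Pow \<W>. \<beta> j T y * (c j T - F j y)))"
  have G: "G j y = F j y + \<beta> j (S j y) y * (c j (S j y) - F j y)" for j y
  proof -
    have "(\<Sum>T\<in>Pow \<W>. \<beta> j T y * (c j T - F j y)) = (\<Sum>T\<in>{S j y}. \<beta> j T y * (c j T - F j y))"
      using finW by (intro sum.mono_neutral_right) (auto simp: S_def \<beta>0)
    then show ?thesis by (simp add: G_def)
  qed
  have "\<exists>\<gamma>>0. \<forall>T\<in>Pow \<W>. \<forall>T'\<in>Pow \<W>. T \<noteq> T' \<longrightarrow> \<gamma> \<le> \<bar>c j T - c j T'\<bar>" for j
    using finite_inj_separated[OF _ cinj[of j]] finW by (metis finite_Pow_iff)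
  then obtain \<gamma> where \<gamma>: "\<And>j. 0 < \<gamma> j" "\<And>j T T'. \<lbrakk>T \<subseteq> \<W>; T' \<subseteq> \<W>; T \<noteq> T'\<rbrakk> \<Longrightarrow> \<gamma> j \<le> \<bar>c j T - c j T'\<bar>"
    by (metis Pow_iff)
  define bad where "bad = (\<lambda>x. {j \<in> {..<M}. \<exists>W\<in>\<W>. \<bar>a W x - \<theta> j\<bar> < m})"
  have badcard: "card (bad x) \<le> k" if x: "x \<in> Y" for x
  proof -
    let ?B = "\<lambda>W. {j \<in> {..<M}. \<bar>a W x - \<theta> j\<bar> < m}"
    have B1: "card (?B W) \<le> 1" for W
    proof -
      have "i = j" if "i \<in> ?B W" "j \<in> ?B W" for i j
        using that \<theta>sep[of i j] by (cases "i = j") auto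
      then have "\<forall>i\<in>?B W. \<forall>j\<in>?B W. i = j" by blast
      moreover have "finite (?B W)" by simp
      ultimately show ?thesis using card_le_Suc0_iff_eq[of "?B W"] unfolding One_nat_def by blast
    qed
    have "bad x \<subseteq> (\<Union>W\<in>{W\<in>\<W>. x \<in> W}. ?B W)"
    proof
      fix j assume "j \<in> bad x"
      then obtain W where W: "W \<in> \<W>" "\<bar>a W x - \<theta> j\<bar> < m" "j < M" by (auto simp: bad_def)
      then have "0 < a W x" using \<theta>m[of j] m by linarith
      then show "j \<in> (\<Union>W\<in>{W\<in>\<W>. x \<in> W}. ?B W)" using W aW[OF W(1) x] by auto
    qed
    then have "card (bad x) \<le> card (\<Union>W\<in>{W\<in>\<W>. x \<in> W}. ?B W)"
      using finW by (intro card_mono) auto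
    also have "\<dots> \<le> (\<Sum>W\<in>{W\<in>\<W>. x \<in> W}. card (?B W))"
      using finW by (intro card_UN_le) auto
    also have "\<dots> \<le> (\<Sum>W\<in>{W\<in>\<W>. x \<in> W}. 1)" by (intro sum_mono B1)
    also have "\<dots> \<le> k" using ordW[OF x] by simp
    finally show ?thesis .
  qed
  have good: "G j x = c j (S j x)" if "j < M" "j \<notin> bad x" for j x
  proof -
    have away: "m \<le> \<bar>a W x - \<theta> j\<bar>" if "W \<in> \<W>" for W
      using that \<open>j < M\<close> \<open>j \<notin> bad x\<close> by (force simp: bad_def)
    have "(\<Prod>W\<in>S j x. clamp01 ((a W x - \<theta> j) / m)) = 1"
      using away m by (intro prod.neutral ballI clamp01_simps(3)) (fastforce simp: S_def)
    moreover have "(\<Prod>W\<in>\<W> - S j x. clamp01 ((\<theta> j - a W x) / m)) = 1"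
      using away m by (intro prod.neutral ballI clamp01_simps(3)) (fastforce simp: S_def)
    ultimately show ?thesis by (simp add: G \<beta>_def)
  qed
  show ?thesis
  proof
    show "continuous_on Y (G j)" if "j < M" for j
      unfolding G_def \<beta>_def using m F[OF that] ca by (intro continuous_intros) auto
    show "\<bar>G j y - F j y\<bar> \<le> \<eta>" if "j < M" "y \<in> Y" for j y
    proof -
      have "\<bar>c j (S j y) - F j y\<bar> \<le> \<eta>"
      proof -
        have "S j y \<subseteq> \<W>" by (auto simp: S_def)
        then show ?thesis using vF[OF that] cv[of "S j y" j] by linarith
      qed
      then have "\<beta> j (S j y) y * \<bar>c j (S j y) - F j y\<bar> \<le> 1 * \<eta>"
        using \<beta>01 \<eta> by (intro mult_mono) auto
      then show ?thesis using \<beta>01 by (simp add: G abs_mult)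
    qed
    show "0 < Min (\<gamma> ` {..<M})" using M \<gamma>(1) by (subst Min_gr_iff) auto
    show "\<exists>j<M. Min (\<gamma> ` {..<M}) \<le> \<bar>G j x - G j y\<bar>" if x: "x \<in> Y" and y: "y \<in> Y" and d: "\<epsilon> \<le> dist x y" for x y
    proof -
      have "card (bad x \<union> bad y) \<le> k + k"
        using card_Un_le[of "bad x" "bad y"] badcard[OF x] badcard[OF y] by linarith
      then have "\<not> {..<M} \<subseteq> bad x \<union> bad y"
        using M card_mono[of "bad x \<union> bad y" "{..<M}"] by (force simp: bad_def)
      then obtain j where j: "j < M" "j \<notin> bad x" "j \<notin> bad y" by blast
      \<comment> \<open>Equal cells would share a member, which contains both points and is too
        small for that.\<close>
      have "S j x \<noteq> S j y"
      proof
        assume "S j x = S j y"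
        then obtain W where "W \<in> \<W>" "W \<in> S j x" "W \<in> S j y" using Sne[OF j(1) x] by auto
        then have "dist x y < \<epsilon>" using diamW[of W x y] SW x y by auto
        then show False using d by simp
      qed
      then have "\<gamma> j \<le> \<bar>G j x - G j y\<bar>"
        using good j \<gamma>(2)[of "S j x" "S j y" j] by (auto simp: S_def)
      moreover have "Min (\<gamma> ` {..<M}) \<le> \<gamma> j" using j by (intro Min_le) auto
      ultimately show ?thesis using j(1) order_trans by blast
    qed
  qed
qed

text \<open>A Baire category argument carried out by hand: stage \<open>n\<close> separates points
  at distance at least \<open>1 / (n + 1)\<close> by some gap \<open>\<gamma> n\<close>, and all
  later corrections are kept small enough not to destroy this. As the \<open>\<eta> n\<close> at
  least halve and \<open>\<eta> n \<le> \<gamma> n / 8\<close>, the total later change is at most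
  \<open>2 * \<eta> n \<le> \<gamma> n / 4\<close> at each point, so half of the gap survives in the
  limit.\<close>

theorem embedding_of_fine_covers:
  fixes Y :: "'b::metric_space set"
  assumes Y: "compact Y" and dimY: "fine_covers_of_order Y k"
  obtains f :: "'b \<Rightarrow> nat \<Rightarrow> real"
  where "continuous_on Y f" "inj_on f Y" "\<And>y i. 2 * k < i \<Longrightarrow> f y i = 0"
proof -
  define M where "M = Suc (2 * k)"
  have M: "2 * k < M" by (simp add: M_def)
  let ?Good = "\<lambda>(n::nat) (F :: nat \<Rightarrow> 'b \<Rightarrow> real, \<gamma>::real, \<eta>::real).
     (\<forall>j<M. continuous_on Y (F j)) \<and> 0 < \<eta> \<and> \<eta> \<le> \<gamma> / 8 \<and>
     (\<forall>x\<in>Y. \<forall>y\<in>Y. 1 / (real n + 1) \<le> dist x y \<longrightarrow> (\<exists>j<M. \<gamma> \<le> \<bar>F j x - F j y\<bar>))"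
  let ?Next = "\<lambda>(F :: nat \<Rightarrow> 'b \<Rightarrow> real, \<gamma>::real, \<eta>::real) (F', \<gamma>', \<eta>').
     (\<forall>j<M. \<forall>y\<in>Y. \<bar>F' j y - F j y\<bar> \<le> \<eta>) \<and> \<eta>' \<le> \<eta> / 2"
  have step: "\<exists>F' \<gamma>' \<eta>'. ?Good n (F', \<gamma>', \<eta>') \<and> ?Next (F, \<gamma>, \<eta>) (F', \<gamma>', \<eta>')"
    if cF: "\<forall>j<M. continuous_on Y (F j)" and \<eta>: "0 < \<eta>" for n F \<gamma> \<eta>
  proof -
    have n: "0 < 1 / (real n + 1)" by simp
    obtain G \<gamma>' where G: "\<And>j. j < M \<Longrightarrow> continuous_on Y (G j)"
      "\<And>j y. \<lbrakk>j < M; y \<in> Y\<rbrakk> \<Longrightarrow> \<bar>G j y - F j y\<bar> \<le> \<eta>" "0 < \<gamma>'"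
      "\<And>x y. \<lbrakk>x \<in> Y; y \<in> Y; 1 / (real n + 1) \<le> dist x y\<rbrakk> \<Longrightarrow> \<exists>j<M. \<gamma>' \<le> \<bar>G j x - G j y\<bar>"
      using perturb_to_separate[OF Y dimY M _ \<eta> n, of F] cF by metis
    show ?thesis
      using G \<eta> by (intro exI[of _ G] exI[of _ \<gamma>'] exI[of _ "min (\<gamma>' / 8) (\<eta> / 2)"]) auto
  qed
  have "\<exists>s. \<forall>n. ?Good n (s n) \<and> ?Next (s n) (s (Suc n))"
  proof (rule dependent_nat_choice)
    show "\<exists>s. ?Good 0 s" using step[of "\<lambda>_ _. 0" 1 0 0] by auto
    show "\<exists>s'. ?Good (Suc n) s' \<and> ?Next s s'" if "?Good n s" for s n
      using that step[of "fst s" "snd (snd s)" "Suc n" "fst (snd s)"]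
      by (cases s) (auto simp: split_def)
  qed
  then obtain s where ss: "\<forall>n. ?Good n (s n) \<and> ?Next (s n) (s (Suc n))" by (rule exE)
  have s: "?Good n (s n)" "?Next (s n) (s (Suc n))" for n using ss[rule_format, of n] by (rule conjunct1, rule conjunct2)
  define F where "F = (\<lambda>n. fst (s n))"
  define \<gamma> where "\<gamma> = (\<lambda>n. fst (snd (s n)))"
  define \<eta> where "\<eta> = (\<lambda>n. snd (snd (s n)))"
  have cF: "\<And>n j. j < M \<Longrightarrow> continuous_on Y (F n j)" and \<eta>0: "\<And>n. 0 < \<eta> n" and \<eta>\<gamma>: "\<And>n. \<eta> n \<le> \<gamma> n / 8"
    and sep: "\<And>n x y. \<lbrakk>x \<in> Y; y \<in> Y; 1 / (real n + 1) \<le> dist x y\<rbrakk> \<Longrightarrow> \<exists>j<M. \<gamma> n \<le> \<bar>F n j x - F n j y\<bar>"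
    using s(1) unfolding F_def \<gamma>_def \<eta>_def split_def by auto
  have Fstep: "\<And>n j y. \<lbrakk>j < M; y \<in> Y\<rbrakk> \<Longrightarrow> \<bar>F (Suc n) j y - F n j y\<bar> \<le> \<eta> n"
    and \<eta>half: "\<And>n. \<eta> (Suc n) \<le> \<eta> n / 2"
    using s(2) unfolding F_def \<gamma>_def \<eta>_def split_def by auto
  have \<eta>pow: "\<eta> (n + i) \<le> \<eta> n * (1/2) ^ i" for n i
  proof (induction i)
    case (Suc i)
    then show ?case using \<eta>half[of "n + i"] by simp
  qed simp
  have Fdiff: "\<bar>F (n + i) j y - F n j y\<bar> \<le> 2 * \<eta> n * (1 - (1/2) ^ i)" if "j < M" "y \<in> Y" for n i j y
  proof (induction i)
    case (Suc i)
    have "\<bar>F (Suc (n + i)) j y - F (n + i) j y\<bar> \<le> \<eta> n * (1/2) ^ i"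
      using Fstep[OF that, of "n + i"] \<eta>pow[of n i] by linarith
    then have "\<bar>F (n + Suc i) j y - F n j y\<bar> \<le> \<eta> n * (1/2) ^ i + 2 * \<eta> n * (1 - (1/2) ^ i)"
      using Suc by simp
    also have "\<dots> = 2 * \<eta> n * (1 - (1/2) ^ Suc i)" by (simp add: algebra_simps)
    finally show ?case .
  qed simp
  have Fdiff': "\<bar>F l j y - F n j y\<bar> \<le> 2 * \<eta> n" if "j < M" "y \<in> Y" "n \<le> l" for n l j y
  proof -
    obtain i where "l = n + i" using \<open>n \<le> l\<close> by (metis le_iff_add)
    moreover have "2 * \<eta> n * (1 - (1/2) ^ i) \<le> 2 * \<eta> n * 1"
      using \<eta>0[of n] by (intro mult_left_mono) auto
    ultimately show ?thesis using Fdiff[OF that(1,2), of n i] by simp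
  qed
  have \<eta>lim: "\<eta> \<longlonglongrightarrow> 0"
  proof (rule tendsto_sandwich[of "\<lambda>_. 0" _ _ "\<lambda>i. \<eta> 0 * (1/2) ^ i"])
    show "(\<lambda>i. \<eta> 0 * (1/2) ^ i) \<longlonglongrightarrow> 0"
      by (intro tendsto_mult_right_zero LIMSEQ_power_zero) auto
  qed (use \<eta>0 \<eta>pow[of 0] in \<open>auto simp: less_imp_le\<close>)
  have conv: "convergent (\<lambda>n. F n j y)" if "j < M" "y \<in> Y" for j y
  proof -
    have "Cauchy (\<lambda>n. F n j y)"
    proof (rule metric_CauchyI)
      fix e :: real assume "0 < e"
      then have "\<forall>\<^sub>F n in sequentially. \<eta> n < e / 4"
        using order_tendstoD(2)[OF \<eta>lim, of "e / 4"] by simp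
      then obtain N where N: "\<eta> N < e / 4" by (auto simp: eventually_sequentially)
      show "\<exists>N. \<forall>m\<ge>N. \<forall>n\<ge>N. dist (F m j y) (F n j y) < e"
      proof (intro exI[of _ N] allI impI)
        fix m n assume "N \<le> m" "N \<le> n"
        then have "\<bar>F m j y - F N j y\<bar> \<le> 2 * \<eta> N" "\<bar>F n j y - F N j y\<bar> \<le> 2 * \<eta> N"
          using Fdiff' that by auto
        then show "dist (F m j y) (F n j y) < e" using N unfolding dist_real_def by linarith
      qed
    qed
    then show ?thesis by (simp add: Cauchy_convergent_iff)
  qed
  define f where "f = (\<lambda>y j. if j < M then lim (\<lambda>n. F n j y) else 0)"
  have flim: "(\<lambda>n. F n j y) \<longlonglongrightarrow> f y j" if "j < M" "y \<in> Y" for j y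
    using conv[OF that] that by (simp add: f_def convergent_LIMSEQ_iff)
  have fF: "\<bar>f y j - F n j y\<bar> \<le> 2 * \<eta> n" if "j < M" "y \<in> Y" for n j y
  proof (rule tendsto_upperbound)
    show "(\<lambda>l. \<bar>F l j y - F n j y\<bar>) \<longlonglongrightarrow> \<bar>f y j - F n j y\<bar>"
      using flim[OF that] by (intro tendsto_intros)
    show "\<forall>\<^sub>F l in sequentially. \<bar>F l j y - F n j y\<bar> \<le> 2 * \<eta> n"
      using Fdiff'[OF that] by (auto simp: eventually_sequentially)
  qed auto
  have cf: "continuous_on Y (\<lambda>y. f y j)" if j: "j < M" for j
  proof (rule uniform_limit_theorem[of _ "\<lambda>n y. F n j y" sequentially])
    show "\<forall>\<^sub>F n in sequentially. continuous_on Y (\<lambda>y. F n j y)" using cF[OF j] by simp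
    show "uniform_limit Y (\<lambda>n y. F n j y) (\<lambda>y. f y j) sequentially"
    proof (rule uniform_limitI)
      fix e :: real assume "0 < e"
      then have "\<forall>\<^sub>F n in sequentially. \<eta> n < e / 4"
        using order_tendstoD(2)[OF \<eta>lim, of "e / 4"] by simp
      then show "\<forall>\<^sub>F n in sequentially. \<forall>y\<in>Y. dist (F n j y) (f y j) < e"
      proof eventually_elim
        case (elim n)
        then show ?case using fF[OF j, of _ n] \<eta>0[of n] by (fastforce simp: dist_real_def abs_minus_commute)
      qed
    qed
  qed simp
  show ?thesis
  proof
    show "continuous_on Y f"
    proof (rule continuous_on_coordinatewise_then_product)
      show "continuous_on Y (\<lambda>y. f y j)" for j
        using cf by (cases "j < M") (auto simp: f_def)
    qed
    show "f y i = 0" if "2 * k < i" for y i using that by (simp add: f_def M_def)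
    show "inj_on f Y"
    proof (rule inj_onI, rule ccontr)
      fix x y assume xy: "x \<in> Y" "y \<in> Y" "f x = f y" "x \<noteq> y"
      obtain n where "inverse (real (Suc n)) < dist x y"
        using xy(4) reals_Archimedean[of "dist x y"] by auto
      then have n: "1 / (real n + 1) \<le> dist x y" by (simp add: inverse_eq_divide add.commute)
      obtain j where j: "j < M" "\<gamma> n \<le> \<bar>F n j x - F n j y\<bar>" using sep[OF xy(1,2) n] by blast
      have "\<bar>f x j - F n j x\<bar> \<le> \<gamma> n / 4" "\<bar>f y j - F n j y\<bar> \<le> \<gamma> n / 4"
        using fF[OF j(1), of _ n] xy \<eta>\<gamma>[of n] by fastforce+
      moreover have "0 < \<gamma> n" using \<eta>0[of n] \<eta>\<gamma>[of n] by linarith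
      ultimately show False using j xy(3) by (auto simp: abs_if split: if_splits)
    qed
  qed
qed

section \<open>Spaces with a conical bicombing\<close>

text \<open>The space of bounded functions on pairs of a radius and a point: the wrapper
  \<open>discrete\<close> makes every function continuous. It is complete, so closures in it serve
  as completions.\<close>

type_synonym 'a ambient = "((nat \<times> 'a) discrete, real) bcontfun"

text \<open>Of the consistency of \<open>\<sigma>\<close> only the case of initial segments is kept.\<close>

locale conical_space =
  fixes X :: "'a::complete_space set" and \<sigma> :: "'a \<Rightarrow> 'a \<Rightarrow> real \<Rightarrow> 'a" and b :: 'a
  assumes b_in: "b \<in> X"
    and proper: "\<And>r. compact (X \<inter> cball b r)"
    and \<sigma>_in: "\<And>x y t. \<lbrakk>x \<in> X; y \<in> X; t \<in> {0..1}\<rbrakk> \<Longrightarrow> \<sigma> x y t \<in> X"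
    and \<sigma>_0: "\<And>x y. \<lbrakk>x \<in> X; y \<in> X\<rbrakk> \<Longrightarrow> \<sigma> x y 0 = x"
    and \<sigma>_1: "\<And>x y. \<lbrakk>x \<in> X; y \<in> X\<rbrakk> \<Longrightarrow> \<sigma> x y 1 = y"
    and \<sigma>_dist: "\<And>x y s t. \<lbrakk>x \<in> X; y \<in> X; s \<in> {0..1}; t \<in> {0..1}\<rbrakk> \<Longrightarrow>
      dist (\<sigma> x y s) (\<sigma> x y t) = \<bar>s - t\<bar> * dist x y"
    and \<sigma>_consistent: "\<And>x y s t. \<lbrakk>x \<in> X; y \<in> X; s \<in> {0..1}; t \<in> {0..1}\<rbrakk> \<Longrightarrow>
      \<sigma> x (\<sigma> x y t) s = \<sigma> x y (s * t)"
    and \<sigma>_conical: "\<And>x y x' y' t. \<lbrakk>x \<in> X; y \<in> X; x' \<in> X; y' \<in> X; t \<in> {0..1}\<rbrakk> \<Longrightarrow>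
      dist (\<sigma> x y t) (\<sigma> x' y' t) \<le> (1 - t) * dist x x' + t * dist y y'"
begin

lemma dist_\<sigma>_start: "\<lbrakk>x \<in> X; y \<in> X; t \<in> {0..1}\<rbrakk> \<Longrightarrow> dist x (\<sigma> x y t) = t * dist x y"
  using \<sigma>_dist[of x y 0 t] \<sigma>_0[of x y] by auto

lemma dist_\<sigma>_end: "\<lbrakk>x \<in> X; y \<in> X; t \<in> {0..1}\<rbrakk> \<Longrightarrow> dist (\<sigma> x y t) y = (1 - t) * dist x y"
  using \<sigma>_dist[of x y t 1] \<sigma>_1[of x y] by auto

lemma \<sigma>_same: "\<lbrakk>x \<in> X; t \<in> {0..1}\<rbrakk> \<Longrightarrow> \<sigma> x x t = x"
  using dist_\<sigma>_start[of x x t] by simp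

text \<open>Conicality compares the geodesic with the constant one at the centre
  \<open>z\<close>.\<close>

lemma \<sigma>_convex_ball:
  assumes "z \<in> X" "x \<in> X" "y \<in> X" "t \<in> {0..1}" "dist z x \<le> r" "dist z y \<le> r"
  shows "dist z (\<sigma> x y t) \<le> r"
proof -
  have "dist z (\<sigma> x y t) \<le> (1 - t) * dist z x + t * dist z y"
    using \<sigma>_conical[of z z x y t] \<sigma>_same[of z t] assms by simp
  also have "\<dots> \<le> (1 - t) * r + t * r"
    using assms by (intro add_mono mult_left_mono) auto
  finally show ?thesis by (simp add: algebra_simps)
qed

section \<open>Radial projections\<close>

definition proj :: "real \<Rightarrow> 'a \<Rightarrow> 'a" where
  "proj R x = (if dist b x \<le> R then x else \<sigma> b x (R / dist b x))"

lemma proj_id: "dist b x \<le> R \<Longrightarrow> proj R x = x"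
  by (simp add: proj_def)

lemma proj_far: "\<lbrakk>x \<in> X; 0 \<le> R; R \<le> dist b x\<rbrakk> \<Longrightarrow> proj R x = \<sigma> b x (R / dist b x)"
  using \<sigma>_1[of b x] b_in \<sigma>_same[of b 0] unfolding proj_def by (cases "dist b x = 0") auto

lemma frac_in: "\<lbrakk>0 \<le> (R::real); R \<le> d\<rbrakk> \<Longrightarrow> R / d \<in> {0..1}"
  by (auto simp: divide_le_eq_1)

lemma proj_in: "\<lbrakk>x \<in> X; 0 \<le> R\<rbrakk> \<Longrightarrow> proj R x \<in> X"
  using \<sigma>_in[OF b_in _ frac_in] by (auto simp: proj_def)

lemma dist_proj: "\<lbrakk>x \<in> X; 0 \<le> R\<rbrakk> \<Longrightarrow> dist b (proj R x) = min R (dist b x)"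
  using dist_\<sigma>_start[OF b_in, of x "R / dist b x"] frac_in[of R "dist b x"]
  by (auto simp: proj_def)

lemma proj_in_ball: "\<lbrakk>x \<in> X; 0 \<le> R\<rbrakk> \<Longrightarrow> proj R x \<in> X \<inter> cball b R"
  by (simp add: proj_in dist_proj)

text \<open>Consistency of \<open>\<sigma>\<close> enters here: an initial segment of a geodesic
  from \<open>b\<close> is again the chosen geodesic. As a result a large radius controls all
  smaller ones.\<close>

lemma proj_proj:
  assumes x: "x \<in> X" and st: "0 \<le> s" "s \<le> t"
  shows "proj s (proj t x) = proj s x"
proof (cases "dist b x \<le> t \<or> s = t")
  case True
  then show ?thesis using x st dist_proj[of x t] by (auto simp: proj_id)
next
  case False
  have d: "dist b (proj t x) = t" using False x st dist_proj[of x t] by auto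
  have "proj s (proj t x) = \<sigma> b (proj t x) (s / t)"
    using proj_far[of "proj t x" s] proj_in[OF x, of t] d st by auto
  also have "\<dots> = \<sigma> b (\<sigma> b x (t / dist b x)) (s / t)"
    using False by (simp add: proj_def)
  also have "\<dots> = \<sigma> b x ((s / t) * (t / dist b x))"
    using False st x b_in by (intro \<sigma>_consistent frac_in) auto
  also have "\<dots> = proj s x"
    using False st proj_far[OF x, of s] by auto
  finally show ?thesis .
qed

text \<open>Compare both points with the one on the geodesic to \<open>y\<close> at the parameter
  \<open>t / dist b x\<close> that belongs to \<open>x\<close>. Conicality bounds the first
  distance; the second is radial and at most the same multiple of
  \<open>dist b y - dist b x\<close>. Hence the factor 2.\<close>

lemma proj_nonexpanding_near:
  assumes x: "x \<in> X" and y: "y \<in> X" and t: "0 \<le> t" "t \<le> dist b x" and le: "dist b x \<le> dist b y"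
  shows "dist (proj t x) (proj t y) \<le> 2 * (t / dist b x) * dist x y"
proof (cases "dist b x = 0")
  case True
  then have "t = 0" "x = b" using t by auto
  then have "proj t x = b" "proj t y = b"
    using proj_far[OF x, of 0] proj_far[OF y, of 0] \<sigma>_0[OF b_in] x y t le by auto
  then show ?thesis using t True by simp
next
  case False
  let ?a = "dist b x" and ?c = "dist b y"
  have ac: "?a > 0" "?c > 0" using False le by (auto simp: dist_nz[symmetric])
  have fr: "t / ?a \<in> {0..1}" "t / ?c \<in> {0..1}" using t le by (auto simp: divide_le_eq_1 ac)
  have px: "proj t x = \<sigma> b x (t / ?a)" and py: "proj t y = \<sigma> b y (t / ?c)"
    using proj_far x y t le by auto
  have "dist (proj t x) (proj t y) \<le> dist (\<sigma> b x (t / ?a)) (\<sigma> b y (t / ?a)) + dist (\<sigma> b y (t / ?a)) (\<sigma> b y (t / ?c))"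
    unfolding px py by (rule dist_triangle)
  also have "\<dots> \<le> (t / ?a) * dist x y + \<bar>t / ?a - t / ?c\<bar> * ?c"
    using \<sigma>_conical[OF b_in x b_in y fr(1)] \<sigma>_dist[OF b_in y fr] by simp
  also have "\<bar>t / ?a - t / ?c\<bar> * ?c = (t / ?a) * (?c - ?a)"
  proof -
    have "t / ?c \<le> t / ?a" using le t ac by (intro divide_left_mono) auto
    then show ?thesis using ac by (simp add: field_simps)
  qed
  also have "(t / ?a) * (?c - ?a) \<le> (t / ?a) * dist x y"
    using dist_triangle[of b y x] fr by (intro mult_left_mono) auto
  finally show ?thesis by (simp add: algebra_simps)
qed

lemma proj_contract_far:
  assumes x: "x \<in> X" and y: "y \<in> X" and t: "0 \<le> t" "t \<le> R" "0 < R"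
    and R: "R \<le> dist b x" "R \<le> dist b y"
  shows "dist (proj t x) (proj t y) \<le> 2 * (t / R) * dist x y"
proof -
  have *: "dist (proj t x) (proj t y) \<le> 2 * (t / R) * dist x y"
    if "x \<in> X" "y \<in> X" "R \<le> dist b x" "dist b x \<le> dist b y" for x y
  proof -
    have "dist (proj t x) (proj t y) \<le> 2 * (t / dist b x) * dist x y"
      using proj_nonexpanding_near that t by auto
    also have "\<dots> \<le> 2 * (t / R) * dist x y"
      using that t by (intro mult_right_mono mult_left_mono divide_left_mono mult_pos_pos) auto
    finally show ?thesis .
  qed
  show ?thesis
    using *[of x y] *[of y x] x y R by (cases "dist b x \<le> dist b y") (auto simp: dist_commute)
qed

lemma proj_lipschitz:
  assumes x: "x \<in> X" and y: "y \<in> X" and t: "0 \<le> t"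
  shows "dist (proj t x) (proj t y) \<le> 2 * dist x y"
proof -
  have *: "dist (proj t x) (proj t y) \<le> 2 * dist x y"
    if x: "x \<in> X" and y: "y \<in> X" and le: "dist b x \<le> dist b y" for x y
  proof (cases "t \<le> dist b x")
    case True
    have "dist (proj t x) (proj t y) \<le> 2 * (t / dist b x) * dist x y"
      using proj_nonexpanding_near x y t True le by auto
    also have "\<dots> \<le> 2 * 1 * dist x y"
      using frac_in[OF t True] by (intro mult_right_mono mult_left_mono) auto
    finally show ?thesis by simp
  next
    case F: False
    then have px: "proj t x = x" by (simp add: proj_id)
    show ?thesis
    proof (cases "dist b y \<le> t")
      case True
      then show ?thesis using px by (simp add: proj_id)
    next
      case False
      \<comment> \<open>Here \<open>x\<close> is inside the ball and \<open>y\<close> outside: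
        projecting moves \<open>y\<close> by the overshoot \<open>dist b y - t\<close>, which is
        less than \<open>dist b y - dist b x\<close>.\<close>
      have "proj t y = \<sigma> b y (t / dist b y)" using proj_far y t False by auto
      then have "dist (proj t y) y = (1 - t / dist b y) * dist b y"
        using dist_\<sigma>_end[OF b_in y frac_in[OF t, of "dist b y"]] False by simp
      moreover have "dist b y > 0" using False t by linarith
      ultimately have "dist (proj t y) y = dist b y - t" by (simp add: left_diff_distrib)
      then have "dist x (proj t y) \<le> dist x y + (dist b y - t)"
        using dist_triangle[of x "proj t y" y] by (simp add: dist_commute)
      then show ?thesis using px F dist_triangle[of b y x] by simp
    qed
  qed
  show ?thesis
    using *[of x y] *[of y x] x y by (cases "dist b x \<le> dist b y") (auto simp: dist_commute)
qed

lemma dist_proj_proj_radius: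
  assumes x: "x \<in> X" and R: "0 \<le> R" "0 \<le> R'"
  shows "dist (proj R x) (proj R' x) \<le> \<bar>R - R'\<bar>"
proof -
  have *: "dist (proj R x) (proj R' x) \<le> R' - R" if "0 \<le> R" "R \<le> R'" for R R'
  proof (cases "dist b x \<le> R")
    case True
    then show ?thesis using that by (simp add: proj_id)
  next
    case False
    let ?z = "proj R' x"
    have z: "?z \<in> X" "dist b ?z = min R' (dist b x)" "R \<le> dist b ?z"
      using x that False proj_in[of x R'] dist_proj[of x R'] by auto
    have "proj R x = \<sigma> b ?z (R / dist b ?z)"
      using proj_proj[OF x that] proj_far[OF z(1) that(1) z(3)] by simp
    then have "dist (proj R x) ?z = (1 - R / dist b ?z) * dist b ?z"
      using dist_\<sigma>_end[OF b_in z(1) frac_in[OF that(1) z(3)]] by simp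
    also have "\<dots> = dist b ?z - R \<or> dist b ?z = 0" by (auto simp: field_simps)
    ultimately show ?thesis using z that by auto
  qed
  show ?thesis using *[of R R'] *[of R' R] R by (cases "R \<le> R'") (auto simp: dist_commute)
qed

section \<open>The compactification by radial projections\<close>

text \<open>A Frechet embedding: the supremum over \<open>z\<close> recovers the distance of \<open>proj n x\<close> and \<open>proj n y\<close>.\<close>

definition emb :: "'a \<Rightarrow> 'a ambient" where
  "emb x = Bcontfun (\<lambda>p. case of_discrete p of (n, z) \<Rightarrow> (dist (proj (real n) x) z - dist b z) / (real n + 1)\<^sup>2)"

lemma apply_emb:
  assumes x: "x \<in> X"
  shows "apply_bcontfun (emb x) (discrete (n, z)) = (dist (proj (real n) x) z - dist b z) / (real n + 1)\<^sup>2"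
proof -
  let ?f = "\<lambda>(n, z). (dist (proj (real n) x) z - dist b z) / (real n + 1)\<^sup>2"
  have "(\<lambda>p. ?f (of_discrete p)) \<in> bcontfun"
  proof (rule bcontfun_normI)
    show "continuous_on UNIV (\<lambda>p. ?f (of_discrete p))"
      by (simp add: continuous_on_open_vimage open_discrete)
    have "norm (?f p) \<le> 1" for p
    proof (cases p)
      case (Pair n z)
      have "\<bar>dist (proj (real n) x) z - dist b z\<bar> \<le> dist b (proj (real n) x)"
        using abs_dist_diff_le[of "proj (real n) x" z b] by (simp add: dist_commute)
      also have "\<dots> \<le> real n" using dist_proj[OF x, of "real n"] by simp
      also have "\<dots> \<le> (real n + 1)\<^sup>2" by (simp add: power2_eq_square algebra_simps)
      finally show ?thesis by (simp add: Pair divide_le_eq_1)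
    qed
    then show "norm (?f (of_discrete p)) \<le> 1" for p .
  qed
  then show ?thesis by (simp add: emb_def Bcontfun_inverse discrete_inverse)
qed

lemma emb_dist_le:
  assumes x: "x \<in> X" and y: "y \<in> X"
    and le: "\<And>n. dist (proj (real n) x) (proj (real n) y) \<le> e * (real n + 1)\<^sup>2"
  shows "dist (emb x) (emb y) \<le> e"
proof (rule dist_bound)
  fix p :: "(nat \<times> 'a) discrete"
  obtain n z where p: "p = discrete (n, z)" by (metis discrete_cases prod.exhaust)
  have "dist (emb x p) (emb y p) = \<bar>dist (proj (real n) x) z - dist (proj (real n) y) z\<bar> / (real n + 1)\<^sup>2"
    by (simp add: p apply_emb x y dist_real_def flip: diff_divide_distrib)
  also have "\<dots> \<le> dist (proj (real n) x) (proj (real n) y) / (real n + 1)\<^sup>2"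
    using abs_dist_diff_le[of "proj (real n) x" z "proj (real n) y"]
    by (intro divide_right_mono) (auto simp: dist_commute)
  also have "\<dots> \<le> e" using le[of n] by (simp add: divide_le_eq)
  finally show "dist (emb x p) (emb y p) \<le> e" .
qed

text \<open>The coordinate with \<open>z = proj n y\<close> attains the distance. Together with
  \<open>emb_dist_le\<close> this identifies the metric on the image as the weighted supremum over
  all radii.\<close>

lemma proj_nat_dist_le:
  assumes x: "x \<in> X" and y: "y \<in> X"
  shows "dist (proj (real n) x) (proj (real n) y) \<le> (real n + 1)\<^sup>2 * dist (emb x) (emb y)"
proof -
  have "dist (emb x (discrete (n, proj (real n) y))) (emb y (discrete (n, proj (real n) y))) = dist (proj (real n) x) (proj (real n) y) / (real n + 1)\<^sup>2"
    by (simp only: apply_emb x y dist_real_def flip: diff_divide_distrib) (simp add: abs_divide)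
  then have "dist (proj (real n) x) (proj (real n) y) / (real n + 1)\<^sup>2 \<le> dist (emb x) (emb y)"
    using dist_bounded[of "emb x" "discrete (n, proj (real n) y)" "emb y"] by simp
  then show ?thesis by (simp add: divide_le_eq mult.commute)
qed

lemma proj_dist_le:
  assumes x: "x \<in> X" and y: "y \<in> X" and R: "0 \<le> R"
  shows "dist (proj R x) (proj R y) \<le> 2 * (R + 2)\<^sup>2 * dist (emb x) (emb y)"
proof -
  \<comment> \<open>The metric sees integer radii only, so \<open>R\<close> is rounded up: this
    turns \<open>n + 1\<close> into \<open>R + 2\<close>, and coming back down to \<open>R\<close>
    costs the factor 2.\<close>
  define n where "n = nat \<lceil>R\<rceil>"
  have n: "R \<le> real n" "real n + 1 \<le> R + 2" using R by (auto simp: n_def) linarith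
  have "dist (proj R x) (proj R y) = dist (proj R (proj (real n) x)) (proj R (proj (real n) y))"
    using proj_proj x y R n by simp
  also have "\<dots> \<le> 2 * dist (proj (real n) x) (proj (real n) y)"
    using proj_lipschitz proj_in x y R by simp
  also have "\<dots> \<le> 2 * ((real n + 1)\<^sup>2 * dist (emb x) (emb y))"
    using proj_nat_dist_le[OF x y, of n] by simp
  also have "\<dots> \<le> 2 * ((R + 2)\<^sup>2 * dist (emb x) (emb y))"
    using n by (intro mult_left_mono mult_right_mono power_mono) auto
  finally show ?thesis by simp
qed

lemma one_le_Suc_square: "1 \<le> (real n + 1)\<^sup>2"
  by simp

lemma emb_lipschitz:
  assumes x: "x \<in> X" and y: "y \<in> X"
  shows "dist (emb x) (emb y) \<le> 2 * dist x y"
proof (rule emb_dist_le[OF x y])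
  fix n
  have "2 * dist x y * 1 \<le> 2 * dist x y * (real n + 1)\<^sup>2"
    by (intro mult_left_mono one_le_Suc_square) auto
  then show "dist (proj (real n) x) (proj (real n) y) \<le> 2 * dist x y * (real n + 1)\<^sup>2"
    using proj_lipschitz[OF x y, of "real n"] by simp
qed

text \<open>The two projections of radius \<open>n\<close> are at most \<open>2 * n\<close> apart,
  so after weighting all radii above \<open>N\<close> contribute at most
  \<open>2 / (N + 1)\<close>.\<close>

lemma emb_dist_le_cutoff:
  assumes x: "x \<in> X" and y: "y \<in> X" and e: "0 \<le> e" "2 / (real N + 1) \<le> e"
    and le: "\<And>n. n \<le> N \<Longrightarrow> dist (proj (real n) x) (proj (real n) y) \<le> e"
  shows "dist (emb x) (emb y) \<le> e"
proof (rule emb_dist_le[OF x y])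
  fix n
  show "dist (proj (real n) x) (proj (real n) y) \<le> e * (real n + 1)\<^sup>2"
  proof (cases "n \<le> N")
    case True
    have "e * 1 \<le> e * (real n + 1)\<^sup>2" using e by (intro mult_left_mono one_le_Suc_square) auto
    then show ?thesis using le[OF True] by simp
  next
    case False
    have "dist (proj (real n) x) (proj (real n) y) \<le> 2 * real n"
      using dist_triangle3[of "proj (real n) x" "proj (real n) y" b] dist_proj[OF x, of "real n"] dist_proj[OF y, of "real n"]
      by simp
    also have "\<dots> \<le> 2 * (real n + 1)" by simp
    also have "2 / (real n + 1) \<le> 2 / (real N + 1)" using False by (intro divide_left_mono) auto
    then have "2 / (real n + 1) \<le> e" using e by linarith
    then have "2 \<le> e * (real n + 1)" by (simp add: divide_le_eq)
    then have "2 * (real n + 1) \<le> e * (real n + 1) * (real n + 1)" by (intro mult_right_mono) auto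
    finally show ?thesis by (simp add: power2_eq_square mult.assoc)
  qed
qed

text \<open>Radii up to \<open>R\<close> do not distinguish \<open>x\<close> from
  \<open>proj R x\<close>. At a larger radius \<open>n\<close> the projections differ by at most
  \<open>n - R\<close>, which the weight turns into less than \<open>1 / (n + 1)\<close>.\<close>

lemma dist_emb_proj:
  assumes x: "x \<in> X" and R: "0 \<le> R"
  shows "dist (emb (proj R x)) (emb x) \<le> 1 / (R + 1)"
proof (rule emb_dist_le)
  fix n
  show "dist (proj (real n) (proj R x)) (proj (real n) x) \<le> 1 / (R + 1) * (real n + 1)\<^sup>2"
  proof (cases "real n \<le> R")
    case True
    then show ?thesis using proj_proj[OF x] R by simp
  next
    case False
    have "proj (real n) (proj R x) = proj R x"
      using dist_proj[OF x R] False by (intro proj_id) auto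
    then have "dist (proj (real n) (proj R x)) (proj (real n) x) \<le> real n + 1"
      using dist_proj_proj_radius[OF x R, of "real n"] R False by auto
    also have "\<dots> = 1 / (real n + 1) * (real n + 1)\<^sup>2" by (simp add: power2_eq_square)
    also have "\<dots> \<le> 1 / (R + 1) * (real n + 1)\<^sup>2"
      using False R by (intro mult_right_mono divide_left_mono) auto
    finally show ?thesis .
  qed
qed (use x R proj_in in auto)

lemma inj_emb: "inj_on emb X"
proof
  fix x y assume xy: "x \<in> X" "y \<in> X" "emb x = emb y"
  have "dist (proj R x) (proj R y) = 0" if "0 \<le> R" for R
    using proj_dist_le[OF xy(1,2) that] xy(3) by (simp add: antisym)
  from this[of "max (dist b x) (dist b y)"] show "x = y" by (simp add: proj_id le_max_iff_disj)
qed

section \<open>The compact space \<open>Xbar\<close> and the dense copy of \<open>X\<close> in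
  it\<close>

definition emb_image :: "'a ambient set" where "emb_image = emb ` X"

definition Xbar :: "'a ambient set" where "Xbar = closure emb_image"

definition emb_inv :: "'a ambient \<Rightarrow> 'a" where "emb_inv = inv_into X emb"

lemma emb_inv_emb [simp]: "x \<in> X \<Longrightarrow> emb_inv (emb x) = x"
  by (simp add: emb_inv_def inj_emb)

lemma emb_emb_inv [simp]: "u \<in> emb_image \<Longrightarrow> emb (emb_inv u) = u"
  by (auto simp: emb_image_def)

lemma emb_inv_in: "u \<in> emb_image \<Longrightarrow> emb_inv u \<in> X"
  by (auto simp: emb_image_def)

lemma emb_in: "x \<in> X \<Longrightarrow> emb x \<in> emb_image"
  by (auto simp: emb_image_def)

lemma emb_image_subset_Xbar: "emb_image \<subseteq> Xbar"
  by (simp add: Xbar_def closure_subset)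

lemma continuous_emb: "continuous_on X emb"
  unfolding continuous_on_iff
proof (intro ballI allI impI)
  fix x and e :: real assume x: "x \<in> X" and e: "0 < e"
  show "\<exists>d>0. \<forall>x'\<in>X. dist x' x < d \<longrightarrow> dist (emb x') (emb x) < e"
    using emb_lipschitz[OF _ x] e by (intro exI[of _ "e / 2"]) fastforce
qed

lemma compact_Xbar: "compact Xbar"
  unfolding compact_eq_totally_bounded
proof (intro conjI allI impI)
  show "complete Xbar" by (simp add: Xbar_def complete_eq_closed)
  fix e :: real assume e: "0 < e"
  define R where "R = 4 / e"
  have R: "0 \<le> R" "1 / (R + 1) < e / 4" using e by (auto simp: R_def field_simps)
  have "compact (emb ` (X \<inter> cball b R))"
    by (intro compact_continuous_image proper continuous_on_subset[OF continuous_emb]) auto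
  then obtain k where k: "finite k" "emb ` (X \<inter> cball b R) \<subseteq> (\<Union>x\<in>k. ball x (e / 4))"
    unfolding compact_eq_totally_bounded using e by (metis zero_less_divide_iff zero_less_numeral)
  have "Xbar \<subseteq> (\<Union>x\<in>k. ball x e)"
  proof
    fix y assume "y \<in> Xbar"
    then obtain x where x: "x \<in> X" "dist (emb x) y < e / 4"
      using e unfolding Xbar_def emb_image_def closure_approachable by (metis image_iff zero_less_divide_iff zero_less_numeral)
    obtain z where z: "z \<in> k" "dist z (emb (proj R x)) < e / 4"
      using k(2) proj_in_ball[OF x(1) R(1)] by force
    have "dist z y \<le> dist z (emb (proj R x)) + dist (emb (proj R x)) (emb x) + dist (emb x) y"
      using dist_triangle[of z y "emb x"] dist_triangle[of z "emb x" "emb (proj R x)"] by linarith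
    also have "\<dots> < e" using z x(2) dist_emb_proj[OF x(1) R(1)] R(2) e by linarith
    finally show "y \<in> (\<Union>x\<in>k. ball x e)" using z(1) by auto
  qed
  then show "\<exists>k. finite k \<and> Xbar \<subseteq> (\<Union>x\<in>k. ball x e)" using k(1) by blast
qed

section \<open>Extension of the radial projections to the boundary\<close>

definition retr :: "real \<Rightarrow> 'a ambient \<Rightarrow> 'a" where
  "retr R = (SOME g. continuous_on Xbar g \<and> (\<forall>x\<in>X. g (emb x) = proj R x))"

text \<open>By \<open>proj_dist_le\<close> the projection is Lipschitz for the metric of the
  embedding, so it extends to the closure with values in a complete space.\<close>

lemma retr_properties:
  assumes R: "0 \<le> R"
  shows "continuous_on Xbar (retr R)" "\<And>x. x \<in> X \<Longrightarrow> retr R (emb x) = proj R x"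
proof -
  have "uniformly_continuous_on emb_image (\<lambda>u. proj R (emb_inv u))"
    unfolding uniformly_continuous_on_def
  proof (intro allI impI)
    fix e :: real assume e: "0 < e"
    define L where "L = 2 * (R + 2)\<^sup>2"
    have L: "0 < L" using R by (simp add: L_def)
    show "\<exists>d>0. \<forall>x\<in>emb_image. \<forall>x'\<in>emb_image. dist x' x < d \<longrightarrow> dist (proj R (emb_inv x')) (proj R (emb_inv x)) < e"
    proof (intro exI[of _ "e / L"] conjI ballI impI)
      show "0 < e / L" using e L by simp
      fix u v assume uv: "u \<in> emb_image" "v \<in> emb_image" "dist v u < e / L"
      have "dist (proj R (emb_inv v)) (proj R (emb_inv u)) \<le> L * dist v u"
        using proj_dist_le[of "emb_inv v" "emb_inv u" R] uv R emb_inv_in by (simp add: L_def)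
      also have "\<dots> < e" using uv(3) L by (simp add: field_simps)
      finally show "dist (proj R (emb_inv v)) (proj R (emb_inv u)) < e" .
    qed
  qed
  then obtain g where g: "uniformly_continuous_on Xbar g" "\<And>u. u \<in> emb_image \<Longrightarrow> proj R (emb_inv u) = g u"
    unfolding Xbar_def by (rule uniformly_continuous_on_extension_on_closure) blast
  have "continuous_on Xbar g \<and> (\<forall>x\<in>X. g (emb x) = proj R x)"
    using g(1) g(2)[OF emb_in] by (simp add: uniformly_continuous_imp_continuous)
  then have "continuous_on Xbar (retr R) \<and> (\<forall>x\<in>X. retr R (emb x) = proj R x)"
    unfolding retr_def by (rule someI[of "\<lambda>g. continuous_on Xbar g \<and> (\<forall>x\<in>X. g (emb x) = proj R x)"])
  then show "continuous_on Xbar (retr R)" "\<And>x. x \<in> X \<Longrightarrow> retr R (emb x) = proj R x" by auto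
qed

lemma retr_in_ball:
  assumes R: "0 \<le> R" and y: "y \<in> Xbar"
  shows "retr R y \<in> X \<inter> cball b R"
proof -
  have "retr R ` closure emb_image \<subseteq> X \<inter> cball b R"
  proof (rule image_closure_subset)
    show "continuous_on (closure emb_image) (retr R)" using retr_properties(1)[OF R] by (simp add: Xbar_def)
    show "closed (X \<inter> cball b R)" by (intro compact_imp_closed proper)
    show "retr R ` emb_image \<subseteq> X \<inter> cball b R"
      using retr_properties(2)[OF R] proj_in_ball[OF _ R] by (auto simp: emb_image_def)
  qed
  then show ?thesis using y by (auto simp: Xbar_def)
qed

lemma retr_in: "\<lbrakk>0 \<le> R; y \<in> Xbar\<rbrakk> \<Longrightarrow> retr R y \<in> X"
  using retr_in_ball by blast

text \<open>Both sides are continuous in the pair of points, and pairs from \<open>emb_image\<close>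
  are dense; the next two estimates pass to the closure in the same way.\<close>

lemma retr_lipschitz:
  assumes R: "0 \<le> R" and y: "y \<in> Xbar" and y': "y' \<in> Xbar"
  shows "dist (retr R y) (retr R y') \<le> 2 * (R + 2)\<^sup>2 * dist y y'"
proof -
  let ?f = "\<lambda>p. dist (retr R (fst p)) (retr R (snd p)) - 2 * (R + 2)\<^sup>2 * dist (fst p) (snd p)"
  have "?f (y, y') \<le> 0"
  proof (rule continuous_le_on_closure[of "emb_image \<times> emb_image"])
    show "continuous_on (closure (emb_image \<times> emb_image)) ?f"
      unfolding closure_Times Xbar_def[symmetric]
      by (intro continuous_intros continuous_on_compose2[OF retr_properties(1)[OF R]]) auto
    show "(y, y') \<in> closure (emb_image \<times> emb_image)" using y y' by (simp add: closure_Times Xbar_def)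
    show "?f p \<le> 0" if "p \<in> emb_image \<times> emb_image" for p
      using that proj_dist_le[OF _ _ R] retr_properties(2)[OF R] by (auto simp: emb_image_def)
  qed
  then show ?thesis by simp
qed

lemma retr_radius_lipschitz:
  assumes R: "0 \<le> R" "0 \<le> R'" and y: "y \<in> Xbar"
  shows "dist (retr R y) (retr R' y) \<le> \<bar>R - R'\<bar>"
proof (rule continuous_le_on_closure[of emb_image])
  show "continuous_on (closure emb_image) (\<lambda>y. dist (retr R y) (retr R' y))"
    using retr_properties(1)[OF R(1)] retr_properties(1)[OF R(2)] by (auto simp: Xbar_def intro!: continuous_intros)
  show "y \<in> closure emb_image" using y by (simp add: Xbar_def)
  show "dist (retr R u) (retr R' u) \<le> \<bar>R - R'\<bar>" if "u \<in> emb_image" for u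
    using that dist_proj_proj_radius[OF _ R] retr_properties(2)[OF R(1)] retr_properties(2)[OF R(2)]
    by (auto simp: emb_image_def)
qed

lemma dist_emb_retr:
  assumes R: "0 \<le> R" and y: "y \<in> Xbar"
  shows "dist (emb (retr R y)) y \<le> 1 / (R + 1)"
proof (rule continuous_le_on_closure[of emb_image])
  show "continuous_on (closure emb_image) (\<lambda>y. dist (emb (retr R y)) y)"
    unfolding Xbar_def[symmetric]
    using retr_in[OF R] by (intro continuous_intros continuous_on_compose2[OF continuous_emb retr_properties(1)[OF R]]) auto
  show "y \<in> closure emb_image" using y by (simp add: Xbar_def)
  show "dist (emb (retr R u)) u \<le> 1 / (R + 1)" if "u \<in> emb_image" for u
    using that dist_emb_proj[OF _ R] retr_properties(2)[OF R] by (auto simp: emb_image_def)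
qed

text \<open>For points of \<open>X\<close> near \<open>y\<close> the projection stays strictly
  inside the ball of radius \<open>R\<close>, hence is the identity there. So a sequence from
  \<open>emb_image\<close> tending to \<open>y\<close> eventually agrees with its image under
  \<open>emb\<close> after \<open>retr R\<close>, and the limits agree too.\<close>

lemma emb_retr_interior:
  assumes R: "0 \<le> R" and y: "y \<in> Xbar" and lt: "dist b (retr R y) < R"
  shows "y = emb (retr R y)"
proof -
  obtain u where u: "\<And>n. u n \<in> emb_image" "u \<longlonglongrightarrow> y" using y unfolding Xbar_def closure_sequential by blast
  have uP: "(\<lambda>n. retr R (u n)) \<longlonglongrightarrow> retr R y"
  proof (rule continuous_on_tendsto_compose[OF retr_properties(1)[OF R] u(2) y])
    show "\<forall>\<^sub>F n in sequentially. u n \<in> Xbar" using u(1) emb_image_subset_Xbar by (intro always_eventually) blast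
  qed
  have "(\<lambda>n. emb (retr R (u n))) \<longlonglongrightarrow> emb (retr R y)"
  proof (rule continuous_on_tendsto_compose[OF continuous_emb uP retr_in[OF R y]])
    show "\<forall>\<^sub>F n in sequentially. retr R (u n) \<in> X"
      using u(1) emb_image_subset_Xbar retr_in[OF R] by (intro always_eventually) blast
  qed
  moreover have "\<forall>\<^sub>F n in sequentially. emb (retr R (u n)) = u n"
  proof -
    have "\<forall>\<^sub>F n in sequentially. dist b (retr R (u n)) < R"
      using uP lt by (intro order_tendstoD(2)[OF tendsto_dist[OF tendsto_const uP]])
    then show ?thesis
    proof eventually_elim
      case (elim n)
      obtain x where x: "x \<in> X" "u n = emb x" using u(1)[of n] by (auto simp: emb_image_def)
      then have "min R (dist b x) < R" using elim retr_properties(2)[OF R x(1)] dist_proj[OF x(1) R] by simp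
      then have "proj R x = x" by (intro proj_id) simp
      then show ?case using x retr_properties(2)[OF R x(1)] by simp
    qed
  qed
  ultimately have "u \<longlonglongrightarrow> emb (retr R y)" by (rule Lim_transform_eventually)
  then show ?thesis using u(2) LIMSEQ_unique by blast
qed

section \<open>The copy of \<open>X\<close> is open and carries the original topology\<close>

lemma emb_image_ball_witness:
  assumes "u \<in> emb_image"
  obtains R where "0 < R" "dist b (retr R u) < R"
proof -
  obtain x where x: "x \<in> X" "u = emb x" using assms by (auto simp: emb_image_def)
  have "retr (dist b x + 1) u = x" using x retr_properties(2)[of "dist b x + 1" x] by (simp add: proj_id)
  then show ?thesis by (intro that[of "dist b x + 1"]) (auto simp: add_nonneg_pos)
qed

lemma openin_emb_image: "openin (top_of_set Xbar) emb_image"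
proof -
  have "emb_image = (\<Union>R\<in>{0<..}. Xbar \<inter> retr R -` ball b R)"
  proof safe
    fix u assume u: "u \<in> emb_image"
    then obtain R where "0 < R" "dist b (retr R u) < R" by (rule emb_image_ball_witness)
    then show "u \<in> (\<Union>R\<in>{0<..}. Xbar \<inter> retr R -` ball b R)" using u emb_image_subset_Xbar by auto
  next
    fix y and R :: real assume "y \<in> Xbar" "0 < R" "retr R y \<in> ball b R"
    then show "y \<in> emb_image" using emb_retr_interior[of R y] retr_in[of R y] emb_in by (metis less_imp_le mem_ball)
  qed
  moreover have "openin (top_of_set Xbar) (Xbar \<inter> retr R -` ball b R)" if "0 < R" for R
    using retr_properties(1)[of R] that by (intro continuous_openin_preimage_gen) auto
  then have "openin (top_of_set Xbar) (\<Union>R\<in>{0<..}. Xbar \<inter> retr R -` ball b R)" by (intro openin_Union) auto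
  ultimately show ?thesis by metis
qed

text \<open>Near a given point the inverse coincides with \<open>retr R\<close> for a suitable
  \<open>R\<close>, and \<open>retr R\<close> is continuous on all of \<open>Xbar\<close>.\<close>

lemma continuous_emb_inv: "continuous_on emb_image emb_inv"
  unfolding continuous_on_iff
proof (intro ballI allI impI)
  fix u and e :: real assume u: "u \<in> emb_image" and e: "0 < e"
  obtain R where R: "0 < R" "dist b (retr R u) < R" using emb_image_ball_witness[OF u] .
  have Ru: "emb_inv v = retr R v" if "v \<in> emb_image" "dist b (retr R v) < R" for v
  proof -
    have "v \<in> Xbar" using that emb_image_subset_Xbar by blast
    then show ?thesis using emb_retr_interior[of R v] that R emb_inv_emb[of "retr R v"] retr_in[of R v] by simp
  qed
  have "openin (top_of_set Xbar) (Xbar \<inter> retr R -` (ball b R \<inter> ball (retr R u) e))"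
    using retr_properties(1)[of R] R by (intro continuous_openin_preimage_gen) auto
  moreover have "u \<in> Xbar \<inter> retr R -` (ball b R \<inter> ball (retr R u) e)" using u R e emb_image_subset_Xbar by auto
  ultimately obtain d where d: "0 < d" "ball u d \<inter> Xbar \<subseteq> Xbar \<inter> retr R -` (ball b R \<inter> ball (retr R u) e)"
    unfolding openin_contains_ball by blast
  show "\<exists>d>0. \<forall>v\<in>emb_image. dist v u < d \<longrightarrow> dist (emb_inv v) (emb_inv u) < e"
  proof (intro exI[of _ d] conjI ballI impI d(1))
    fix v assume v: "v \<in> emb_image" "dist v u < d"
    then have "v \<in> ball u d \<inter> Xbar" using emb_image_subset_Xbar by (auto simp: dist_commute)
    then have "dist b (retr R v) < R" "dist (retr R u) (retr R v) < e" using d(2) by auto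
    then show "dist (emb_inv v) (emb_inv u) < e" using Ru v u R by (simp add: dist_commute)
  qed
qed

text \<open>Time \<open>t\<close> corresponds to radius \<open>1 / t\<close>, so positive times land
  in the copy of \<open>X\<close> and the radius tends to infinity at time 0. That time needs its
  own branch: \<open>1 / 0 = 0\<close> would collapse everything to \<open>b\<close>.\<close>

definition push :: "real \<times> 'a ambient \<Rightarrow> 'a ambient" where
  "push = (\<lambda>(t, y). if t \<le> 0 then y else emb (retr (1 / t) y))"

lemma dist_push_id: "\<lbrakk>0 \<le> t; y \<in> Xbar\<rbrakk> \<Longrightarrow> dist (push (t, y)) y \<le> t"
proof (cases "t = 0")
  case False
  assume "0 \<le> t" "y \<in> Xbar"
  then have "dist (push (t, y)) y \<le> 1 / (1 / t + 1)" using False dist_emb_retr[of "1 / t" y] by (simp add: push_def)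
  also have "\<dots> \<le> 1 / (1 / t)" using False \<open>0 \<le> t\<close> by (intro divide_left_mono mult_pos_pos add_pos_pos) auto
  finally show ?thesis by simp
qed (simp add: push_def)

lemma continuous_push: "continuous_on ({0..1} \<times> Xbar) push"
proof -
  have "continuous (at p within {0..1} \<times> Xbar) push" if p: "p \<in> {0..1} \<times> Xbar" for p :: "real \<times> 'a ambient"
  proof (cases "fst p = 0")
    case True
    obtain y where y: "p = (0, y)" "y \<in> Xbar" using p True by auto
    have "((\<lambda>q. dist (push q) y) \<longlongrightarrow> 0) (at p within {0..1} \<times> Xbar)"
    proof (rule tendsto_sandwich[of "\<lambda>_. 0" _ _ "\<lambda>q. fst q + dist (snd q) y"])
      have "((\<lambda>q. fst q + dist (snd q) y :: real) \<longlongrightarrow> fst p + dist (snd p) y) (at p within {0..1} \<times> Xbar)"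
        by (intro tendsto_intros)
      then show "((\<lambda>q. fst q + dist (snd q) y :: real) \<longlongrightarrow> 0) (at p within {0..1} \<times> Xbar)" by (simp add: y)
      show "\<forall>\<^sub>F q in at p within {0..1} \<times> Xbar. dist (push q) y \<le> fst q + dist (snd q) y"
        unfolding eventually_at
      proof (intro exI[of _ 1] conjI ballI impI)
        fix q :: "real \<times> 'a ambient" assume "q \<in> {0..1} \<times> Xbar"
        then show "dist (push q) y \<le> fst q + dist (snd q) y"
          using dist_push_id[of "fst q" "snd q"] dist_triangle[of "push q" y "snd q"] by (cases q) auto
      qed simp
    qed auto
    then have "(push \<longlongrightarrow> y) (at p within {0..1} \<times> Xbar)" by (rule tendsto_dist_iff[THEN iffD2])
    then show ?thesis by (simp add: continuous_within y push_def)
  next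
    case False
    obtain t y where y: "p = (t, y)" "y \<in> Xbar" "0 < t" "t \<le> 1" using p False by (cases p) auto
    \<comment> \<open>At positive times the Lipschitz bounds in the radius and in the point combine.
      Leaving out time 0 does not affect the limit and keeps \<open>1 / fst q\<close>
      meaningful.\<close>
    let ?S = "{0<..1} \<times> Xbar"
    have c: "((\<lambda>q. retr (1 / fst q) (snd q)) \<longlongrightarrow> retr (1 / t) y) (at p within ?S)"
    proof -
      have "((\<lambda>q. dist (retr (1 / fst q) (snd q)) (retr (1 / t) y)) \<longlongrightarrow> 0) (at p within ?S)"
      proof (rule tendsto_sandwich[of "\<lambda>_. 0" _ _ "\<lambda>q. \<bar>1 / fst q - 1 / t\<bar> + 2 * (1 / t + 2)\<^sup>2 * dist (snd q) y"])
        have "((\<lambda>q. \<bar>1 / fst q - 1 / t\<bar> + 2 * (1 / t + 2)\<^sup>2 * dist (snd q) y) \<longlongrightarrow>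
            \<bar>1 / fst p - 1 / t\<bar> + 2 * (1 / t + 2)\<^sup>2 * dist (snd p) y) (at p within ?S)"
          using y by (intro tendsto_intros) auto
        then show "((\<lambda>q. \<bar>1 / fst q - 1 / t\<bar> + 2 * (1 / t + 2)\<^sup>2 * dist (snd q) y) \<longlongrightarrow> 0) (at p within ?S)"
          by (simp add: y)
        show "\<forall>\<^sub>F q in at p within ?S. dist (retr (1 / fst q) (snd q)) (retr (1 / t) y)
            \<le> \<bar>1 / fst q - 1 / t\<bar> + 2 * (1 / t + 2)\<^sup>2 * dist (snd q) y"
          unfolding eventually_at
        proof (intro exI[of _ 1] conjI ballI impI)
          fix q :: "real \<times> 'a ambient" assume "q \<in> ?S"
          then have q: "0 < fst q" "snd q \<in> Xbar" by auto
          show "dist (retr (1 / fst q) (snd q)) (retr (1 / t) y) \<le> \<bar>1 / fst q - 1 / t\<bar> + 2 * (1 / t + 2)\<^sup>2 * dist (snd q) y"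
            using retr_radius_lipschitz[of "1 / fst q" "1 / t" "snd q"] retr_lipschitz[of "1 / t" "snd q" y] q y
              dist_triangle[of "retr (1 / fst q) (snd q)" "retr (1 / t) y" "retr (1 / t) (snd q)"] by simp
        qed simp
      qed auto
      then show ?thesis by (rule tendsto_dist_iff[THEN iffD2])
    qed
    have "((\<lambda>q. emb (retr (1 / fst q) (snd q))) \<longlongrightarrow> emb (retr (1 / t) y)) (at p within ?S)"
    proof (rule continuous_on_tendsto_compose[OF continuous_emb c])
      show "retr (1 / t) y \<in> X" using y retr_in by simp
      show "\<forall>\<^sub>F q in at p within ?S. retr (1 / fst q) (snd q) \<in> X"
        unfolding eventually_at by (intro exI[of _ 1]) (auto intro!: retr_in)
    qed
    moreover have "\<forall>\<^sub>F q in at p within ?S. emb (retr (1 / fst q) (snd q)) = push q"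
      unfolding eventually_at by (intro exI[of _ 1]) (auto simp: push_def)
    ultimately have "(push \<longlongrightarrow> push p) (at p within ?S)"
      using y by (simp add: push_def Lim_transform_eventually)
    moreover have "at p within ({0..1} \<times> Xbar) = at p within ?S"
      using y by (intro at_within_nhd[of _ "{0<..} \<times> UNIV"]) (auto intro: open_Times)
    ultimately show ?thesis by (simp add: continuous_within)
  qed
  then show ?thesis by (simp add: continuous_on_eq_continuous_within)
qed

lemma push_in: "\<lbrakk>0 \<le> t; y \<in> Xbar\<rbrakk> \<Longrightarrow> push (t, y) \<in> Xbar"
  using retr_in[of "1 / t" y] emb_in emb_image_subset_Xbar by (auto simp: push_def)

lemma push_in_emb_image: "\<lbrakk>0 < t; y \<in> Xbar\<rbrakk> \<Longrightarrow> push (t, y) \<in> emb_image"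
  using retr_in[of "1 / t" y] emb_in by (auto simp: push_def)

lemma Z_set_boundary: "Z_set (top_of_set Xbar) (Xbar - emb_image)"
  unfolding Z_set_def
proof (intro exI[of _ push] conjI ballI)
  show "continuous_map (prod_topology (top_of_set {0..1}) (top_of_set Xbar)) (top_of_set Xbar) push"
    using continuous_push push_in by (auto simp: prod_topology_subtopology_eu continuous_map_in_subtopology)
  show "push (0, x) = x" for x by (simp add: push_def)
  show "(\<lambda>x. push (t, x)) ` topspace (top_of_set Xbar) \<inter> (Xbar - emb_image) = {}" if "t \<in> {0<..1}" for t
    using that push_in_emb_image by auto
qed

lemma emb_null:
  assumes C: "0 \<le> C" and e: "0 < e"
  obtains R where "0 < R" "\<And>x y. \<lbrakk>x \<in> X; y \<in> X; R \<le> dist b x; R \<le> dist b y; dist x y \<le> C\<rbrakk> \<Longrightarrow> dist (emb x) (emb y) < e"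
proof -
  obtain N where N: "4 / e < real N" using reals_Archimedean2 by blast
  \<comment> \<open>The middle summand makes \<open>2 * (N / R) * C\<close> at most
    \<open>e / 2\<close>, and \<open>N \<le> R\<close> allows the contraction estimate for all radii
    up to \<open>N\<close>; the larger radii are handled by the cutoff.\<close>
  define R where "R = real N + 4 * real N * C / e + 1"
  have R0: "0 \<le> 4 * real N * C / e" using C e by simp
  have R: "0 < R" "real N \<le> R" "4 * real N * C / e \<le> R" using R0 by (auto simp: R_def)
  show ?thesis
  proof
    show "0 < R" by fact
    fix x y assume xy: "x \<in> X" "y \<in> X" "R \<le> dist b x" "R \<le> dist b y" "dist x y \<le> C"
    have "dist (emb x) (emb y) \<le> e / 2"
    proof (rule emb_dist_le_cutoff[of _ _ _ N])
      show "2 / (real N + 1) \<le> e / 2" using N e by (simp add: field_simps)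
      fix n assume n: "n \<le> N"
      have "dist (proj (real n) x) (proj (real n) y) \<le> 2 * (real n / R) * dist x y"
        using xy n R by (intro proj_contract_far) auto
      also have "\<dots> \<le> 2 * (real N / R) * C"
        using xy n R C by (intro mult_mono divide_right_mono) auto
      also have "\<dots> \<le> e / 2" using R e by (simp add: field_simps)
      finally show "dist (proj (real n) x) (proj (real n) y) \<le> e / 2" .
    qed (use xy e in auto)
    then show "dist (emb x) (emb y) < e" using e by simp
  qed
qed

text \<open>Compare the geodesics to \<open>g x\<close> issuing from \<open>b\<close> and from \<open>g b\<close>: at equal parameters they are
  at distance at most \<open>dist b (g b)\<close>, and radial projection shrinks this error.\<close>

lemma proj_isometry_proj:
  assumes gX: "\<And>x. x \<in> X \<Longrightarrow> g x \<in> X" and giso: "\<And>x y. \<lbrakk>x \<in> X; y \<in> X\<rbrakk> \<Longrightarrow> dist (g x) (g y) = dist x y"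
    and g\<sigma>: "\<And>x y t. \<lbrakk>x \<in> X; y \<in> X; t \<in> {0..1}\<rbrakk> \<Longrightarrow> g (\<sigma> x y t) = \<sigma> (g x) (g y) t"
    and x: "x \<in> X" and k: "dist b (g b) < k" and n: "0 \<le> n" "n \<le> k - dist b (g b)"
  shows "dist (proj n (g x)) (proj n (g (proj k x))) \<le> 2 * n * dist b (g b) / (k - dist b (g b))"
proof (cases "dist b x \<le> k")
  case True
  then show ?thesis using n k by (simp add: proj_id)
next
  case False
  define c where "c = dist b (g b)"
  have c: "0 \<le> c" "c < k" using k by (auto simp: c_def)
  define s where "s = k / dist b x"
  have s: "s \<in> {0..1}" "s * dist b x = k" using False c unfolding s_def by (auto simp: divide_le_eq_1)
  have gb: "g b \<in> X" and gx: "g x \<in> X" using gX b_in x by auto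
  define w where "w = \<sigma> b (g x) s"
  have wX: "w \<in> X" using \<sigma>_in b_in gx s by (simp add: w_def)
  have pk: "proj k x = \<sigma> b x s" using False by (simp add: proj_def s_def)
  have pX: "g (proj k x) \<in> X" using gX proj_in[OF x] c by simp
  have gpk: "g (proj k x) = \<sigma> (g b) (g x) s" using pk g\<sigma>[OF b_in x s(1)] by simp
  have "dist w (g (proj k x)) \<le> (1 - s) * c + s * 0"
    using \<sigma>_conical[OF b_in gx gb gx s(1)] by (simp add: w_def gpk c_def)
  also have "\<dots> \<le> c" using s c by (simp add: mult_left_le_one_le)
  finally have wc: "dist w (g (proj k x)) \<le> c" .
  have "dist b x - c \<le> dist b (g x)"
    using giso[OF b_in x] dist_triangle[of "g b" "g x" b] by (simp add: c_def dist_commute)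
  then have "s * (dist b x - c) \<le> s * dist b (g x)" using s by (intro mult_left_mono) auto
  moreover have "s * c \<le> c" using s c by (simp add: mult_left_le_one_le)
  moreover have dw: "dist b w = s * dist b (g x)" using dist_\<sigma>_start b_in gx s by (simp add: w_def)
  ultimately have bw: "k - c \<le> dist b w" using s(2) by (simp add: right_diff_distrib)
  have "dist (g b) (g (proj k x)) = k"
    using giso[OF b_in proj_in[OF x]] dist_proj[OF x, of k] c False by simp
  then have bp: "k - c \<le> dist b (g (proj k x))"
    using dist_triangle[of "g b" "g (proj k x)" b] by (simp add: c_def dist_commute)
  \<comment> \<open>\<open>w\<close> is the radial projection of \<open>g x\<close> to radius
    \<open>dist b w\<close>, which is at least \<open>n\<close>, so projecting further to radius
    \<open>n\<close> forgets the difference.\<close>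
  have "proj n (g x) = proj n w"
  proof -
    have "dist b w \<le> dist b (g x)" using dw s by (simp add: mult_left_le_one_le)
    then have "proj (dist b w) (g x) = w"
      using proj_far[OF gx, of "dist b w"] dw s c bw by (auto simp: w_def)
    then show ?thesis using proj_proj[OF gx n(1), of "dist b w"] bw n by (simp add: c_def)
  qed
  then have "dist (proj n (g x)) (proj n (g (proj k x))) \<le> 2 * (n / (k - c)) * dist w (g (proj k x))"
    using proj_contract_far[OF wX pX n(1), of "k - c"] n c bw bp by (simp add: c_def)
  also have "\<dots> \<le> 2 * (n / (k - c)) * c" using wc n c by (intro mult_left_mono) auto
  finally show ?thesis by (simp add: c_def)
qed

text \<open>Truncate at a large radius \<open>k\<close> before applying \<open>g\<close>. The
  truncated points depend uniformly on the embedded ones by \<open>proj_dist_le\<close>, and at the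
  finitely many radii that matter \<open>proj_isometry_proj\<close> bounds the effect of the
  truncation.\<close>

lemma isometry_emb_uniform:
  assumes gX: "\<And>x. x \<in> X \<Longrightarrow> g x \<in> X" and giso: "\<And>x y. \<lbrakk>x \<in> X; y \<in> X\<rbrakk> \<Longrightarrow> dist (g x) (g y) = dist x y"
    and g\<sigma>: "\<And>x y t. \<lbrakk>x \<in> X; y \<in> X; t \<in> {0..1}\<rbrakk> \<Longrightarrow> g (\<sigma> x y t) = \<sigma> (g x) (g y) t"
  shows "uniformly_continuous_on emb_image (\<lambda>u. emb (g (emb_inv u)))"
  unfolding uniformly_continuous_on_def
proof (intro allI impI)
  fix e :: real assume e: "0 < e"
  define c where "c = dist b (g b)"
  have c: "0 \<le> c" by (simp add: c_def)
  obtain N where N: "4 / e < real N" using reals_Archimedean2 by blast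
  \<comment> \<open>With \<open>16 * N * c / e \<le> k - c\<close> each of the two truncation errors
    is at most \<open>e / 8\<close>; the choice of \<open>d\<close> below makes the middle term at
    most \<open>e / 4\<close>, so the sum is \<open>e / 2\<close>.\<close>
  define k where "k = c + real N + 16 * real N * c / e + 1"
  have "0 \<le> 16 * real N * c / e" using c e by simp
  then have k: "c < k" "real N \<le> k - c" "16 * real N * c / e \<le> k - c" "0 \<le> k" using c by (auto simp: k_def)
  define d where "d = e / (16 * (k + 2)\<^sup>2)"
  have k2: "0 < (k + 2)\<^sup>2" using k by simp
  have d: "0 < d" using e k2 by (simp add: d_def)
  have main: "dist (emb (g x)) (emb (g y)) < e" if x: "x \<in> X" and y: "y \<in> X" and xy: "dist (emb x) (emb y) < d" for x y
  proof -
    have "dist (emb (g x)) (emb (g y)) \<le> e / 2"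
    proof (rule emb_dist_le_cutoff[of _ _ _ N])
      show "2 / (real N + 1) \<le> e / 2" using N e by (simp add: field_simps)
      fix n assume n: "n \<le> N"
      have near: "dist (proj (real n) (g z)) (proj (real n) (g (proj k z))) \<le> e / 8" if z: "z \<in> X" for z
      proof -
        have "dist (proj (real n) (g z)) (proj (real n) (g (proj k z))) \<le> 2 * real n * c / (k - c)"
          using proj_isometry_proj[OF gX giso g\<sigma> z, of k "real n"] k n by (simp add: c_def)
        also have "\<dots> \<le> 2 * real N * c / (k - c)"
          using n k c by (intro divide_right_mono mult_right_mono) auto
        also have "\<dots> \<le> e / 8" using k e by (simp add: field_simps)
        finally show ?thesis .
      qed
      have "dist (proj (real n) (g (proj k x))) (proj (real n) (g (proj k y))) \<le> 2 * dist (proj k x) (proj k y)"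
        using proj_lipschitz[of "g (proj k x)" "g (proj k y)" "real n"] giso[of "proj k x" "proj k y"] gX proj_in x y k by simp
      also have "\<dots> \<le> 2 * (2 * (k + 2)\<^sup>2 * dist (emb x) (emb y))"
        using proj_dist_le[OF x y k(4)] by simp
      also have "\<dots> \<le> 2 * (2 * (k + 2)\<^sup>2 * d)"
        using xy k2 by (intro mult_left_mono) auto
      also have "\<dots> = e / 4" using k2 by (simp add: d_def)
      finally have mid: "dist (proj (real n) (g (proj k x))) (proj (real n) (g (proj k y))) \<le> e / 4" .
      show "dist (proj (real n) (g x)) (proj (real n) (g y)) \<le> e / 2"
        using near[OF x] near[OF y] mid
          dist_triangle[of "proj (real n) (g x)" "proj (real n) (g y)" "proj (real n) (g (proj k x))"]
          dist_triangle[of "proj (real n) (g (proj k x))" "proj (real n) (g y)" "proj (real n) (g (proj k y))"]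
        by (simp add: dist_commute)
    qed (use gX x y e in auto)
    then show ?thesis using e by simp
  qed
  show "\<exists>d>0. \<forall>u\<in>emb_image. \<forall>v\<in>emb_image. dist v u < d \<longrightarrow> dist (emb (g (emb_inv v))) (emb (g (emb_inv u))) < e"
    using d main by (intro exI[of _ d]) (auto simp: emb_image_def)
qed

text \<open>Taking preimages under \<open>retr R\<close> may identify members of a cover but cannot
  raise its order, since the preimages containing \<open>y\<close> come from members containing
  \<open>retr R y\<close>. Small members have small preimages in \<open>Xbar\<close> because
  \<open>retr R\<close> displaces points by less than \<open>e / 8\<close>.\<close>

lemma fine_covers_Xbar:
  assumes dim: "covering_dim_le (top_of_set X) n"
  shows "fine_covers_of_order Xbar (n + 1)"
  unfolding fine_covers_of_order_def
proof (intro allI impI)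
  fix e :: real assume e: "0 < e"
  define R where "R = 8 / e"
  have R: "0 \<le> R" "1 / (R + 1) < e / 8" using e by (auto simp: R_def field_simps)
  have near: "dist (emb (retr R y)) y < e / 8" if "y \<in> Xbar" for y
    using dist_emb_retr[OF R(1) that] R(2) by linarith
  \<comment> \<open>Points in one ball are less than \<open>e / 8\<close> apart, their images under
    \<open>emb\<close> less than \<open>e / 4\<close>; two displacements of less than
    \<open>e / 8\<close> keep the mesh below \<open>e\<close>.\<close>
  define \<U> where "\<U> = (\<lambda>x. X \<inter> ball x (e / 16)) ` X"
  have "open_cover_of (top_of_set X) \<U>"
    using e by (auto simp: open_cover_of_def \<U>_def)
  then obtain \<V> where \<V>: "open_cover_of (top_of_set X) \<V>" "\<forall>V\<in>\<V>. \<exists>T\<in>\<U>. V \<subseteq> T"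
    "\<forall>x\<in>X. finite {V\<in>\<V>. x \<in> V} \<and> card {V\<in>\<V>. x \<in> V} \<le> n + 1"
    using dim unfolding covering_dim_le_def by auto
  define w where "w = (\<lambda>V. Xbar \<inter> retr R -` V)"
  have wo: "openin (top_of_set Xbar) (w V)" if "V \<in> \<V>" for V
    unfolding w_def
    using that \<V>(1) retr_properties(1)[OF R(1)] retr_in[OF R(1)]
    by (intro continuous_openin_preimage[of _ _ X]) (auto simp: open_cover_of_def)
  have wcov: "Xbar \<subseteq> \<Union>(w ` \<V>)"
    using retr_in[OF R(1)] \<V>(1) by (fastforce simp: w_def open_cover_of_def)
  obtain \<W> where \<W>: "\<W> \<subseteq> w ` \<V>" "finite \<W>" "Xbar \<subseteq> \<Union>\<W>"
    using compact_Xbar[unfolded compact_eq_openin_cover, rule_format, of "w ` \<V>"] wo wcov by auto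
  show "\<exists>\<W>. finite \<W> \<and> (\<forall>W\<in>\<W>. openin (top_of_set Xbar) W) \<and> Xbar \<subseteq> \<Union>\<W> \<and>
        (\<forall>y\<in>Xbar. card {W\<in>\<W>. y \<in> W} \<le> n + 1) \<and> (\<forall>W\<in>\<W>. \<forall>x\<in>W. \<forall>y\<in>W. dist x y < e)"
  proof (intro exI[of _ \<W>] conjI ballI)
    show "openin (top_of_set Xbar) W" if "W \<in> \<W>" for W using that \<W>(1) wo by blast
    show "card {W\<in>\<W>. y \<in> W} \<le> n + 1" if y: "y \<in> Xbar" for y
    proof -
      let ?A = "{V\<in>\<V>. retr R y \<in> V}"
      have fin: "finite ?A" "card ?A \<le> n + 1" using \<V>(3) retr_in[OF R(1) y] by auto
      have "{W\<in>\<W>. y \<in> W} \<subseteq> w ` ?A" using \<W>(1) by (auto simp: w_def)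
      then have "card {W\<in>\<W>. y \<in> W} \<le> card (w ` ?A)" using fin by (intro card_mono) auto
      also have "\<dots> \<le> card ?A" using fin by (intro card_image_le)
      finally show ?thesis using fin by simp
    qed
    fix W x y assume W: "W \<in> \<W>" and x: "x \<in> W" and y: "y \<in> W"
    obtain V where V: "V \<in> \<V>" "W = w V" using W \<W>(1) by blast
    obtain z where z: "z \<in> X" "V \<subseteq> X \<inter> ball z (e / 16)" using \<V>(2) V(1) unfolding \<U>_def by blast
    have xY: "x \<in> Xbar" "y \<in> Xbar" and PV: "retr R x \<in> V" "retr R y \<in> V" using x y V by (auto simp: w_def)
    have "dist (retr R x) (retr R y) < e / 8"
    proof -
      have "dist z (retr R x) < e / 16" "dist z (retr R y) < e / 16" using PV z(2) by auto
      then show ?thesis using dist_triangle3[of "retr R x" "retr R y" z] by linarith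
    qed
    then have "dist (emb (retr R x)) (emb (retr R y)) < e / 4"
      using emb_lipschitz[OF retr_in[OF R(1) xY(1)] retr_in[OF R(1) xY(2)]] by linarith
    then show "dist x y < e"
      using near[OF xY(1)] near[OF xY(2)] dist_triangle[of x y "emb (retr R x)"]
        dist_triangle[of "emb (retr R x)" y "emb (retr R y)"] dist_commute[of x "emb (retr R x)"] e by linarith
  qed (use \<W> in auto)
qed

end

section \<open>The compactification is an absolute extensor\<close>

text \<open>The starting index \<open>n0\<close> is there because partial averages are controlled
  only once some weight has become positive.\<close>

lemma geometric_limit:
  fixes s :: "nat \<Rightarrow> 'a::complete_space"
  assumes step: "\<And>n. n0 \<le> n \<Longrightarrow> dist (s (Suc n)) (s n) \<le> K * (1/2) ^ n"
  shows "convergent s" "\<And>n. n0 \<le> n \<Longrightarrow> dist (s n) (lim s) \<le> 2 * K * (1/2) ^ n"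
proof -
  have K: "0 \<le> K * (1/2) ^ n0" using step[of n0] zero_le_dist order_trans by blast
  have K0: "0 \<le> K"
  proof (rule ccontr)
    assume "\<not> 0 \<le> K"
    then have "K * (1/2) ^ n0 < 0" by (intro mult_neg_pos) auto
    then show False using K by simp
  qed
  have far: "dist (s n) (s (n + i)) \<le> 2 * K * (1/2) ^ n * (1 - (1/2) ^ i)" if "n0 \<le> n" for n i
  proof (induction i)
    case (Suc i)
    have "dist (s n) (s (n + Suc i)) \<le> dist (s n) (s (n + i)) + dist (s (Suc (n + i))) (s (n + i))"
      using dist_triangle[of "s n" "s (Suc (n + i))" "s (n + i)"] by (simp add: dist_commute)
    also have "\<dots> \<le> 2 * K * (1/2) ^ n * (1 - (1/2) ^ i) + K * (1/2) ^ (n + i)"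
      using Suc step[of "n + i"] that by (intro add_mono) auto
    also have "\<dots> = 2 * K * (1/2) ^ n * (1 - (1/2) ^ Suc i)" by (simp add: algebra_simps power_add)
    finally show ?case .
  qed simp
  have far': "dist (s n) (s m) \<le> 2 * K * (1/2) ^ n" if "n0 \<le> n" "n \<le> m" for n m
  proof -
    obtain i where "m = n + i" using \<open>n \<le> m\<close> by (metis le_iff_add)
    moreover have "2 * K * (1/2) ^ n * (1 - (1/2) ^ i) \<le> 2 * K * (1/2) ^ n * 1"
      using K0 by (intro mult_left_mono) auto
    ultimately show ?thesis using far[OF that(1), of i] by simp
  qed
  have lim0: "(\<lambda>n. 2 * K * (1/2::real) ^ n) \<longlonglongrightarrow> 0"
    by (intro tendsto_mult_right_zero LIMSEQ_power_zero) auto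
  have "Cauchy s"
  proof (rule metric_CauchyI)
    fix e :: real assume "0 < e"
    then have "\<forall>\<^sub>F n in sequentially. 2 * K * (1/2) ^ n < e / 2"
      using order_tendstoD(2)[OF lim0, of "e / 2"] by simp
    then have "\<forall>\<^sub>F n in sequentially. 2 * K * (1/2) ^ n < e / 2 \<and> n0 \<le> n"
      using eventually_ge_at_top[of n0] by eventually_elim auto
    then obtain N where N: "2 * K * (1/2) ^ N < e / 2" "n0 \<le> N" by (auto simp: eventually_sequentially)
    show "\<exists>N. \<forall>m\<ge>N. \<forall>n\<ge>N. dist (s m) (s n) < e"
    proof (intro exI[of _ N] allI impI)
      fix m n assume "N \<le> m" "N \<le> n"
      then have "dist (s N) (s m) \<le> 2 * K * (1/2) ^ N" "dist (s N) (s n) \<le> 2 * K * (1/2) ^ N"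
        using far' N by auto
      then show "dist (s m) (s n) < e" using N dist_triangle3[of "s m" "s n" "s N"] by linarith
    qed
  qed
  then show conv: "convergent s" by (rule Cauchy_convergent)
  show "dist (s n) (lim s) \<le> 2 * K * (1/2) ^ n" if "n0 \<le> n" for n
  proof (rule tendsto_upperbound)
    show "(\<lambda>m. dist (s n) (s m)) \<longlonglongrightarrow> dist (s n) (lim s)"
      using conv by (intro tendsto_intros) (simp add: convergent_LIMSEQ_iff)
    show "\<forall>\<^sub>F m in sequentially. dist (s n) (s m) \<le> 2 * K * (1/2) ^ n"
      using far'[OF that] by (auto simp: eventually_sequentially)
  qed simp
qed

text \<open>The radius used in extending a map must depend continuously on the distance to
  \<open>A\<close>, so the modulus has to be continuous. An infimum of affine functions is concave,
  hence continuous on the open half line; adding \<open>s\<close> makes it positive.\<close>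

lemma continuous_modulus:
  fixes h :: "'c::metric_space \<Rightarrow> 'd::metric_space"
  assumes A: "compact A" and h: "continuous_on A h"
  shows "\<exists>\<eta>::real \<Rightarrow> real. continuous_on {0<..} \<eta> \<and> (\<forall>s>0. 0 < \<eta> s) \<and> (\<eta> \<longlongrightarrow> 0) (at_right 0) \<and>
    (\<forall>a\<in>A. \<forall>a'\<in>A. \<forall>s>0. dist a a' \<le> s \<longrightarrow> dist (h a) (h a') \<le> \<eta> s)"
proof -
  have "bounded (h ` A)" using compact_continuous_image[OF h A] compact_imp_bounded by blast
  then obtain B0 where B0: "\<forall>x\<in>h ` A. \<forall>y\<in>h ` A. dist x y \<le> B0"
    unfolding bounded_two_points by blast
  define B where "B = max 1 B0"
  have B: "0 < B" "\<And>a a'. \<lbrakk>a \<in> A; a' \<in> A\<rbrakk> \<Longrightarrow> dist (h a) (h a') \<le> B"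
    using B0 by (auto simp: B_def le_max_iff_disj)
  have "\<exists>d>0. \<forall>a\<in>A. \<forall>a'\<in>A. dist a a' < d \<longrightarrow> dist (h a) (h a') < 1 / (real k + 1)" for k :: nat
  proof -
    obtain d where "d > 0" "\<forall>x\<in>A. \<forall>x'\<in>A. dist x' x < d \<longrightarrow> dist (h x') (h x) < 1 / (real k + 1)"
      using compact_uniformly_continuous[OF h A, unfolded uniformly_continuous_on_def, rule_format, of "1 / (real k + 1)"]
      by auto
    then show ?thesis by blast
  qed
  then obtain d where d: "\<And>k. 0 < d k" "\<And>k a a'. \<lbrakk>a \<in> A; a' \<in> A; dist a a' < d k\<rbrakk> \<Longrightarrow> dist (h a) (h a') < 1 / (real k + 1)"
    by metis
  \<comment> \<open>Each of these bounds the variation of \<open>h\<close>: below distance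
    \<open>d k\<close> the constant term suffices, and from \<open>d k\<close> on the linear term is
    at least the global bound \<open>B\<close>.\<close>
  define f where "f = (\<lambda>k s. 1 / (real k + 1) + (B / d k) * s)"
  define I where "I = (\<lambda>s. INF k. f k s)"
  have f0: "0 \<le> f k s" if "0 < s" for k s using that d(1)[of k] B by (simp add: f_def)
  have bdd: "bdd_below (range (\<lambda>k. f k s))" if "0 < s" for s
    using f0[OF that] by (intro bdd_belowI[of _ 0]) auto
  have If: "I s \<le> f k s" if "0 < s" for k s
    unfolding I_def using bdd[OF that] by (intro cINF_lower) auto
  have I0: "0 \<le> I s" if "0 < s" for s
    unfolding I_def using f0[OF that] by (intro cINF_greatest) auto
  have "convex_on {0<..} (\<lambda>s. - I s)"
  proof (rule convex_onI)
    fix t x y :: real assume t: "0 < t" "t < 1" and xy: "x \<in> {0<..}" "y \<in> {0<..}"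
    have "(1 - t) * I x + t * I y \<le> I ((1 - t) *\<^sub>R x + t *\<^sub>R y)"
    proof -
      have "(1 - t) * I x + t * I y \<le> f k ((1 - t) * x + t * y)" for k
      proof -
        have "(1 - t) * I x + t * I y \<le> (1 - t) * f k x + t * f k y"
          using t xy If by (intro add_mono mult_left_mono) auto
        also have "\<dots> = f k ((1 - t) * x + t * y)" by (simp add: f_def algebra_simps add_divide_distrib diff_divide_distrib)
        finally show ?thesis .
      qed
      then have "(1 - t) * I x + t * I y \<le> (INF k. f k ((1 - t) * x + t * y))" by (intro cINF_greatest) auto
      then show ?thesis by (simp add: I_def)
    qed
    then show "- I ((1 - t) *\<^sub>R x + t *\<^sub>R y) \<le> (1 - t) * - I x + t * - I y" by simp
  qed simp
  then have "continuous_on {0<..} (\<lambda>s. - I s)" by (intro convex_on_continuous) auto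
  then have cI: "continuous_on {0<..} I" using continuous_on_minus by fastforce
  show ?thesis
  proof (intro exI[of _ "\<lambda>s. s + I s"] conjI allI ballI impI)
    show "continuous_on {0<..} (\<lambda>s. s + I s)" using cI by (intro continuous_intros)
    show pos: "0 < s + I s" if "0 < s" for s using that I0[OF that] by simp
    show "((\<lambda>s. s + I s) \<longlongrightarrow> 0) (at_right 0)"
    proof (rule order_tendstoI)
      show "\<forall>\<^sub>F s in at_right 0. e < s + I s" if "e < 0" for e
        unfolding eventually_at_right_field using pos that by (intro exI[of _ 1]) force
      fix e :: real assume e: "0 < e"
      obtain k where "inverse (real (Suc k)) < e" using reals_Archimedean[OF e] by blast
      then have k: "1 / (real k + 1) < e" by (simp add: inverse_eq_divide add.commute)
      have "((\<lambda>s. s + f k s) \<longlongrightarrow> 0 + (1 / (real k + 1) + (B / d k) * 0)) (at_right 0)"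
        unfolding f_def by (intro tendsto_intros)
      then have "\<forall>\<^sub>F s in at_right 0. s + f k s < e" using k by (intro order_tendstoD(2)) auto
      moreover have "\<forall>\<^sub>F s::real in at_right 0. 0 < s" by (simp add: eventually_at_right_less)
      ultimately show "\<forall>\<^sub>F s in at_right 0. s + I s < e"
      proof eventually_elim
        case (elim s)
        then show ?case using If[of s k] by linarith
      qed
    qed
    fix a a' s assume a: "a \<in> A" "a' \<in> A" and s: "0 < s" "dist a a' \<le> s"
    have "dist (h a) (h a') \<le> f k s" for k
    proof (cases "dist a a' < d k")
      case True
      then have "dist (h a) (h a') < 1 / (real k + 1)" using d(2) a by blast
      then show ?thesis using s d(1)[of k] B(1) by (simp add: f_def add_increasing2 less_imp_le)
    next
      case False
      then have "B * 1 \<le> B * (s / d k)" using s d(1)[of k] B(1) by (intro mult_left_mono) (auto simp: field_simps)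
      then show ?thesis using B(2)[OF a] by (simp add: f_def add_increasing)
    qed
    then have "dist (h a) (h a') \<le> I s" unfolding I_def by (intro cINF_greatest) auto
    then show "dist (h a) (h a') \<le> s + I s" using s by simp
  qed
qed

section \<open>Infinite averages and extension of maps into \<open>Xbar\<close>\<close>

context conical_space
begin

text \<open>Conicality controls the endpoints and constant speed the parameter.\<close>

lemma tendsto_\<sigma>:
  assumes f: "(f \<longlongrightarrow> x) F" and g: "(g \<longlongrightarrow> y) F" and t: "(t \<longlongrightarrow> t0) F"
    and ev: "\<forall>\<^sub>F q in F. f q \<in> X \<and> g q \<in> X \<and> t q \<in> {0..1}"
    and xy: "x \<in> X" "y \<in> X" "t0 \<in> {0..1}"
  shows "((\<lambda>q. \<sigma> (f q) (g q) (t q)) \<longlongrightarrow> \<sigma> x y t0) F"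
proof (rule tendsto_dist_iff[THEN iffD2], rule tendsto_sandwich[of "\<lambda>_. 0"])
  have "((\<lambda>q. dist (f q) x + dist (g q) y + \<bar>t q - t0\<bar> * dist x y) \<longlongrightarrow> dist x x + dist y y + \<bar>t0 - t0\<bar> * dist x y) F"
    by (intro tendsto_intros f g t)
  then show "((\<lambda>q. dist (f q) x + dist (g q) y + \<bar>t q - t0\<bar> * dist x y) \<longlongrightarrow> 0) F" by simp
  show "\<forall>\<^sub>F q in F. dist (\<sigma> (f q) (g q) (t q)) (\<sigma> x y t0) \<le> dist (f q) x + dist (g q) y + \<bar>t q - t0\<bar> * dist x y"
    using ev
  proof eventually_elim
    case (elim q)
    have "dist (\<sigma> (f q) (g q) (t q)) (\<sigma> x y t0) \<le> dist (\<sigma> (f q) (g q) (t q)) (\<sigma> x y (t q)) + dist (\<sigma> x y (t q)) (\<sigma> x y t0)"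
      by (rule dist_triangle)
    also have "\<dots> \<le> ((1 - t q) * dist (f q) x + t q * dist (g q) y) + \<bar>t q - t0\<bar> * dist x y"
      using \<sigma>_conical[of "f q" "g q" x y "t q"] \<sigma>_dist[of x y "t q" t0] elim xy by simp
    also have "\<dots> \<le> (1 * dist (f q) x + 1 * dist (g q) y) + \<bar>t q - t0\<bar> * dist x y"
      using elim by (intro add_mono mult_right_mono) auto
    finally show ?case by simp
  qed
qed auto

text \<open>The partial averages are \<open>s (Suc n) = \<sigma> (s n) (x (Suc n)) w\<close> with \<open>w\<close> the relative weight of the new point.
  Where all weights up to \<open>n\<close> vanish, \<open>s n\<close> may be discontinuous, but it is then multiplied by
  \<open>1 - w\<close>, which tends to 0 there.\<close>

lemma infinite_conical_combination:
  fixes x :: "nat \<Rightarrow> 'c::metric_space \<Rightarrow> 'a" and L :: "nat \<Rightarrow> 'c \<Rightarrow> real"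
  assumes x: "\<And>i. continuous_on D (x i)" "\<And>i p. p \<in> D \<Longrightarrow> x i p \<in> X"
    and \<rho>: "continuous_on D \<rho>" "\<And>i p. p \<in> D \<Longrightarrow> dist b (x i p) \<le> \<rho> p"
    and L: "\<And>i. continuous_on D (L i)" "\<And>i p. p \<in> D \<Longrightarrow> 0 \<le> L i p" "\<And>p. p \<in> D \<Longrightarrow> \<exists>i. 0 < L i p"
    and M: "continuous_on D M" "\<And>i p. p \<in> D \<Longrightarrow> L i p \<le> M p * (1/2) ^ i"
  shows "\<exists>c. continuous_on D c \<and> (\<forall>p\<in>D. c p \<in> X) \<and>
    (\<forall>p\<in>D. \<forall>z\<in>X. \<forall>e. (\<forall>i. 0 < L i p \<longrightarrow> dist z (x i p) \<le> e) \<longrightarrow> dist z (c p) \<le> e)"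
proof -
  define S where "S = (\<lambda>n p. \<Sum>i\<le>n. L i p)"
  have S_Suc: "S (Suc n) p = S n p + L (Suc n) p" for n p by (simp add: S_def)
  have S0: "0 \<le> S n p" if "p \<in> D" for n p unfolding S_def using L(2)[OF that] by (intro sum_nonneg) auto
  have Smono: "S m p \<le> S n p" if "p \<in> D" "m \<le> n" for m n p
    unfolding S_def using L(2)[OF that(1)] that(2) by (intro sum_mono2) auto
  have Scont: "continuous_on D (S n)" for n unfolding S_def using L(1) by (intro continuous_intros)
  \<comment> \<open>While all weights vanish, division by zero gives \<open>w = 0\<close> and the
    average stays at \<open>x 0\<close>; at the first positive weight after that
    \<open>w = 1\<close> discards it.\<close>
  define w where "w = (\<lambda>n p. L (Suc n) p / S (Suc n) p)"
  have w01: "w n p \<in> {0..1}" if "p \<in> D" for n p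
    unfolding w_def using L(2)[OF that] S0[OF that] by (intro frac_in) (auto simp: S_Suc)
  define s where "s = rec_nat (x 0) (\<lambda>n f p. \<sigma> (f p) (x (Suc n) p) (w n p))"
  have s_0: "s 0 = x 0" and s_Suc: "s (Suc n) p = \<sigma> (s n p) (x (Suc n) p) (w n p)" for n p
    by (auto simp: s_def)
  have sX: "s n p \<in> X \<and> dist b (s n p) \<le> \<rho> p" if "p \<in> D" for n p
  proof (induction n)
    case (Suc n)
    then show ?case
      unfolding s_Suc using \<sigma>_in[OF _ x(2)[OF that] w01[OF that]]
        \<sigma>_convex_ball[OF b_in _ x(2)[OF that] w01[OF that] _ \<rho>(2)[OF that]] by blast
  qed (simp add: s_0 x \<rho> that)
  \<comment> \<open>Positivity of \<open>S n p\<close> excludes the initial stretch where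
    \<open>s n p\<close> is \<open>x 0 p\<close>, a point of weight zero that need not obey the
    bound.\<close>
  have hull: "dist z (s n p) \<le> e"
    if p: "p \<in> D" and z: "z \<in> X" and le: "\<And>i. 0 < L i p \<Longrightarrow> dist z (x i p) \<le> e" and "0 < S n p" for n p z e
    using \<open>0 < S n p\<close>
  proof (induction n)
    case 0
    then show ?case using le by (simp add: s_0 S_def)
  next
    case (Suc n)
    show ?case
    proof (cases "0 < S n p")
      case True
      show ?thesis
      proof (cases "0 < L (Suc n) p")
        case True
        then show ?thesis unfolding s_Suc
          using \<sigma>_convex_ball[OF z _ x(2)[OF p] w01[OF p] Suc.IH[OF \<open>0 < S n p\<close>] le[OF True]] sX[OF p] by blast
      next
        case False
        then have "w n p = 0" using L(2)[OF p, of "Suc n"] by (simp add: w_def)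
        then show ?thesis unfolding s_Suc
          using Suc.IH[OF \<open>0 < S n p\<close>] \<sigma>_0[of "s n p" "x (Suc n) p"] sX[OF p, of n] x(2)[OF p] by simp
      qed
    next
      case False
      then have "S n p = 0" using S0[OF p, of n] by simp
      then have "w n p = 1" "0 < L (Suc n) p" using Suc.prems by (auto simp: w_def S_Suc)
      then show ?thesis unfolding s_Suc
        using le[of "Suc n"] \<sigma>_1[of "s n p" "x (Suc n) p"] sX[OF p, of n] x(2)[OF p] by simp
    qed
  qed
  have cts: "(s n \<longlongrightarrow> s n p) (at p within D)" if p: "p \<in> D" and "0 < S n p" for n p
    using \<open>0 < S n p\<close>
  proof (induction n)
    case 0
    then show ?case using x(1)[of 0] p by (simp add: s_0 continuous_on_def)
  next
    case (Suc n)
    have evD: "\<forall>\<^sub>F q in at p within D. q \<in> D" by (simp add: eventually_at_filter)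
    have wlim: "(w n \<longlongrightarrow> w n p) (at p within D)"
      unfolding w_def using L(1)[of "Suc n"] Scont[of "Suc n"] p Suc.prems
      by (intro tendsto_intros) (auto simp: continuous_on_def)
    have xlim: "(x (Suc n) \<longlongrightarrow> x (Suc n) p) (at p within D)" using x(1) p by (auto simp: continuous_on_def)
    show ?case
    proof (cases "0 < S n p")
      case True
      show ?thesis unfolding s_Suc
      proof (rule tendsto_\<sigma>[OF Suc.IH[OF True] xlim wlim])
        show "\<forall>\<^sub>F q in at p within D. s n q \<in> X \<and> x (Suc n) q \<in> X \<and> w n q \<in> {0..1}"
          using evD
        proof eventually_elim
          case (elim q)
          show ?case using sX[OF elim, of n] x(2)[OF elim] w01[OF elim] by blast
        qed
        show "s n p \<in> X" "x (Suc n) p \<in> X" "w n p \<in> {0..1}" using sX[OF p, of n] x(2)[OF p] w01[OF p] by blast+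
      qed
    next
      case False
      then have "S n p = 0" using S0[OF p, of n] by simp
      then have w1: "w n p = 1" using Suc.prems by (auto simp: w_def S_Suc)
      have sp: "s (Suc n) p = x (Suc n) p" using w1 \<sigma>_1[of "s n p" "x (Suc n) p"] sX[OF p, of n] x(2)[OF p] by (simp add: s_Suc)
      have "((\<lambda>q. dist (s (Suc n) q) (x (Suc n) p)) \<longlongrightarrow> 0) (at p within D)"
      proof (rule tendsto_sandwich[of "\<lambda>_. 0"])
        have "((\<lambda>q. (1 - w n q) * (2 * \<rho> q) + dist (x (Suc n) q) (x (Suc n) p)) \<longlongrightarrow>
            (1 - w n p) * (2 * \<rho> p) + dist (x (Suc n) p) (x (Suc n) p)) (at p within D)"
          using \<rho>(1) p by (intro tendsto_intros wlim xlim) (auto simp: continuous_on_def)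
        then show "((\<lambda>q. (1 - w n q) * (2 * \<rho> q) + dist (x (Suc n) q) (x (Suc n) p)) \<longlongrightarrow> 0) (at p within D)"
          by (simp add: w1)
        show "\<forall>\<^sub>F q in at p within D. dist (s (Suc n) q) (x (Suc n) p) \<le> (1 - w n q) * (2 * \<rho> q) + dist (x (Suc n) q) (x (Suc n) p)"
          using evD
        proof eventually_elim
          case (elim q)
          have "dist (s (Suc n) q) (x (Suc n) q) = (1 - w n q) * dist (s n q) (x (Suc n) q)"
            unfolding s_Suc using dist_\<sigma>_end[OF _ x(2)[OF elim] w01[OF elim]] sX[OF elim, of n] by blast
          also have "\<dots> \<le> (1 - w n q) * (2 * \<rho> q)"
          proof (rule mult_left_mono)
            show "dist (s n q) (x (Suc n) q) \<le> 2 * \<rho> q"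
              using dist_triangle3[of "s n q" "x (Suc n) q" b] sX[OF elim, of n] \<rho>(2)[OF elim, of "Suc n"] by linarith
          qed (use w01[OF elim] in auto)
          finally show ?case using dist_triangle[of "s (Suc n) q" "x (Suc n) p" "x (Suc n) q"] by linarith
        qed
      qed auto
      then show ?thesis unfolding sp by (rule tendsto_dist_iff[THEN iffD2])
    qed
  qed
  \<comment> \<open>The constants \<open>c0\<close>, \<open>m\<close> and \<open>r\<close> are not
    tied to \<open>q\<close>, so that one geometric bound serves a whole neighbourhood and the limit
    is locally uniform.\<close>
  have step: "dist (s (Suc n) q) (s n q) \<le> (m * (2 * r) / c0) * (1/2) ^ n"
    if q: "q \<in> D" and c0: "0 < c0" "c0 \<le> S n q" and m: "M q \<le> m" and r: "\<rho> q \<le> r" for n q c0 m r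
  proof -
    have r0: "0 \<le> r" using sX[OF q, of 0] r zero_le_dist[of b "s 0 q"] by linarith
    have "dist (s (Suc n) q) (s n q) = w n q * dist (s n q) (x (Suc n) q)"
      unfolding s_Suc using dist_\<sigma>_start[OF _ x(2)[OF q] w01[OF q], of "s n q" "Suc n" n] sX[OF q, of n]
      by (simp add: dist_commute)
    also have "\<dots> \<le> (m * (1/2) ^ n / c0) * (2 * r)"
    proof (intro mult_mono)
      have "L (Suc n) q \<le> M q * (1/2) ^ Suc n" using M(2)[OF q] .
      also have "\<dots> \<le> m * (1/2) ^ n"
      proof -
        have "0 \<le> M q" using M(2)[OF q, of 0] L(2)[OF q, of 0] by simp
        then have "M q * (1/2) ^ Suc n \<le> M q * (1/2) ^ n" by (intro mult_left_mono) auto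
        also have "\<dots> \<le> m * (1/2) ^ n" using m by (intro mult_right_mono) auto
        finally show ?thesis .
      qed
      finally have Lm: "L (Suc n) q \<le> m * (1/2) ^ n" .
      have "w n q \<le> L (Suc n) q / c0"
        unfolding w_def using Smono[OF q, of n "Suc n"] c0 L(2)[OF q] by (intro divide_left_mono) auto
      also have "\<dots> \<le> m * (1/2) ^ n / c0" using Lm c0 by (intro divide_right_mono) auto
      finally show "w n q \<le> m * (1/2) ^ n / c0" .
      show "0 \<le> m * (1/2) ^ n / c0" using Lm L(2)[OF q, of "Suc n"] c0 by (intro divide_nonneg_pos) linarith+
      show "dist (s n q) (x (Suc n) q) \<le> 2 * r"
        using dist_triangle3[of "s n q" "x (Suc n) q" b] sX[OF q, of n] \<rho>(2)[OF q, of "Suc n"] r by linarith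
    qed auto
    finally show ?thesis by (simp add: mult_ac)
  qed
  have Spos: "\<exists>n. 0 < S n p" if p: "p \<in> D" for p
  proof -
    obtain i where "0 < L i p" using L(3)[OF p] by blast
    also have "L i p \<le> S i p" unfolding S_def using L(2)[OF p] by (intro member_le_sum) auto
    finally show ?thesis by blast
  qed
  define c where "c = (\<lambda>p. lim (\<lambda>n. s n p))"
  have clim: "(\<lambda>n. s n p) \<longlonglongrightarrow> c p" if p: "p \<in> D" for p
  proof -
    obtain n0 where n0: "0 < S n0 p" using Spos[OF p] by blast
    have "convergent (\<lambda>n. s n p)"
      by (rule geometric_limit(1)[of n0], rule step[OF p n0 Smono[OF p] order_refl order_refl])
    then show ?thesis by (simp add: c_def convergent_LIMSEQ_iff)
  qed
  show ?thesis
  proof (intro exI[of _ c] conjI ballI allI impI)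
    show "c p \<in> X" if p: "p \<in> D" for p
    proof -
      have "c p \<in> X \<inter> cball b (\<rho> p)"
      proof (rule closed_sequentially[OF compact_imp_closed[OF proper] _ clim[OF p]])
        show "s n p \<in> X \<inter> cball b (\<rho> p)" for n using sX[OF p, of n] by simp
      qed
      then show ?thesis by simp
    qed
    show "dist z (c p) \<le> e" if p: "p \<in> D" and z: "z \<in> X" and le: "\<forall>i. 0 < L i p \<longrightarrow> dist z (x i p) \<le> e" for p z e
    proof (rule tendsto_upperbound)
      show "(\<lambda>n. dist z (s n p)) \<longlonglongrightarrow> dist z (c p)" using clim[OF p] by (intro tendsto_intros)
      obtain n0 where n0: "0 < S n0 p" using Spos[OF p] by blast
      show "\<forall>\<^sub>F n in sequentially. dist z (s n p) \<le> e"
        using eventually_ge_at_top[of n0]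
      proof eventually_elim
        case (elim n)
        then have "0 < S n p" using n0 Smono[OF p elim] by linarith
        then show ?case using hull[OF p z, of e n] le by blast
      qed
    qed simp
    show "continuous_on D c"
      unfolding continuous_on_def
    proof (intro ballI tendstoI)
      fix p and e :: real assume p: "p \<in> D" and e: "0 < e"
      obtain n0 where n0: "0 < S n0 p" using Spos[OF p] by blast
      \<comment> \<open>Half the value at \<open>p\<close> remains a lower bound for
        \<open>S n0\<close> near \<open>p\<close>, which keeps the relative weights there under
        control.\<close>
      define c0 where "c0 = S n0 p / 2"
      have c0: "0 < c0" "c0 < S n0 p" using n0 by (auto simp: c0_def)
      define K where "K = (M p + 1) * (2 * (\<rho> p + 1)) / c0"
      have near: "dist (s n q) (c q) \<le> 2 * K * (1/2) ^ n"
        if q: "q \<in> D" "c0 \<le> S n0 q" "M q \<le> M p + 1" "\<rho> q \<le> \<rho> p + 1" and n: "n0 \<le> n" for q n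
      proof -
        have "dist (s (Suc n) q) (s n q) \<le> K * (1/2) ^ n" if "n0 \<le> n" for n
          unfolding K_def using step[OF q(1) c0(1) _ q(3,4)] q(2) Smono[OF q(1) that] by simp
        from geometric_limit(2)[of n0 "\<lambda>n. s n q", OF this n] show ?thesis by (simp add: c_def)
      qed
      have "(\<lambda>n. 2 * K * (1/2::real) ^ n) \<longlonglongrightarrow> 0"
        by (intro tendsto_mult_right_zero LIMSEQ_power_zero) auto
      then have "\<forall>\<^sub>F n in sequentially. 2 * K * (1/2) ^ n < e / 3"
        using e by (intro order_tendstoD(2)[of _ 0]) auto
      then have "\<forall>\<^sub>F n in sequentially. 2 * K * (1/2) ^ n < e / 3 \<and> n0 \<le> n"
        using eventually_ge_at_top[of n0] by eventually_elim auto
      then obtain n where n: "2 * K * (1/2) ^ n < e / 3" "n0 \<le> n" by (auto simp: eventually_sequentially)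
      have evD: "\<forall>\<^sub>F q in at p within D. q \<in> D" by (simp add: eventually_at_filter)
      have "0 < S n p" using n0 Smono[OF p n(2)] by linarith
      then have "\<forall>\<^sub>F q in at p within D. dist (s n q) (s n p) < e / 3"
        using tendstoD[OF cts[OF p], of n "e / 3"] e by simp
      moreover have "\<forall>\<^sub>F q in at p within D. c0 < S n0 q"
        using order_tendstoD(1)[OF Scont[of n0, unfolded continuous_on_def, rule_format, OF p] c0(2)] .
      moreover have "\<forall>\<^sub>F q in at p within D. M q < M p + 1"
        using order_tendstoD(2)[OF M(1)[unfolded continuous_on_def, rule_format, OF p], of "M p + 1"] by simp
      moreover have "\<forall>\<^sub>F q in at p within D. \<rho> q < \<rho> p + 1"
        using order_tendstoD(2)[OF \<rho>(1)[unfolded continuous_on_def, rule_format, OF p], of "\<rho> p + 1"] by simp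
      ultimately show "\<forall>\<^sub>F q in at p within D. dist (c q) (c p) < e"
        using evD
      proof eventually_elim
        case (elim q)
        have "dist (s n q) (c q) \<le> 2 * K * (1/2) ^ n" using elim n by (intro near) auto
        moreover have "dist (s n p) (c p) \<le> 2 * K * (1/2) ^ n" using p n c0 by (intro near) auto
        ultimately show ?case
          using elim n dist_triangle[of "c q" "c p" "s n q"] dist_triangle[of "s n q" "c p" "s n p"] dist_commute[of "c q" "s n q"]
          by linarith
      qed
    qed
  qed
qed

text \<open>In place of a locally finite cover of the complement, all members of a countable dense
  subset of \<open>A\<close> are averaged at once; the factor \<open>(1/2) ^ i\<close> in the
  weights makes this converge. For continuity at \<open>A\<close> the averaged points must be close
  in \<open>X\<close>, where closed balls are convex for \<open>\<sigma>\<close>.\<close>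

theorem Xbar_absolute_extensor:
  fixes h :: "'c::{metric_space,second_countable_topology} \<Rightarrow> 'a ambient"
  assumes A: "compact A" "A \<noteq> {}" and h: "continuous_on A h" "h ` A \<subseteq> Xbar"
  obtains r where "continuous_on UNIV r" "range r \<subseteq> Xbar" "\<And>a. a \<in> A \<Longrightarrow> r a = h a"
proof -
  obtain \<eta> where \<eta>: "continuous_on {0<..} \<eta>" "\<And>s. 0 < s \<Longrightarrow> 0 < \<eta> s" "(\<eta> \<longlongrightarrow> 0) (at_right 0)"
    and h\<eta>: "\<And>a a' s. \<lbrakk>a \<in> A; a' \<in> A; 0 < s; dist a a' \<le> s\<rbrakk> \<Longrightarrow> dist (h a) (h a') \<le> \<eta> s"
  proof -
    from continuous_modulus[OF A(1) h(1)]
    obtain \<eta> :: "real \<Rightarrow> real" where *: "continuous_on {0<..} \<eta>" "\<forall>s>0. 0 < \<eta> s" "(\<eta> \<longlongrightarrow> 0) (at_right 0)"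
      "\<forall>a\<in>A. \<forall>a'\<in>A. \<forall>s>0. dist a a' \<le> s \<longrightarrow> dist (h a) (h a') \<le> \<eta> s" by blast
    show ?thesis by (rule that[of \<eta>]) (use * in auto)
  qed
  obtain T where T: "countable T" "T \<subseteq> A" "A \<subseteq> closure T" using separable by blast
  have "T \<noteq> {}" using T(3) A(2) by auto
  then have rT: "range (from_nat_into T) = T" using T(1) by simp
  define a where "a = from_nat_into T"
  have aA: "a i \<in> A" for i using rT T(2) by (auto simp: a_def)
  define \<delta> where "\<delta> = (\<lambda>p. infdist p A)"
  have clA: "closed A" using A(1) compact_imp_closed by blast
  have \<delta>0: "0 < \<delta> p" if "p \<notin> A" for p
    unfolding \<delta>_def using that clA A(2) infdist_nonneg[of p A] by (metis in_closed_iff_infdist_zero order_le_less)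
  have \<delta>cont: "continuous_on S \<delta>" for S unfolding \<delta>_def by (intro continuous_intros)
  \<comment> \<open>Contributing points of \<open>A\<close> lie within \<open>4 * \<delta> p\<close>
    of each other, so their images under \<open>h\<close> differ by at most the fourth power of
    \<open>q (\<delta> p)\<close>. With \<open>R = 1 / q\<close> the Lipschitz constant of
    \<open>retr R\<close> uses up only two of these four factors.\<close>
  define q where "q = (\<lambda>s. sqrt (sqrt (\<eta> (4 * s))))"
  have q0: "0 < q s" if "0 < s" for s using that \<eta>(2) by (simp add: q_def)
  have q4: "q s ^ 4 = \<eta> (4 * s)" if "0 < s" for s
  proof -
    have "q s ^ 4 = ((q s)\<^sup>2)\<^sup>2" by simp
    also have "\<dots> = \<eta> (4 * s)" using that \<eta>(2)[of "4 * s"] by (simp add: q_def)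
    finally show ?thesis .
  qed
  have qcont: "continuous_on {0<..} q"
    unfolding q_def by (intro continuous_intros continuous_on_compose2[OF \<eta>(1)]) auto
  have qlim: "(q \<longlongrightarrow> 0) (at_right 0)"
  proof -
    have "filterlim (\<lambda>s::real. 4 * s) (at_right 0) (at_right 0)"
    proof -
      have "((\<lambda>s::real. 4 * s) \<longlongrightarrow> 4 * 0) (at_right 0)" by (intro tendsto_intros)
      moreover have "\<forall>\<^sub>F s::real in at_right 0. 4 * s \<in> {0<..} \<and> 4 * s \<noteq> 0"
        using eventually_at_right_less[of "0::real"] by eventually_elim auto
      ultimately show ?thesis by (simp add: filterlim_at)
    qed
    then have "((\<lambda>s. \<eta> (4 * s)) \<longlongrightarrow> 0) (at_right 0)" using filterlim_compose[OF \<eta>(3)] by blast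
    then have "(q \<longlongrightarrow> sqrt (sqrt 0)) (at_right 0)" unfolding q_def by (intro tendsto_intros)
    then show ?thesis by simp
  qed
  define R where "R = (\<lambda>p. 1 / q (\<delta> p))"
  have R0: "0 < R p" if "p \<in> - A" for p using that \<delta>0 q0 by (simp add: R_def)
  have qdcont: "continuous_on (- A) (\<lambda>p. q (\<delta> p))"
    by (rule continuous_on_compose2[OF qcont \<delta>cont]) (use \<delta>0 in auto)
  have Rcont: "continuous_on (- A) R"
    unfolding R_def using q0 \<delta>0 by (intro continuous_intros qdcont) (metis ComplD less_irrefl)
  define x where "x = (\<lambda>i p. retr (R p) (h (a i)))"
  have haY: "h (a i) \<in> Xbar" for i using h(2) aA by blast
  \<comment> \<open>Only points closer than twice the distance to \<open>A\<close> contribute. The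
    factor 2 leaves room for the dense subset: some \<open>a i\<close> lies within less than
    \<open>\<delta> p\<close> of a nearest point of \<open>A\<close>.\<close>
  define L where "L = (\<lambda>i p. (1/2) ^ i * max 0 (2 * \<delta> p - dist p (a i)))"
  have Lpos: "0 < L i p \<longleftrightarrow> dist p (a i) < 2 * \<delta> p" for i p
    by (auto simp: L_def zero_less_mult_iff)
  have Lex: "\<exists>i. 0 < L i p" if p: "p \<in> - A" for p
  proof -
    obtain a1 where a1: "a1 \<in> A" "\<forall>a\<in>A. dist p a1 \<le> dist p a"
    proof -
      have "continuous_on A (dist p)" by (intro continuous_intros)
      then show ?thesis using continuous_attains_inf[OF A, of "dist p"] that by blast
    qed
    have a1\<delta>: "dist p a1 \<le> \<delta> p"
      unfolding \<delta>_def infdist_notempty[OF A(2)] using a1(2) A(2) by (intro cINF_greatest) auto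
    obtain t where t: "t \<in> T" "dist t a1 < \<delta> p"
    proof -
      have "a1 \<in> closure T" "0 < \<delta> p" using a1(1) T(3) \<delta>0[of p] p by auto
      then show ?thesis using that unfolding closure_approachable by blast
    qed
    obtain i where "t = a i" using t(1) rT unfolding a_def by blast
    then have "dist p (a i) < 2 * \<delta> p" using t a1\<delta> dist_triangle2[of p t a1] by simp
    then show ?thesis using Lpos by blast
  qed
  have "\<exists>c. continuous_on (- A) c \<and> (\<forall>p\<in>- A. c p \<in> X) \<and>
    (\<forall>p\<in>- A. \<forall>z\<in>X. \<forall>e. (\<forall>i. 0 < L i p \<longrightarrow> dist z (x i p) \<le> e) \<longrightarrow> dist z (c p) \<le> e)"
  proof (rule infinite_conical_combination[of "- A" x R L "\<lambda>p. 2 * \<delta> p"])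
    show "continuous_on (- A) (x i)" for i
      unfolding continuous_on_iff
    proof (intro ballI allI impI)
      fix p and e :: real assume p: "p \<in> - A" and e: "0 < e"
      obtain d where d: "d > 0" "\<forall>p'\<in>- A. dist p' p < d \<longrightarrow> dist (R p') (R p) < e"
        using Rcont p e unfolding continuous_on_iff by blast
      show "\<exists>d>0. \<forall>p'\<in>- A. dist p' p < d \<longrightarrow> dist (x i p') (x i p) < e"
      proof (intro exI[of _ d] conjI ballI impI d(1))
        fix p' assume p': "p' \<in> - A" "dist p' p < d"
        have "dist (x i p') (x i p) \<le> \<bar>R p' - R p\<bar>"
          unfolding x_def using R0[OF p] R0[OF p'(1)] haY by (intro retr_radius_lipschitz) auto
        then show "dist (x i p') (x i p) < e" using d(2) p' by (fastforce simp: dist_real_def)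
      qed
    qed
    show "x i p \<in> X" if "p \<in> - A" for i p unfolding x_def using R0[OF that] haY by (intro retr_in) auto
    show "dist b (x i p) \<le> R p" if "p \<in> - A" for i p
      using retr_in_ball[of "R p" "h (a i)"] R0[OF that] haY by (simp add: x_def)
    show "continuous_on (- A) (L i)" for i unfolding L_def by (intro continuous_intros \<delta>cont)
    show "0 \<le> L i p" for i p by (simp add: L_def)
    show "L i p \<le> 2 * \<delta> p * (1/2) ^ i" if "p \<in> - A" for i p
      unfolding L_def using \<delta>0[of p] that zero_le_dist[of p "a i"]
      by (subst mult.commute) (intro mult_right_mono, auto)
  qed (use Rcont Lex \<delta>cont in \<open>auto intro!: continuous_intros\<close>)
  then obtain c where c: "continuous_on (- A) c" "\<And>p. p \<in> - A \<Longrightarrow> c p \<in> X"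
    and chull: "\<And>p z e. \<lbrakk>p \<in> - A; z \<in> X; \<forall>i. 0 < L i p \<longrightarrow> dist z (x i p) \<le> e\<rbrakk> \<Longrightarrow> dist z (c p) \<le> e"
    by (elim exE conjE) auto
  define r where "r = (\<lambda>p. if p \<in> A then h p else emb (c p))"
  \<comment> \<open>The first term is the bound on the averaged points, doubled since
    \<open>emb\<close> is 2-Lipschitz; the second bounds the displacement
    \<open>1 / (R + 1)\<close>.\<close>
  define E where "E = (\<lambda>s. 4 * (1 + 2 * q s)\<^sup>2 * (q s)\<^sup>2 + q s)"
  have close: "\<exists>i. dist p (a i) < 2 * \<delta> p \<and> dist (emb (c p)) (h (a i)) \<le> E (\<delta> p)" if p: "p \<in> - A" for p
  proof -
    let ?q = "q (\<delta> p)"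
    have qp: "0 < ?q" using q0 \<delta>0 p by simp
    obtain i where i: "0 < L i p" using Lex[OF p] by blast
    have xX: "x i p \<in> X" unfolding x_def using R0[OF p] haY by (intro retr_in) auto
    have "dist (x i p) (c p) \<le> 2 * (1 + 2 * ?q)\<^sup>2 * ?q\<^sup>2"
    proof (rule chull[OF p xX], intro allI impI)
      fix j assume j: "0 < L j p"
      have "dist (a i) (a j) \<le> 4 * \<delta> p"
        using i j Lpos dist_triangle3[of "a i" "a j" p] by fastforce
      then have "dist (h (a i)) (h (a j)) \<le> ?q ^ 4"
        using h\<eta>[OF aA aA, of "4 * \<delta> p"] q4 \<delta>0[of p] p by simp
      then have "2 * (R p + 2)\<^sup>2 * dist (h (a i)) (h (a j)) \<le> 2 * (R p + 2)\<^sup>2 * ?q ^ 4"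
        by (intro mult_left_mono) auto
      also have "\<dots> = 2 * ((R p + 2) * ?q)\<^sup>2 * ?q\<^sup>2" by (simp add: power_mult_distrib power2_eq_square power4_eq_xxxx)
      also have "(R p + 2) * ?q = 1 + 2 * ?q" using qp by (simp add: R_def field_simps)
      finally have "2 * (R p + 2)\<^sup>2 * dist (h (a i)) (h (a j)) \<le> 2 * (1 + 2 * ?q)\<^sup>2 * ?q\<^sup>2" .
      moreover have "dist (x i p) (x j p) \<le> 2 * (R p + 2)\<^sup>2 * dist (h (a i)) (h (a j))"
        unfolding x_def using R0[OF p] haY by (intro retr_lipschitz) auto
      ultimately show "dist (x i p) (x j p) \<le> 2 * (1 + 2 * ?q)\<^sup>2 * ?q\<^sup>2" by linarith
    qed
    then have 1: "dist (emb (c p)) (emb (x i p)) \<le> 4 * (1 + 2 * ?q)\<^sup>2 * ?q\<^sup>2"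
      using emb_lipschitz[OF c(2)[OF p] xX] by (simp add: dist_commute)
    have "dist (emb (x i p)) (h (a i)) \<le> 1 / (R p + 1)"
      unfolding x_def using R0[OF p] haY by (intro dist_emb_retr) auto
    also have "\<dots> \<le> 1 / R p" using R0[OF p] by (intro divide_left_mono) auto
    also have "\<dots> = ?q" by (simp add: R_def)
    finally have "dist (emb (c p)) (h (a i)) \<le> E (\<delta> p)"
      using 1 dist_triangle[of "emb (c p)" "h (a i)" "emb (x i p)"] by (simp add: E_def)
    then show ?thesis using i Lpos by blast
  qed
  have Elim: "(E \<longlongrightarrow> 0) (at_right 0)"
  proof -
    have "(E \<longlongrightarrow> 4 * (1 + 2 * 0)\<^sup>2 * 0\<^sup>2 + 0) (at_right 0)"
      unfolding E_def by (intro tendsto_intros qlim)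
    then show ?thesis by simp
  qed
  have rA: "isCont r p" if p: "p \<in> A" for p
    unfolding continuous_at_eps_delta
  proof (intro allI impI)
    fix e :: real assume e: "0 < e"
    obtain d1 where d1: "0 < d1" "\<And>a'. \<lbrakk>a' \<in> A; dist a' p < d1\<rbrakk> \<Longrightarrow> dist (h a') (h p) < e / 2"
      using h(1)[unfolded continuous_on_iff, rule_format, OF p, of "e / 2"] e by auto
    have "\<forall>\<^sub>F s in at_right 0. E s < e / 2" using order_tendstoD(2)[OF Elim, of "e / 2"] e by simp
    then obtain d2 where d2: "0 < d2" "\<And>s. \<lbrakk>0 < s; s < d2\<rbrakk> \<Longrightarrow> E s < e / 2"
      unfolding eventually_at_right_field by auto
    show "\<exists>d>0. \<forall>p'. dist p' p < d \<longrightarrow> dist (r p') (r p) < e"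
    \<comment> \<open>The chosen \<open>a i\<close> is closer to \<open>p'\<close> than
      \<open>2 * \<delta> p'\<close>, and \<open>\<delta> p'\<close> is at most
      \<open>dist p' p\<close>; so it is within three times that distance of
      \<open>p\<close>.\<close>
    proof (intro exI[of _ "min (d1 / 3) d2"] conjI allI impI)
      show "0 < min (d1 / 3) d2" using d1 d2 by simp
      fix p' assume d: "dist p' p < min (d1 / 3) d2"
      show "dist (r p') (r p) < e"
      proof (cases "p' \<in> A")
        case True
        then have "dist (h p') (h p) < e / 2" using d1 d by (intro d1(2)) auto
        then show ?thesis using True p e by (simp add: r_def)
      next
        case False
        then obtain i where i: "dist p' (a i) < 2 * \<delta> p'" "dist (emb (c p')) (h (a i)) \<le> E (\<delta> p')"
          using close[of p'] by auto
        have \<delta>p: "\<delta> p' \<le> dist p' p" unfolding \<delta>_def using p by (intro infdist_le)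
        have "dist (a i) p < d1"
          using i(1) \<delta>p d dist_triangle3[of "a i" p p'] by simp
        then have "dist (h (a i)) (h p) < e / 2" using d1(2) aA by blast
        moreover have "E (\<delta> p') < e / 2" using \<delta>p d \<delta>0[OF False] by (intro d2(2)) auto
        ultimately show ?thesis
          using i(2) False p dist_triangle[of "emb (c p')" "h p" "h (a i)"] by (simp add: r_def)
      qed
    qed
  qed
  have rD: "isCont r p" if p: "p \<in> - A" for p
  proof -
    have "continuous_on (- A) (\<lambda>p. emb (c p))"
      by (rule continuous_on_compose2[OF continuous_emb c(1)]) (use c(2) in auto)
    then have "continuous_on (- A) r"
      by (rule continuous_on_eq) (simp add: r_def)
    then show ?thesis using p clA by (simp add: continuous_on_eq_continuous_at open_Compl)
  qed
  show ?thesis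
  proof
    show "continuous_on UNIV r" using rA rD by (auto simp: continuous_on_eq_continuous_at)
    show "range r \<subseteq> Xbar" using h(2) c(2) emb_in emb_image_subset_Xbar by (auto simp: r_def)
    show "r a = h a" if "a \<in> A" for a using that by (simp add: r_def)
  qed
qed

text \<open>The inverse of the embedding is extended over the whole product space
  \<open>nat \<Rightarrow> real\<close>; composing back with the embedding and restricting gives the
  retraction.\<close>

theorem euclidean_retract_Xbar:
  assumes dim: "covering_dim_le (top_of_set X) n"
  shows "euclidean_retract (top_of_set Xbar)"
proof -
  obtain f :: "'a ambient \<Rightarrow> nat \<Rightarrow> real" where f: "continuous_on Xbar f" "inj_on f Xbar" "\<And>y i. 2 * (n + 1) < i \<Longrightarrow> f y i = 0"
    using embedding_of_fine_covers[OF compact_Xbar fine_covers_Xbar[OF dim]] by metis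
  \<comment> \<open>Covers of order \<open>k = n + 1\<close> give the coordinates 0 to
    \<open>2 * k\<close>, which are \<open>2 * k + 1\<close> in number.\<close>
  let ?E = "Euclidean_space (2 * (n + 1) + 1)"
  define A where "A = f ` Xbar"
  obtain g where g: "homeomorphism Xbar A f g"
    using homeomorphism_compact[OF compact_Xbar f(1) A_def[symmetric] f(2)] by blast
  have AE: "A \<subseteq> topspace ?E" using f(3) by (auto simp: A_def topspace_Euclidean_space)
  have "b \<in> X" by (rule b_in)
  then have Ane: "A \<noteq> {}" using emb_in emb_image_subset_Xbar by (auto simp: A_def)
  have subE: "subtopology ?E A = top_of_set A"
    using AE by (simp add: Euclidean_space_def euclidean_product_topology[symmetric] subtopology_subtopology Int_absorb1 topspace_Euclidean_space)
  obtain r where r: "continuous_on UNIV r" "range r \<subseteq> Xbar" "\<And>a. a \<in> A \<Longrightarrow> r a = g a"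
  proof (rule Xbar_absolute_extensor[of A g])
    show "compact A" unfolding A_def by (rule compact_continuous_image[OF f(1) compact_Xbar])
    show "continuous_on A g" "g ` A \<subseteq> Xbar" using g by (auto simp: homeomorphism_def)
  qed (use Ane in auto)
  have "A retract_of_space ?E"
    unfolding retract_of_space_def
  proof (intro conjI exI[of _ "f \<circ> r"] AE ballI)
    have "continuous_on UNIV (f \<circ> r)"
      using continuous_on_compose[OF r(1)] continuous_on_subset[OF f(1) r(2)] by blast
    then have "continuous_map euclidean (top_of_set A) (f \<circ> r)"
      using r(2) by (auto simp: continuous_map_in_subtopology A_def)
    then show "continuous_map ?E (subtopology ?E A) (f \<circ> r)"
      unfolding subE by (simp add: Euclidean_space_def euclidean_product_topology[symmetric] continuous_map_from_subtopology)
    show "(f \<circ> r) a = a" if "a \<in> A" for a using that r(3) g by (auto simp: homeomorphism_def)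
  qed
  moreover have "top_of_set Xbar homeomorphic_space subtopology ?E A"
    unfolding subE homeomorphic_space_def homeomorphic_maps_def using g
    by (intro exI[of _ f] exI[of _ g]) (auto simp: homeomorphism_def continuous_map_in_subtopology)
  ultimately show ?thesis unfolding euclidean_retract_def by blast
qed

end

section \<open>The group action\<close>

lemma isometry_continuous_map:
  assumes "f \<in> mspace m \<rightarrow> mspace m'"
    and "\<And>x y. \<lbrakk>x \<in> mspace m; y \<in> mspace m\<rbrakk> \<Longrightarrow> mdist m' (f x) (f y) = mdist m x y"
  shows "continuous_map (mtopology_of m) (mtopology_of m') f"
  unfolding mtopology_of_def
    Metric_space.metric_continuous_map[OF Metric_space_mspace_mdist Metric_space_mspace_mdist]
proof (intro conjI ballI allI impI)
  show "f ` mspace m \<subseteq> mspace m'" using assms(1) by auto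
  show "\<exists>\<delta>>0. \<forall>x. x \<in> mspace m \<and> mdist m a x < \<delta> \<longrightarrow> mdist m' (f a) (f x) < \<epsilon>"
    if "a \<in> mspace m" "0 < \<epsilon>" for a \<epsilon>
    using that assms(2) by (intro exI[of _ \<epsilon>]) auto
qed

lemma isometry_homeomorphic_maps:
  assumes f: "f \<in> mspace m \<rightarrow> mspace m'" and h: "h \<in> mspace m' \<rightarrow> mspace m"
    and hf: "\<And>x. x \<in> mspace m \<Longrightarrow> h (f x) = x" and fh: "\<And>y. y \<in> mspace m' \<Longrightarrow> f (h y) = y"
    and iso: "\<And>x y. \<lbrakk>x \<in> mspace m; y \<in> mspace m\<rbrakk> \<Longrightarrow> mdist m' (f x) (f y) = mdist m x y"
  shows "homeomorphic_maps (mtopology_of m) (mtopology_of m') f h"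
proof -
  have "mdist m (h x) (h y) = mdist m' x y" if "x \<in> mspace m'" "y \<in> mspace m'" for x y
  proof -
    have "h x \<in> mspace m" "h y \<in> mspace m" using h that by auto
    then show ?thesis using iso[of "h x" "h y"] fh that by simp
  qed
  then show ?thesis
    unfolding homeomorphic_maps_def
    using isometry_continuous_map[OF f iso] isometry_continuous_map[OF h] hf fh by simp
qed

text \<open>This identifies the topology of the metric transported to \<open>emb_image\<close> with
  the subspace topology from \<open>Xbar\<close>.\<close>

lemma homeomorphic_maps_topology_unique:
  assumes 1: "homeomorphic_maps T T1 f h" and 2: "homeomorphic_maps T T2 f h"
  shows "T1 = T2"
proof -
  have *: "openin T2 V" if 1: "homeomorphic_maps T T1 f h" and 2: "homeomorphic_maps T T2 f h" and V: "openin T1 V" for T1 T2 V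
  proof -
    have "f ` topspace T = topspace T1" "f ` topspace T = topspace T2"
      using 1 2 by (auto simp: homeomorphic_maps_map dest: homeomorphic_imp_surjective_map)
    then have top: "topspace T1 = topspace T2" by simp
    have "continuous_map T2 T1 (f \<circ> h)"
      using 1 2 unfolding homeomorphic_maps_def by (blast intro: continuous_map_compose)
    then have "openin T2 {y \<in> topspace T2. (f \<circ> h) y \<in> V}" using V unfolding continuous_map_def by blast
    moreover have "{y \<in> topspace T2. (f \<circ> h) y \<in> V} = V"
      using 2 openin_subset[OF V] top unfolding homeomorphic_maps_def by auto
    ultimately show ?thesis by simp
  qed
  show ?thesis unfolding topology_eq using *[OF 1 2] *[OF 2 1] by blast
qed

lemma geometric_action_transfer:
  assumes geo: "geometric_action G m \<phi>"
    and f: "f \<in> mspace m \<rightarrow> mspace m'" and h: "h \<in> mspace m' \<rightarrow> mspace m"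
    and hf: "\<And>x. x \<in> mspace m \<Longrightarrow> h (f x) = x" and fh: "\<And>y. y \<in> mspace m' \<Longrightarrow> f (h y) = y"
    and iso: "\<And>x y. \<lbrakk>x \<in> mspace m; y \<in> mspace m\<rbrakk> \<Longrightarrow> mdist m' (f x) (f y) = mdist m x y"
  shows "geometric_action G m' (\<lambda>g. \<lambda>y\<in>mspace m'. f (\<phi> g (h y)))"
proof -
  let ?\<phi> = "\<lambda>g. \<lambda>y\<in>mspace m'. f (\<phi> g (h y))"
  have act: "group_action G (mspace m) \<phi>"
    using geo by (simp add: geometric_action_def isometric_action_def)
  have \<phi>in: "\<phi> g x \<in> mspace m" if "g \<in> carrier G" "x \<in> mspace m" for g x
    using group_action.element_image[OF act that refl] .
  have hm: "homeomorphic_maps (mtopology_of m) (mtopology_of m') f h"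
    by (rule isometry_homeomorphic_maps[OF f h hf fh iso])
  have \<phi>f: "?\<phi> g (f x) = f (\<phi> g x)" if "x \<in> mspace m" for g x
    using that f hf[OF that] by (auto simp: Pi_iff)
  show ?thesis
    unfolding geometric_action_def
  proof (intro conjI)
    show "isometric_action G m' ?\<phi>"
      unfolding isometric_action_def
    proof (intro conjI ballI)
      show "group_action G (mspace m') ?\<phi>" by (rule group_action_transfer[OF act f h hf fh])
      fix g x y assume g: "g \<in> carrier G" and xy: "x \<in> mspace m'" "y \<in> mspace m'"
      have hx: "h x \<in> mspace m" "h y \<in> mspace m" using h xy by auto
      have "mdist m' (?\<phi> g x) (?\<phi> g y) = mdist m (\<phi> g (h x)) (\<phi> g (h y))"
        using xy iso[OF \<phi>in[OF g hx(1)] \<phi>in[OF g hx(2)]] by simp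
      also have "\<dots> = mdist m (h x) (h y)"
        using geo g hx unfolding geometric_action_def isometric_action_def by blast
      also have "\<dots> = mdist m' x y" using iso[OF hx] fh xy by simp
      finally show "mdist m' (?\<phi> g x) (?\<phi> g y) = mdist m' x y" .
    qed
    show "proper_action G (mtopology_of m') ?\<phi>"
      unfolding proper_action_def
    proof (intro allI impI)
      fix K assume K: "compactin (mtopology_of m') K"
      then have KE: "K \<subseteq> mspace m'" using compactin_subset_topspace by fastforce
      have "compactin (mtopology_of m) (h ` K)"
        using K hm image_compactin unfolding homeomorphic_maps_def by blast
      then have "finite {g \<in> carrier G. \<phi> g ` (h ` K) \<inter> h ` K \<noteq> {}}"
        using geo unfolding geometric_action_def proper_action_def by blast
      moreover have "{g \<in> carrier G. ?\<phi> g ` K \<inter> K \<noteq> {}} \<subseteq> {g \<in> carrier G. \<phi> g ` (h ` K) \<inter> h ` K \<noteq> {}}"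
      proof -
        have "\<phi> g ` (h ` K) \<inter> h ` K \<noteq> {}" if g: "g \<in> carrier G" and x: "x \<in> K" "?\<phi> g x \<in> K" for g x
        proof -
          have xm: "x \<in> mspace m'" using x(1) KE by blast
          then have hx: "h x \<in> mspace m" using h by blast
          have "h (?\<phi> g x) = \<phi> g (h x)" using xm hf[OF \<phi>in[OF g hx]] by simp
          then have "\<phi> g (h x) \<in> h ` K" using imageI[OF x(2), of h] by simp
          then have "\<phi> g (h x) \<in> \<phi> g ` h ` K \<inter> h ` K" using x(1) by blast
          then show ?thesis by blast
        qed
        then show ?thesis by blast
      qed
      ultimately show "finite {g \<in> carrier G. ?\<phi> g ` K \<inter> K \<noteq> {}}" by (rule rev_finite_subset)
    qed
    show "cocompact_action G (mtopology_of m') ?\<phi>"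
    proof -
      let ?Q = "quotient_topology (mtopology_of m) (orbit G \<phi>)"
      let ?Q' = "quotient_topology (mtopology_of m') (orbit G ?\<phi>)"
      have orb: "f ` orbit G \<phi> x = orbit G ?\<phi> (f x)" if "x \<in> mspace m" for x
      proof -
        have "orbit G ?\<phi> (f x) = {f (\<phi> g x) | g. g \<in> carrier G}"
          unfolding orbit_def \<phi>f[OF that] ..
        then show ?thesis by (auto simp: orbit_def)
      qed
      have "continuous_map (mtopology_of m) ?Q' (orbit G ?\<phi> \<circ> f)"
        by (rule continuous_map_compose[OF isometry_continuous_map[OF f iso]
              quotient_imp_continuous_map[OF quotient_map_quotient_topology]])
      then have "continuous_map (mtopology_of m) ?Q' ((`) f \<circ> orbit G \<phi>)"
        by (rule continuous_map_eq) (simp add: orb)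
      then have "continuous_map ?Q ?Q' ((`) f)"
        using continuous_compose_quotient_map[OF quotient_map_quotient_topology] by blast
      moreover have "(`) f ` topspace ?Q = topspace ?Q'"
      proof -
        have "(`) f ` topspace ?Q = orbit G ?\<phi> ` (f ` mspace m)"
          unfolding topspace_quotient_topology image_image topspace_mtopology_of
          by (intro image_cong refl orb)
        moreover have "f ` mspace m = mspace m'"
        proof
          show "mspace m' \<subseteq> f ` mspace m"
          proof
            fix y assume "y \<in> mspace m'"
            then show "y \<in> f ` mspace m" using fh[of y] h by (intro image_eqI[of _ _ "h y"]) auto
          qed
        qed (use f in auto)
        ultimately show ?thesis by simp
      qed
      moreover have "compact_space ?Q"
        using geo by (simp add: geometric_action_def cocompact_action_def)
      ultimately have "compact_space ?Q'"
        unfolding compact_space_def using image_compactin[of ?Q "topspace ?Q" ?Q' "(`) f"] by simp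
      then show ?thesis by (simp add: cocompact_action_def)
    qed
  qed
qed

lemma continuous_agree_on_closure:
  fixes f g :: "'a::topological_space \<Rightarrow> 'b::metric_space"
  assumes "continuous_on (closure S) f" "continuous_on (closure S) g"
    and "\<And>x. x \<in> S \<Longrightarrow> f x = g x" and "x \<in> closure S"
  shows "f x = g x"
proof -
  have "dist (f x) (g x) = 0"
  proof (rule continuous_constant_on_closure[of S "\<lambda>x. dist (f x) (g x)"])
    show "continuous_on (closure S) (\<lambda>x. dist (f x) (g x))" using assms(1,2) by (intro continuous_intros)
  qed (use assms(3,4) in auto)
  then show ?thesis by simp
qed

section \<open>Extension of the action to the boundary\<close>

context conical_space
begin

text \<open>Each group element extends by uniform continuity, and the action laws pass from the
  dense copy of \<open>X\<close> to its closure. The laws provide the inverses, so the extensions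
  are homeomorphisms.\<close>

lemma extend_action:
  fixes G (structure) and \<phi> :: "'g \<Rightarrow> 'a \<Rightarrow> 'a"
  assumes G: "group G"
    and in_X: "\<And>g x. \<lbrakk>g \<in> carrier G; x \<in> X\<rbrakk> \<Longrightarrow> \<phi> g x \<in> X"
    and one: "\<And>x. x \<in> X \<Longrightarrow> \<phi> \<one> x = x"
    and mult: "\<And>g g' x. \<lbrakk>g \<in> carrier G; g' \<in> carrier G; x \<in> X\<rbrakk> \<Longrightarrow> \<phi> (g \<otimes> g') x = \<phi> g (\<phi> g' x)"
    and iso: "\<And>g x y. \<lbrakk>g \<in> carrier G; x \<in> X; y \<in> X\<rbrakk> \<Longrightarrow> dist (\<phi> g x) (\<phi> g y) = dist x y"
    and equi: "\<And>g x y t. \<lbrakk>g \<in> carrier G; x \<in> X; y \<in> X; t \<in> {0..1}\<rbrakk> \<Longrightarrow> \<phi> g (\<sigma> x y t) = \<sigma> (\<phi> g x) (\<phi> g y) t"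
  shows "\<exists>\<psi>. group_action G Xbar \<psi> \<and> (\<forall>g\<in>carrier G. homeomorphic_map (top_of_set Xbar) (top_of_set Xbar) (\<psi> g)) \<and>
    (\<forall>g\<in>carrier G. \<forall>u\<in>emb_image. \<psi> g u = emb (\<phi> g (emb_inv u)))"
proof -
  interpret group G by (rule G)
  have "\<exists>e. continuous_on Xbar e \<and> (\<forall>u\<in>emb_image. e u = emb (\<phi> g (emb_inv u)))" if g: "g \<in> carrier G" for g
  proof -
    have "uniformly_continuous_on emb_image (\<lambda>u. emb (\<phi> g (emb_inv u)))"
      by (rule isometry_emb_uniform[OF in_X[OF g] iso[OF g] equi[OF g]])
    then obtain e where e: "uniformly_continuous_on (closure emb_image) e" "\<And>u. u \<in> emb_image \<Longrightarrow> emb (\<phi> g (emb_inv u)) = e u"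
      by (rule uniformly_continuous_on_extension_on_closure) blast
    have "continuous_on Xbar e" using e(1) by (simp add: Xbar_def uniformly_continuous_imp_continuous)
    then show ?thesis using e(2) by (intro exI[of _ e]) simp
  qed
  then have "\<exists>e. \<forall>g\<in>carrier G. continuous_on Xbar (e g) \<and> (\<forall>u\<in>emb_image. e g u = emb (\<phi> g (emb_inv u)))"
    by (intro bchoice ballI)
  then obtain e where ee: "\<forall>g\<in>carrier G. continuous_on Xbar (e g) \<and> (\<forall>u\<in>emb_image. e g u = emb (\<phi> g (emb_inv u)))" ..
  have e: "continuous_on Xbar (e g)" if "g \<in> carrier G" for g using ee that by blast
  have eU: "e g u = emb (\<phi> g (emb_inv u))" if "g \<in> carrier G" "u \<in> emb_image" for g u using ee that by blast
  have eU': "e g u \<in> emb_image" if "g \<in> carrier G" "u \<in> emb_image" for g u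
    unfolding eU[OF that] by (intro emb_in in_X emb_inv_in that)
  have eY: "e g y \<in> Xbar" if "g \<in> carrier G" "y \<in> Xbar" for g y
  proof -
    have "e g ` closure emb_image \<subseteq> Xbar"
      using e[OF that(1)] eU'[OF that(1)] emb_image_subset_Xbar
      by (intro image_closure_subset) (auto simp: Xbar_def)
    then show ?thesis using that by (auto simp: Xbar_def)
  qed
  have e1: "e \<one> y = y" if "y \<in> Xbar" for y
  proof (rule continuous_agree_on_closure[of emb_image "e \<one>" "\<lambda>y. y"])
    show "continuous_on (closure emb_image) (e \<one>)" using e[of \<one>] by (simp add: Xbar_def)
    show "e \<one> u = u" if "u \<in> emb_image" for u using that eU one emb_inv_in by simp
  qed (use that in \<open>auto simp: Xbar_def\<close>)
  have emult: "e (g \<otimes> g') y = e g (e g' y)" if g: "g \<in> carrier G" "g' \<in> carrier G" and y: "y \<in> Xbar" for g g' y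
  proof (rule continuous_agree_on_closure[of emb_image "e (g \<otimes> g')" "\<lambda>y. e g (e g' y)"])
    show "continuous_on (closure emb_image) (e (g \<otimes> g'))" using e[of "g \<otimes> g'"] g by (simp add: Xbar_def)
    show "continuous_on (closure emb_image) (\<lambda>y. e g (e g' y))"
      using continuous_on_compose2[OF e[OF g(1)] e[OF g(2)]] eY[OF g(2)] by (auto simp: Xbar_def)
    show "e (g \<otimes> g') u = e g (e g' u)" if u: "u \<in> emb_image" for u
    proof -
      have "e g (e g' u) = emb (\<phi> g (emb_inv (emb (\<phi> g' (emb_inv u)))))"
        using eU[OF g(1) eU'[OF g(2) u]] eU[OF g(2) u] by simp
      also have "\<dots> = emb (\<phi> g (\<phi> g' (emb_inv u)))" using in_X[OF g(2) emb_inv_in[OF u]] by simp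
      also have "\<dots> = e (g \<otimes> g') u" using eU[OF m_closed[OF g] u] mult[OF g emb_inv_in[OF u]] by simp
      finally show ?thesis by simp
    qed
  qed (use y in \<open>auto simp: Xbar_def\<close>)
  \<comment> \<open>\<open>Bij\<close> contains extensional functions only, hence the restriction to
    \<open>Xbar\<close>.\<close>
  define \<psi> where "\<psi> = (\<lambda>g. \<lambda>y\<in>Xbar. e g y)"
  have inv1: "e (inv g) (e g y) = y" "e g (e (inv g) y) = y" if "g \<in> carrier G" "y \<in> Xbar" for g y
    using emult[of "inv g" g y] emult[of g "inv g" y] e1[of y] that l_inv[of g] r_inv[of g] inv_closed[of g] by simp_all
  have Bij: "\<psi> g \<in> Bij Xbar" if g: "g \<in> carrier G" for g
  proof -
    have "bij_betw (\<psi> g) Xbar Xbar"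
      unfolding \<psi>_def
      by (rule bij_betw_byWitness[where f' = "e (inv g)"]) (use eY inv1 g in auto)
    then show ?thesis by (simp add: Bij_def \<psi>_def)
  qed
  have hom: "\<psi> (g \<otimes> g') = compose Xbar (\<psi> g) (\<psi> g')" if "g \<in> carrier G" "g' \<in> carrier G" for g g'
  proof
    fix y show "\<psi> (g \<otimes> g') y = compose Xbar (\<psi> g) (\<psi> g') y"
      using emult[OF that, of y] eY[OF that(2), of y] by (simp add: \<psi>_def compose_def)
  qed
  have ga: "group_action G Xbar \<psi>"
    unfolding group_action_def group_hom_def group_hom_axioms_def
    using G group_BijGroup[of Xbar] Bij hom by (auto simp: hom_def BijGroup_def)
  have hm: "homeomorphic_map (top_of_set Xbar) (top_of_set Xbar) (\<psi> g)" if g: "g \<in> carrier G" for g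
  proof -
    have c: "continuous_on Xbar (\<psi> g)" if "g \<in> carrier G" for g
      using e[OF that] unfolding \<psi>_def by (rule continuous_on_eq) simp
    have "homeomorphic_maps (top_of_set Xbar) (top_of_set Xbar) (\<psi> g) (\<psi> (inv g))"
      unfolding homeomorphic_maps_def using c[OF g] c[of "inv g"] g eY inv1
      by (auto simp: continuous_map_in_subtopology \<psi>_def)
    then show ?thesis using homeomorphic_map_maps by blast
  qed
  show ?thesis
  proof (intro exI[of _ \<psi>] conjI ballI)
    show "\<psi> g u = emb (\<phi> g (emb_inv u))" if "g \<in> carrier G" "u \<in> emb_image" for g u
      using eU[OF that] emb_image_subset_Xbar that(2) by (auto simp: \<psi>_def)
  qed (fact ga, fact hm)
qed

end

section \<open>Reduction to subsets of a complete metric space\<close>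

text \<open>An isometric embedding that replaces an abstract carrier by a subset of a complete type.
  Subtracting the distance to \<open>b\<close> keeps the functions bounded, and the value 0 off the
  carrier adds nothing to distances.\<close>

definition kuratowski :: "'a metric \<Rightarrow> 'a \<Rightarrow> 'a \<Rightarrow> ('a discrete, real) bcontfun" where
  "kuratowski m b x = Bcontfun (\<lambda>z. if of_discrete z \<in> mspace m
     then mdist m x (of_discrete z) - mdist m b (of_discrete z) else 0)"

lemma dist_kuratowski:
  assumes b: "b \<in> mspace m" and x: "x \<in> mspace m" and y: "y \<in> mspace m"
  shows "dist (kuratowski m b x) (kuratowski m b y) = mdist m x y"
proof -
  interpret Metric_space "mspace m" "mdist m" by (rule Metric_space_mspace_mdist)
  let ?f = "\<lambda>x z. if z \<in> mspace m then mdist m x z - mdist m b z else 0"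
  have diff: "\<bar>mdist m u z - mdist m v z\<bar> \<le> mdist m u v" if "u \<in> mspace m" "v \<in> mspace m" "z \<in> mspace m" for u v z
    using triangle[OF that(1,2,3)] triangle[OF that(2,1,3)] commute[of u v] by linarith
  have app: "apply_bcontfun (kuratowski m b u) p = ?f u (of_discrete p)" if u: "u \<in> mspace m" for u p
  proof -
    have "(\<lambda>p. ?f u (of_discrete p)) \<in> bcontfun"
    proof (rule bcontfun_normI)
      show "continuous_on UNIV (\<lambda>p. ?f u (of_discrete p))"
        by (simp add: continuous_on_open_vimage open_discrete)
      show "norm (?f u (of_discrete p)) \<le> mdist m u b" for p using diff[OF u b] by simp
    qed
    then show ?thesis by (simp add: kuratowski_def Bcontfun_inverse)
  qed
  show ?thesis
  proof (rule antisym)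
    show "dist (kuratowski m b x) (kuratowski m b y) \<le> mdist m x y"
      using diff[OF x y] by (intro dist_bound) (auto simp: app x y dist_real_def)
    have "dist (kuratowski m b x (discrete y)) (kuratowski m b y (discrete y)) = mdist m x y"
      using x y by (simp add: app discrete_inverse dist_real_def)
    then show "mdist m x y \<le> dist (kuratowski m b x) (kuratowski m b y)"
      using dist_bounded[of "kuratowski m b x" "discrete y" "kuratowski m b y"] by simp
  qed
qed

lemma homeomorphic_maps_covering_dim_le:
  assumes hm: "homeomorphic_maps S T f h" and dim: "covering_dim_le S n"
  shows "covering_dim_le T n"
  unfolding covering_dim_le_def
proof (intro allI impI)
  have cf: "continuous_map S T f" and ch: "continuous_map T S h"
    and hf: "\<And>x. x \<in> topspace S \<Longrightarrow> h (f x) = x" and fh: "\<And>y. y \<in> topspace T \<Longrightarrow> f (h y) = y"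
    using hm unfolding homeomorphic_maps_def by auto
  have fS: "\<And>x. x \<in> topspace S \<Longrightarrow> f x \<in> topspace T" and hT: "\<And>y. y \<in> topspace T \<Longrightarrow> h y \<in> topspace S"
    using cf ch by (auto simp: continuous_map_def)
  fix \<U> assume \<U>: "open_cover_of T \<U>"
  define \<U>' where "\<U>' = (\<lambda>U. {x \<in> topspace S. f x \<in> U}) ` \<U>"
  have "open_cover_of S \<U>'"
    using \<U> cf fS unfolding open_cover_of_def \<U>'_def by (auto simp: continuous_map_def)
  then obtain \<V> where \<V>: "open_cover_of S \<V>" "\<forall>V\<in>\<V>. \<exists>U\<in>\<U>'. V \<subseteq> U"
    "\<forall>x\<in>topspace S. finite {V\<in>\<V>. x \<in> V} \<and> card {V\<in>\<V>. x \<in> V} \<le> n + 1"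
    using dim unfolding covering_dim_le_def by auto
  define w where "w = (\<lambda>V. {y \<in> topspace T. h y \<in> V})"
  show "\<exists>\<V>. open_cover_of T \<V> \<and> (\<forall>V\<in>\<V>. \<exists>U\<in>\<U>. V \<subseteq> U) \<and>
      (\<forall>x\<in>topspace T. finite {V \<in> \<V>. x \<in> V} \<and> card {V \<in> \<V>. x \<in> V} \<le> n + 1)"
  proof (intro exI[of _ "w ` \<V>"] conjI ballI)
    show "open_cover_of T (w ` \<V>)"
      using \<V>(1) ch hT unfolding open_cover_of_def w_def by (auto simp: continuous_map_def)
    show "\<exists>U\<in>\<U>. W \<subseteq> U" if W: "W \<in> w ` \<V>" for W
    proof -
      obtain V where V: "V \<in> \<V>" "W = w V" using W by blast
      obtain U where "U \<in> \<U>" "V \<subseteq> {x \<in> topspace S. f x \<in> U}" using \<V>(2) V(1) unfolding \<U>'_def by blast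
      moreover then have "W \<subseteq> U" using V(2) fh unfolding w_def by fastforce
      ultimately show ?thesis by blast
    qed
    fix y assume y: "y \<in> topspace T"
    let ?A = "{V \<in> \<V>. h y \<in> V}"
    have A: "finite ?A" "card ?A \<le> n + 1" using \<V>(3) hT[OF y] by auto
    have eq: "{W \<in> w ` \<V>. y \<in> W} = w ` ?A" using y by (auto simp: w_def)
    show "finite {W \<in> w ` \<V>. y \<in> W}" unfolding eq using A by simp
    show "card {W \<in> w ` \<V>. y \<in> W} \<le> n + 1" unfolding eq using A card_image_le[of ?A w] by linarith
  qed
qed

text \<open>Consistency equates images of paths only. The parameter is recovered from the distance
  to \<open>x\<close>, which determines it on a geodesic of positive length; constant segments are
  treated separately.\<close>

lemma consistent_bicombing_initial:
  assumes bic: "geodesic_bicombing m \<sigma>" and cons: "consistent_bicombing m \<sigma>"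
    and x: "x \<in> mspace m" and y: "y \<in> mspace m" and s: "s \<in> {0..1}" and t: "t \<in> {0..1}"
  shows "\<sigma> x (\<sigma> x y t) s = \<sigma> x y (s * t)"
proof -
  interpret Metric_space "mspace m" "mdist m" by (rule Metric_space_mspace_mdist)
  have geo: "constant_speed_geodesic m (\<sigma> u v) u v" if "u \<in> mspace m" "v \<in> mspace m" for u v
    using bic that by (simp add: geodesic_bicombing_def)
  have in_m: "\<sigma> u v r \<in> mspace m" if "u \<in> mspace m" "v \<in> mspace m" "r \<in> {0..1}" for u v r
    using geo[OF that(1,2)] that(3) by (auto simp: constant_speed_geodesic_def)
  have d0: "mdist m u (\<sigma> u v r) = r * mdist m u v" if "u \<in> mspace m" "v \<in> mspace m" "r \<in> {0..1}" for u v r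
  proof -
    have *: "\<forall>s\<in>{0..1}. \<forall>t\<in>{0..1}. mdist m (\<sigma> u v s) (\<sigma> u v t) = \<bar>s - t\<bar> * mdist m u v" "\<sigma> u v 0 = u"
      using geo[OF that(1,2)] unfolding constant_speed_geodesic_def by blast+
    show ?thesis using *(1)[rule_format, of 0 r] *(2) that(3) by simp
  qed
  have start: "\<sigma> x y 0 = x" using geo[OF x y] by (simp add: constant_speed_geodesic_def)
  have st: "s * t \<in> {0..1}" using s t by (auto intro: mult_le_one)
  show ?thesis
  proof (cases "mdist m x y = 0 \<or> t = 0")
    case True
    have "mdist m x (\<sigma> x y t) = 0" using d0[OF x y t] True by auto
    then have "\<sigma> x y t = x" using zero[OF x in_m[OF x y t]] by simp
    moreover have "\<sigma> x x s = x" using d0[OF x x s] zero[OF x in_m[OF x x s]] x by simp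
    moreover have "\<sigma> x y (s * t) = x" using d0[OF x y st] zero[OF x in_m[OF x y st]] True by auto
    ultimately show ?thesis by simp
  next
    case False
    then have t0: "0 < t" "t \<le> 1" using t by auto
    have "\<sigma> (\<sigma> x y 0) (\<sigma> x y t) ` {0..1} = \<sigma> x y ` {0..t}"
      using cons x y t0 unfolding consistent_bicombing_def by blast
    then have "\<sigma> x (\<sigma> x y t) s \<in> \<sigma> x y ` {0..t}" using s start by (metis imageI)
    then obtain u where u: "u \<in> {0..t}" "\<sigma> x (\<sigma> x y t) s = \<sigma> x y u" by blast
    have "u * mdist m x y = s * (t * mdist m x y)"
      using d0[OF x in_m[OF x y t] s] d0[OF x y, of u] d0[OF x y t] u t0 by auto
    then have "u = s * t" using False by simp
    then show ?thesis using u by simp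
  qed
qed

theorem theorem1:
  fixes G :: "('g, 'k) monoid_scheme"
    and m :: "'a metric"
    and \<phi> :: "'g \<Rightarrow> 'a \<Rightarrow> 'a"
    and \<sigma> :: "'a \<Rightarrow> 'a \<Rightarrow> real \<Rightarrow> 'a"
  assumes "group G"
    and "mspace m \<noteq> {}"
    and "finite_dimensional (mtopology_of m)"
    and "proper_metric_space m"
    and "geodesic_metric_space m"
    and "geometric_action G m \<phi>"
    and "geodesic_bicombing m \<sigma>"
    and "consistent_bicombing m \<sigma>"
    and "conical_bicombing m \<sigma>"
    and "equivariant_bicombing G m \<phi> \<sigma>"
  shows "admits_EZ_structure G"
proof -
  define M where "M = mspace m"
  obtain o' where o': "o' \<in> M" using assms(2) by (auto simp: M_def)
  obtain n where dim: "covering_dim_le (mtopology_of m) n"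
    using assms(3) by (auto simp: finite_dimensional_def)
  have act: "group_action G M \<phi>"
    and \<phi>iso: "\<And>g x y. \<lbrakk>g \<in> carrier G; x \<in> M; y \<in> M\<rbrakk> \<Longrightarrow> mdist m (\<phi> g x) (\<phi> g y) = mdist m x y"
    and prp: "proper_action G (mtopology_of m) \<phi>"
    using assms(6) by (auto simp: geometric_action_def isometric_action_def M_def)
  have \<phi>M: "\<phi> g x \<in> M" if "g \<in> carrier G" "x \<in> M" for g x
    using group_action.element_image[OF act that refl] .
  have geo: "constant_speed_geodesic m (\<sigma> x y) x y" if "x \<in> M" "y \<in> M" for x y
    using assms(7) that by (simp add: geodesic_bicombing_def M_def)
  have \<sigma>M: "\<sigma> x y t \<in> M" if "x \<in> M" "y \<in> M" "t \<in> {0..1}" for x y t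
    using geo[OF that(1,2)] that(3) by (auto simp: constant_speed_geodesic_def M_def)
  define j where "j = kuratowski m o'"
  define X where "X = j ` M"
  have dj: "dist (j x) (j y) = mdist m x y" if "x \<in> M" "y \<in> M" for x y
    using dist_kuratowski[of o' m x y] o' that by (simp add: j_def M_def)
  have jinj: "inj_on j M"
  proof
    fix x y assume "x \<in> M" "y \<in> M" "j x = j y"
    then show "x = y" using dj[of x y] by (simp add: M_def Metric_space.zero[OF Metric_space_mspace_mdist])
  qed
  define k where "k = inv_into M j"
  have kj: "k (j x) = x" if "x \<in> M" for x using that jinj by (simp add: k_def)
  have jk: "j (k u) = u" and kM: "k u \<in> M" if "u \<in> X" for u using that kj by (auto simp: X_def)
  have jX: "j x \<in> X" if "x \<in> M" for x using that by (simp add: X_def)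
  have dk: "mdist m (k u) (k v) = dist u v" if "u \<in> X" "v \<in> X" for u v
    using dj[OF kM kM] jk that by simp
  have hmj: "homeomorphic_maps (mtopology_of m) (top_of_set X) j k"
  proof -
    have "homeomorphic_maps (mtopology_of m) (mtopology_of (submetric euclidean_metric X)) j k"
      by (rule isometry_homeomorphic_maps) (use jX kM kj jk dj in \<open>auto simp: M_def\<close>)
    then show ?thesis by (simp add: mtopology_of_submetric)
  qed
  define \<sigma>' where "\<sigma>' = (\<lambda>u v t. j (\<sigma> (k u) (k v) t))"
  define b where "b = j o'"
  interpret C: conical_space X \<sigma>' b
  proof
    show "b \<in> X" using o' jX by (simp add: b_def)
    show "compact (X \<inter> cball b r)" for r
    proof -
      have "compactin (mtopology_of m) (mcball_of m o' r)"
        using assms(4) o' by (simp add: proper_metric_space_def M_def)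
      then have "compactin (top_of_set X) (j ` mcball_of m o' r)"
        using hmj image_compactin unfolding homeomorphic_maps_def by blast
      moreover have "j ` mcball_of m o' r = X \<inter> cball b r"
        using o' dj by (auto simp: X_def b_def M_def)
      ultimately show ?thesis by (simp add: compactin_subtopology)
    qed
    fix x y s t assume x: "x \<in> X" and y: "y \<in> X"
    show "\<sigma>' x y 0 = x" "\<sigma>' x y 1 = y"
      using geo[OF kM[OF x] kM[OF y]] jk x y by (auto simp: \<sigma>'_def constant_speed_geodesic_def)
    assume t: "t \<in> {0..1::real}"
    show \<sigma>X: "\<sigma>' x y t \<in> X" using \<sigma>M[OF kM[OF x] kM[OF y] t] jX by (simp add: \<sigma>'_def)
    assume s: "s \<in> {0..1::real}"
    show "dist (\<sigma>' x y s) (\<sigma>' x y t) = \<bar>s - t\<bar> * dist x y"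
    proof -
      have "dist (\<sigma>' x y s) (\<sigma>' x y t) = mdist m (\<sigma> (k x) (k y) s) (\<sigma> (k x) (k y) t)"
        unfolding \<sigma>'_def using \<sigma>M[OF kM[OF x] kM[OF y]] s t by (intro dj) auto
      also have "\<dots> = \<bar>s - t\<bar> * mdist m (k x) (k y)"
        using geo[OF kM[OF x] kM[OF y]] s t unfolding constant_speed_geodesic_def by blast
      finally show ?thesis using dk x y by simp
    qed
    show "\<sigma>' x (\<sigma>' x y t) s = \<sigma>' x y (s * t)"
      using consistent_bicombing_initial[OF assms(7,8), of "k x" "k y" s t] kM[OF x] kM[OF y] s t
        kj[OF \<sigma>M[OF kM[OF x] kM[OF y] t]] by (simp add: \<sigma>'_def M_def)
  next
    fix x y x' y' and t :: real
    assume "x \<in> X" "y \<in> X" "x' \<in> X" "y' \<in> X" and t: "t \<in> {0..1}"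
    note kk = this(1-4)[THEN kM] and ks = this(1-4)
    have "dist (\<sigma>' x y t) (\<sigma>' x' y' t) = mdist m (\<sigma> (k x) (k y) t) (\<sigma> (k x') (k y') t)"
      unfolding \<sigma>'_def using \<sigma>M kk t by (intro dj) auto
    also have "\<dots> \<le> (1 - t) * mdist m (k x) (k x') + t * mdist m (k y) (k y')"
      using assms(9) kk t unfolding conical_bicombing_def M_def by blast
    finally show "dist (\<sigma>' x y t) (\<sigma>' x' y' t) \<le> (1 - t) * dist x x' + t * dist y y'"
      using dk ks by simp
  qed
  define f where "f = (\<lambda>x. C.emb (j x))"
  define h where "h = (\<lambda>u. k (C.emb_inv u))"
  have fM: "f x \<in> C.emb_image" if "x \<in> M" for x using that jX C.emb_in by (simp add: f_def)
  have hU: "h u \<in> M" if "u \<in> C.emb_image" for u using that kM C.emb_inv_in by (simp add: h_def)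
  have hf: "h (f x) = x" if "x \<in> M" for x using that jX kj by (simp add: f_def h_def)
  have fh: "f (h u) = u" if "u \<in> C.emb_image" for u using that jk C.emb_inv_in by (simp add: f_def h_def)
  \<comment> \<open>The original metric is transported here, because the action is isometric for it
    but in general not for the metric of the ambient space.\<close>
  define m' where "m' = metric (C.emb_image, \<lambda>u v. mdist m (h u) (h v))"
  have MS: "Metric_space C.emb_image (\<lambda>u v. mdist m (h u) (h v))"
  proof -
    interpret Metric_space M "mdist m" unfolding M_def by (rule Metric_space_mspace_mdist)
    show ?thesis
    proof
      show "(mdist m (h u) (h v) = 0) = (u = v)" if "u \<in> C.emb_image" "v \<in> C.emb_image" for u v
        using that hU zero[of "h u" "h v"] fh by metis
    qed (auto simp: commute intro!: triangle hU)
  qed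
  have m'U: "mspace m' = C.emb_image" and m'd: "mdist m' u v = mdist m (h u) (h v)" for u v
    using Metric_space.mspace_metric[OF MS] Metric_space.mdist_metric[OF MS] by (auto simp: m'_def)
  have m'iso: "mdist m' (f x) (f y) = mdist m x y" if "x \<in> M" "y \<in> M" for x y
    using that hf by (simp add: m'd)
  define \<phi>' where "\<phi>' = (\<lambda>g. \<lambda>u\<in>C.emb_image. f (\<phi> g (h u)))"
  have geo': "geometric_action G m' \<phi>'"
    unfolding \<phi>'_def m'U[symmetric]
    by (rule geometric_action_transfer[OF assms(6)]) (use fM hU hf fh m'iso in \<open>auto simp: m'U M_def\<close>)
  have hmU: "homeomorphic_maps (mtopology_of m) (top_of_set C.emb_image) f h"
  proof -
    have "homeomorphic_maps (top_of_set X) (top_of_set C.emb_image) C.emb C.emb_inv"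
      unfolding homeomorphic_maps_def
      using C.continuous_emb C.continuous_emb_inv C.emb_in C.emb_inv_in by (auto simp: continuous_map_in_subtopology)
    from homeomorphic_maps_compose[OF conjI[OF hmj this]] show ?thesis by (simp add: f_def h_def o_def)
  qed
  have mtop': "mtopology_of m' = top_of_set C.emb_image"
  proof (rule homeomorphic_maps_topology_unique[OF _ hmU])
    show "homeomorphic_maps (mtopology_of m) (mtopology_of m') f h"
      by (rule isometry_homeomorphic_maps) (use fM hU hf fh m'iso in \<open>auto simp: m'U M_def\<close>)
  qed
  have YU: "C.Xbar - (C.Xbar - C.emb_image) = C.emb_image" using C.emb_image_subset_Xbar by blast
  have subYU: "subtopology (top_of_set C.Xbar) C.emb_image = top_of_set C.emb_image"
    using C.emb_image_subset_Xbar by (simp add: subtopology_subtopology Int_absorb1)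
  have dimX: "covering_dim_le (top_of_set X) n"
    by (rule homeomorphic_maps_covering_dim_le[OF hmj dim])
  have null: "finite {g \<in> carrier G. \<not> (\<exists>V\<in>\<V>. \<phi>' g ` K \<subseteq> V)}"
    if K: "compactin (top_of_set C.emb_image) K" and \<V>: "open_cover_of (top_of_set C.Xbar) \<V>" for K \<V>
  proof -
    have KU: "K \<subseteq> C.emb_image" using K by (simp add: compactin_subtopology)
    define K0 where "K0 = h ` K"
    have K0M: "K0 \<subseteq> M" using KU hU by (auto simp: K0_def)
    have cK0: "compactin (mtopology_of m) K0"
      using K hmU image_compactin unfolding K0_def homeomorphic_maps_def by blast
    have cjK: "compact (j ` K0)"
    proof -
      have "compactin (top_of_set X) (j ` K0)"
        using cK0 hmj image_compactin unfolding homeomorphic_maps_def by blast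
      then show ?thesis by (simp add: compactin_subtopology)
    qed
    obtain D where D: "0 \<le> D" "\<And>x y. \<lbrakk>x \<in> K0; y \<in> K0\<rbrakk> \<Longrightarrow> mdist m x y \<le> D"
    proof -
      obtain D0 where D0: "\<forall>u\<in>j ` K0. \<forall>v\<in>j ` K0. dist u v \<le> D0"
        using compact_imp_bounded[OF cjK] unfolding bounded_two_points by blast
      show ?thesis
      proof (rule that[of "max 0 D0"])
        show "mdist m x y \<le> max 0 D0" if "x \<in> K0" "y \<in> K0" for x y
          using D0 dj[of x y] K0M that by force
      qed simp
    qed
    obtain T where T: "\<And>V. V \<in> \<V> \<Longrightarrow> open (T V) \<and> V = C.Xbar \<inter> T V"
      using \<V> unfolding open_cover_of_def openin_open by metis
    \<comment> \<open>A Lebesgue number turns membership in one element of the cover into a bound on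
      distances.\<close>
    have "\<exists>e>0. \<forall>y\<in>C.Xbar. \<exists>W\<in>T ` \<V>. ball y e \<subseteq> W"
    proof (rule Heine_Borel_lemma[OF C.compact_Xbar, of "T ` \<V>"])
      show "C.Xbar \<subseteq> \<Union>(T ` \<V>)"
      proof
        fix y assume "y \<in> C.Xbar"
        then obtain V where "V \<in> \<V>" "y \<in> V" using \<V> by (auto simp: open_cover_of_def)
        then show "y \<in> \<Union>(T ` \<V>)" using T[of V] by blast
      qed
      show "open W" if "W \<in> T ` \<V>" for W using that T by blast
    qed blast
    then obtain e where e: "0 < e" "\<And>y. y \<in> C.Xbar \<Longrightarrow> \<exists>W\<in>T ` \<V>. ball y e \<subseteq> W" by blast
    obtain R where R: "0 < R" "\<And>x y. \<lbrakk>x \<in> X; y \<in> X; R \<le> dist b x; R \<le> dist b y; dist x y \<le> D\<rbrakk> \<Longrightarrow> dist (C.emb x) (C.emb y) < e"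
      using C.emb_null[OF D(1) e(1)] by blast
    \<comment> \<open>Adding the ball of radius \<open>R\<close> lets properness do the work: a
      \<open>g\<close> that moves \<open>K1\<close> off itself moves \<open>K0\<close> outside this
      ball, where \<open>R\<close> was chosen so that sets of diameter at most \<open>D\<close>
      become small.\<close>
    define K1 where "K1 = K0 \<union> mcball_of m o' R"
    have "compactin (mtopology_of m) K1"
      unfolding K1_def using cK0 assms(4) o' by (intro compactin_Un) (auto simp: proper_metric_space_def M_def)
    then have fin: "finite {g \<in> carrier G. \<phi> g ` K1 \<inter> K1 \<noteq> {}}"
      using prp by (simp add: proper_action_def)
    have "\<exists>V\<in>\<V>. \<phi>' g ` K \<subseteq> V" if g: "g \<in> carrier G" and off: "\<phi> g ` K1 \<inter> K1 = {}" for g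
    proof (cases "K = {}")
      case True
      have "\<V> \<noteq> {}" using \<V> fM[OF o'] C.emb_image_subset_Xbar by (auto simp: open_cover_of_def)
      then show ?thesis using True by auto
    next
      case False
      then obtain u0 where u0: "u0 \<in> K" by blast
      have far: "R \<le> dist b (j (\<phi> g x))" if "x \<in> K0" for x
      proof -
        have "\<phi> g x \<notin> mcball_of m o' R" using off that by (auto simp: K1_def)
        then show ?thesis using \<phi>M[OF g, of x] K0M that o' dj[OF o', of "\<phi> g x"]
          by (auto simp: b_def M_def)
      qed
      have close: "dist (\<phi>' g u0) (\<phi>' g u) < e" if u: "u \<in> K" for u
      proof -
        have x: "h u0 \<in> K0" "h u \<in> K0" using u u0 by (auto simp: K0_def)
        then have xM: "h u0 \<in> M" "h u \<in> M" using K0M by auto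
        have "dist (C.emb (j (\<phi> g (h u0)))) (C.emb (j (\<phi> g (h u)))) < e"
        proof (rule R(2))
          show "dist (j (\<phi> g (h u0))) (j (\<phi> g (h u))) \<le> D"
            using dj[OF \<phi>M[OF g xM(1)] \<phi>M[OF g xM(2)]] \<phi>iso[OF g xM] D(2)[OF x] by simp
        qed (use far x jX \<phi>M[OF g] xM in auto)
        then show ?thesis using u u0 KU by (auto simp: \<phi>'_def f_def subset_iff)
      qed
      have in_Y: "\<phi>' g u \<in> C.Xbar" if "u \<in> K" for u
        using that KU fM[OF \<phi>M[OF g hU]] C.emb_image_subset_Xbar by (auto simp: \<phi>'_def subset_iff)
      obtain V where V: "V \<in> \<V>" "ball (\<phi>' g u0) e \<subseteq> T V" using e(2)[OF in_Y[OF u0]] by blast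
      have "\<phi>' g u \<in> V" if "u \<in> K" for u
        using close[OF that] V in_Y[OF that] T[OF V(1)] by auto
      then show ?thesis using V(1) by blast
    qed
    then have "{g \<in> carrier G. \<not> (\<exists>V\<in>\<V>. \<phi>' g ` K \<subseteq> V)} \<subseteq> {g \<in> carrier G. \<phi> g ` K1 \<inter> K1 \<noteq> {}}" by blast
    then show ?thesis using fin by (rule finite_subset)
  qed
  define \<phi>X where "\<phi>X = (\<lambda>g u. j (\<phi> g (k u)))"
  have "\<exists>\<psi>. group_action G C.Xbar \<psi> \<and> (\<forall>g\<in>carrier G. homeomorphic_map (top_of_set C.Xbar) (top_of_set C.Xbar) (\<psi> g)) \<and>
    (\<forall>g\<in>carrier G. \<forall>u\<in>C.emb_image. \<psi> g u = C.emb (\<phi>X g (C.emb_inv u)))"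
  proof (rule C.extend_action[OF assms(1)])
    interpret A: group_action G M \<phi> by (rule act)
    show "\<phi>X g x \<in> X" if "g \<in> carrier G" "x \<in> X" for g x
      using that \<phi>M kM jX by (simp add: \<phi>X_def)
    show "\<phi>X \<one>\<^bsub>G\<^esub> x = x" if "x \<in> X" for x
      using A.id_eq_one[symmetric] that kM jk by (simp add: \<phi>X_def)
    show "\<phi>X (g \<otimes>\<^bsub>G\<^esub> g') x = \<phi>X g (\<phi>X g' x)" if "g \<in> carrier G" "g' \<in> carrier G" "x \<in> X" for g g' x
      using that A.composition_rule[OF kM[OF that(3)] that(1,2)] kj[OF \<phi>M[OF that(2) kM[OF that(3)]]] by (simp add: \<phi>X_def)
    show "dist (\<phi>X g x) (\<phi>X g y) = dist x y" if "g \<in> carrier G" "x \<in> X" "y \<in> X" for g x y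
      using that dj[OF \<phi>M \<phi>M] \<phi>iso kM dk by (simp add: \<phi>X_def)
    show "\<phi>X g (\<sigma>' x y t) = \<sigma>' (\<phi>X g x) (\<phi>X g y) t" if "g \<in> carrier G" "x \<in> X" "y \<in> X" "t \<in> {0..1}" for g x y t
    proof -
      have "\<phi> g (\<sigma> (k x) (k y) t) = \<sigma> (\<phi> g (k x)) (\<phi> g (k y)) t"
        using assms(10) that kM unfolding equivariant_bicombing_def M_def by blast
      then show ?thesis using that kM kj \<sigma>M \<phi>M by (simp add: \<phi>X_def \<sigma>'_def)
    qed
  qed
  then obtain \<psi> where \<psi>: "group_action G C.Xbar \<psi>" "\<forall>g\<in>carrier G. homeomorphic_map (top_of_set C.Xbar) (top_of_set C.Xbar) (\<psi> g)"
    "\<forall>g\<in>carrier G. \<forall>u\<in>C.emb_image. \<psi> g u = C.emb (\<phi>X g (C.emb_inv u))" by blast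
  have \<psi>\<phi>: "\<psi> g u = \<phi>' g u" if "g \<in> carrier G" "u \<in> C.emb_image" for g u
    using \<psi>(3) that by (simp add: \<phi>'_def \<phi>X_def f_def h_def)
  have "EZ_structure G (top_of_set C.Xbar) (C.Xbar - C.emb_image) \<phi>'"
    unfolding EZ_structure_def topspace_euclidean_subtopology YU subYU
  proof (intro conjI allI impI)
    show "compact_space (top_of_set C.Xbar)" using C.compact_Xbar by (simp add: compact_space_subtopology)
    show "compactin (top_of_set C.Xbar) (C.Xbar - C.emb_image)"
    proof (rule closedin_compact_space)
      show "compact_space (top_of_set C.Xbar)" using C.compact_Xbar by (simp add: compact_space_subtopology)
      show "closedin (top_of_set C.Xbar) (C.Xbar - C.emb_image)" using C.openin_emb_image by (simp add: closedin_diff)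
    qed
    show "\<exists>m. mspace m = C.emb_image \<and> mtopology_of m = top_of_set C.emb_image \<and> geometric_action G m \<phi>'"
      using m'U mtop' geo' by blast
    show "euclidean_retract (top_of_set C.Xbar)" by (rule C.euclidean_retract_Xbar[OF dimX])
    show "Z_set (top_of_set C.Xbar) (C.Xbar - C.emb_image)" by (rule C.Z_set_boundary)
    show "finite {g \<in> carrier G. \<not> (\<exists>V\<in>\<V>. \<phi>' g ` K \<subseteq> V)}"
      if "compactin (top_of_set C.emb_image) K \<and> open_cover_of (top_of_set C.Xbar) \<V>" for K \<V>
      using null that by blast
    show "\<exists>\<psi>. group_action G C.Xbar \<psi> \<and> (\<forall>g\<in>carrier G. homeomorphic_map (top_of_set C.Xbar) (top_of_set C.Xbar) (\<psi> g)) \<and>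
      (\<forall>g\<in>carrier G. \<forall>x\<in>C.emb_image. \<psi> g x = \<phi>' g x)"
      using \<psi>(1,2) \<psi>\<phi> by blast
  qed
  then show ?thesis by (rule EZ_structure_imp_admits)
qed

end
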